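(* Let $\Delta \colon \mathbb{C}[x_1, \dots, x_k]_{d} \to \mathbb{C}$ be a metapolynomial of format $(\delta,d,k)$ computed by an algebraic circuit of size $s$. Then: (1) For every weight $\mu\in\mathbb{N}^k$ with $|\mu|=d\delta$, the projection of $\Delta$ onto the weight space of weight $\mu$ can be computed by a circuit of size $O(s(\delta d)^{2k^3})$. (2) For every partition $\lambda$ of $d\delta$ (with at most $k$ parts), the projection of $\Delta$ onto the $\lambda$-isotypic component can be computed by a circuit of size $O(s\,k^{2k^2}(\delta d)^{2k^3})$. (3) For every partition $\lambda$ of $d\delta$ (with at most $k$ parts), the projection of $\Delta$ onto the highest weight space of weight $\lambda$ can be computed by a circuit of size $O(s(k+1)^{2k^2}(\delta d)^{2k^3})$. (4) For every semistandard tableau $T$ of shape $\lambda$, $\lambda$ a partition of $d\delta$ (with at most $k$ parts) and entries in $\{1,\dots,k\}$, the projection of $\Delta$ onto the $T$-isotypic space can be computed by a circuit of size $O(s\,k^{2k^2}(\delta d)^{2k^4})$.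
   Context: Work over $\mathbb{C}$. $\mathbb{C}[x_1,\ldots,x_k]_d$ is the space of homogeneous degree-$d$ polynomials in $x_1,\dots,x_k$. For each monomial $x^{\bm i}=x_1^{i_1}\cdots x_k^{i_k}$ of degree $d$ there is a metavariable $c_{\bm i}$ (the linear function sending a polynomial to the coefficient of $x^{\bm i}$), of degree 1 and weight $\bm i\in\mathbb{N}^k$. A metapolynomial of format $(\delta,d,k)$ is a homogeneous degree-$\delta$ polynomial in these metavariables; the weight of a metamonomial is the sum of the weights of its metavariables, and the weight-$\mu$ space is the span of metamonomials of weight $\mu$. Algebraic circuits: directed acyclic graphs whose input gates are labeled by affine linear metapolynomials, computation gates by $+$ or $\times$ (fan-in 2), edges by complex scalars; size is the number of vertices. $\mathrm{GL}_k$ acts on $\mathbb{C}[x_1,\ldots,x_k]_d$ by $(g\cdot f)(x)=f(g^{-1}x)$ and on metapolynomials by $(g\cdot\Delta)(f)=\Delta(g^{-1}\cdot f)$. The space of metapolynomials of format $(\delta,d,k)$ decomposes as a direct sum of $\mathrm{GL}_k$-stable isotypic components indexed by partitions $\lambda$ of $\delta d$ with at most $k$ parts; each $\lambda$-isotypic component further decomposes into $T$-isotypic components indexed by semistandard tableaux $T$ of shape $\lambda$ with entries in $\{1,\dots,k\}$ (Gelfand–Tsetlin decomposition along $\mathfrak{gl}_1\subset\cdots\subset\mathfrak{gl}_k$). For $T$ the superstandard tableau of shape $\lambda$ (only the number $j$ in row $j$), the $T$-isotypic component is the highest weight space of weight $\lambda$, i.e. metapolynomials $\Delta$ with $g\cdot\Delta=t_1^{\lambda_1}\cdots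 t_k^{\lambda_k}\Delta$ for every upper triangular $g\in\mathrm{GL}_k$ with diagonal $t_1,\dots,t_k$. Projections are the canonical ones with respect to these direct sum decompositions. *)

theory Defs
  imports
    Complex_Main
    "HOL-Library.Poly_Mapping"
    "HOL-Library.Multiset"
    "HOL-Library.Function_Algebras"
    "Jordan_Normal_Form.Gauss_Jordan_Elimination"
begin

section \<open>Polynomials and metapolynomials\<close>

text \<open>
  Variables are indexed from 0, so the \<open>k\<close> variables are those with index in \<open>{..<k}\<close>.
  Exponent vectors in \<open>\<nat>\<^sup>k\<close> are finitely supported functions with support in \<open>{..<k}\<close>.
\<close>

type_synonym expvec = "nat \<Rightarrow>\<^sub>0 nat"
type_synonym cpoly = "expvec \<Rightarrow>\<^sub>0 complex"

definition expvecs :: "nat \<Rightarrow> nat \<Rightarrow> expvec set" where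
  "expvecs d k =
    {i. Poly_Mapping.keys i \<subseteq> {..<k} \<and> (\<Sum>a\<in>Poly_Mapping.keys i. Poly_Mapping.lookup i a) = d}"

text \<open>
  A metapolynomial is represented by the function it induces on polynomials. A metapolynomial of
  format \<open>(\<delta>, d, k)\<close> reads only coefficients of monomials in \<^term>\<open>expvecs d k\<close>, so the function on
  all of \<open>cpoly\<close> and its restriction to the homogeneous polynomials of degree \<open>d\<close> in
  \<open>k\<close> variables determine each other.
\<close>

type_synonym metapoly = "cpoly \<Rightarrow> complex"

definition mscale :: "complex \<Rightarrow> metapoly \<Rightarrow> metapoly" where
  "mscale c \<Delta> = (\<lambda>f. c * \<Delta> f)"

interpretation meta: vector_space mscale
  by unfold_locales (auto simp: mscale_def fun_eq_iff algebra_simps)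

definition metavar :: "expvec \<Rightarrow> metapoly" where
  "metavar i = (\<lambda>f. Poly_Mapping.lookup f i)"

definition metamonomial :: "expvec multiset \<Rightarrow> metapoly" where
  "metamonomial M = (\<Prod>i\<in>#M. metavar i)"

definition metamonomial_weight :: "expvec multiset \<Rightarrow> expvec" where
  "metamonomial_weight M = \<Sum>\<^sub># M"

definition metapolys :: "nat \<Rightarrow> nat \<Rightarrow> nat \<Rightarrow> metapoly set" where
  "metapolys \<delta> d k =
    meta.span {metamonomial M | M. size M = \<delta> \<and> set_mset M \<subseteq> expvecs d k}"

definition weight_space :: "nat \<Rightarrow> nat \<Rightarrow> nat \<Rightarrow> expvec \<Rightarrow> metapoly set" where
  "weight_space \<delta> d k \<mu> =
    meta.span {metamonomial M | M. size M = \<delta> \<and> set_mset M \<subseteq> expvecs d k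
      \<and> metamonomial_weight M = \<mu>}"

definition affine_metapolys :: "nat \<Rightarrow> nat \<Rightarrow> metapoly set" where
  "affine_metapolys d k =
    {(\<lambda>f. a + (\<Sum>i\<in>expvecs d k. b i * metavar i f)) | a b. True}"


section \<open>Algebraic circuits\<close>

text \<open>A computation gate carries its two incoming edges, each with its scalar label and its source;
  the two edges may have the same source.\<close>

datatype gate =
    Input metapoly
  | Plus "complex \<times> nat" "complex \<times> nat"
  | Times "complex \<times> nat" "complex \<times> nat"

record circuit =
  vertices :: "nat set"
  label :: "nat \<Rightarrow> gate"
  out_vertex :: nat

fun sources :: "gate \<Rightarrow> nat set" where
  "sources (Input A) = {}"
| "sources (Plus (a, u) (b, v)) = {u, v}"
| "sources (Times (a, u) (b, v)) = {u, v}"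

definition circuit_edges :: "circuit \<Rightarrow> (nat \<times> nat) set" where
  "circuit_edges \<C> = {(u, v). v \<in> vertices \<C> \<and> u \<in> sources (label \<C> v)}"

definition is_circuit :: "nat \<Rightarrow> nat \<Rightarrow> circuit \<Rightarrow> bool" where
  "is_circuit d k \<C> \<longleftrightarrow>
    finite (vertices \<C>) \<and> out_vertex \<C> \<in> vertices \<C> \<and>
    (\<forall>v\<in>vertices \<C>. sources (label \<C> v) \<subseteq> vertices \<C>) \<and>
    (\<forall>v\<in>vertices \<C>. \<forall>A. label \<C> v = Input A \<longrightarrow> A \<in> affine_metapolys d k) \<and>
    acyclic (circuit_edges \<C>)"

fun gate_value :: "(nat \<Rightarrow> metapoly) \<Rightarrow> gate \<Rightarrow> metapoly" where
  "gate_value val (Input A) = A"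
| "gate_value val (Plus (a, u) (b, v)) = mscale a (val u) + mscale b (val v)"
| "gate_value val (Times (a, u) (b, v)) = mscale a (val u) * mscale b (val v)"

text \<open>By acyclicity, \<open>val\<close> is uniquely determined on the vertices.\<close>

definition circuit_computes :: "circuit \<Rightarrow> metapoly \<Rightarrow> bool" where
  "circuit_computes \<C> \<Delta> \<longleftrightarrow>
    (\<exists>val. (\<forall>v\<in>vertices \<C>. val v = gate_value val (label \<C> v)) \<and> val (out_vertex \<C>) = \<Delta>)"

definition has_circuit_of_size :: "nat \<Rightarrow> nat \<Rightarrow> metapoly \<Rightarrow> nat \<Rightarrow> bool" where
  "has_circuit_of_size d k \<Delta> s \<longleftrightarrow>
    (\<exists>\<C>. is_circuit d k \<C> \<and> card (vertices \<C>) = s \<and> circuit_computes \<C> \<Delta>)"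


section \<open>The action of the general linear group\<close>

definition GL :: "nat \<Rightarrow> complex mat set" where
  "GL n = {g \<in> carrier_mat n n. invertible_mat g}"

definition mat_inv :: "complex mat \<Rightarrow> complex mat" where
  "mat_inv g = the (mat_inverse g)"

definition Const :: "complex \<Rightarrow> cpoly" where
  "Const c = Poly_Mapping.single 0 c"

definition Var :: "nat \<Rightarrow> cpoly" where
  "Var a = Poly_Mapping.single (Poly_Mapping.single a 1) 1"

text \<open>
  \<open>linear_form h a\<close> is the entry of index \<open>a\<close> of \<open>h x\<close>. For a \<open>j \<times> j\<close> matrix the variables of index
  at least \<open>j\<close> are left unchanged; this is the embedding of \<open>GL j\<close> into \<open>GL k\<close> as
  the upper left block.
\<close>

definition linear_form :: "complex mat \<Rightarrow> nat \<Rightarrow> cpoly" where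
  "linear_form h a =
    (if a < dim_row h then \<Sum>b<dim_col h. Const (h $$ (a, b)) * Var b else Var a)"

definition subst_linear :: "complex mat \<Rightarrow> cpoly \<Rightarrow> cpoly" where
  "subst_linear h f =
    (\<Sum>m\<in>Poly_Mapping.keys f. Const (Poly_Mapping.lookup f m) *
      (\<Prod>a\<in>Poly_Mapping.keys m. linear_form h a ^ Poly_Mapping.lookup m a))"

definition poly_act :: "complex mat \<Rightarrow> cpoly \<Rightarrow> cpoly" where
  "poly_act g f = subst_linear (mat_inv g) f"

definition meta_act :: "complex mat \<Rightarrow> metapoly \<Rightarrow> metapoly" where
  "meta_act g \<Delta> = (\<lambda>f. \<Delta> (poly_act (mat_inv g) f))"


section \<open>Partitions and semistandard tableaux\<close>

definition partitions :: "nat \<Rightarrow> nat \<Rightarrow> nat list set" where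
  "partitions N k =
    {lam. sorted_wrt (\<ge>) lam \<and> 0 \<notin> set lam \<and> sum_list lam = N \<and> length lam \<le> k}"

definition part :: "nat list \<Rightarrow> nat \<Rightarrow> nat" where
  "part lam i = (if i < length lam then lam ! i else 0)"

text \<open>A tableau is the list of its rows; its shape is the list of its row lengths.\<close>

type_synonym tableau = "nat list list"

definition shape :: "tableau \<Rightarrow> nat list" where
  "shape T = map length T"

definition semistandard :: "nat \<Rightarrow> nat list \<Rightarrow> tableau set" where
  "semistandard k lam =
    {T. shape T = lam \<and>
        (\<forall>r\<in>set T. sorted r \<and> set r \<subseteq> {1..k}) \<and>
        (\<forall>i j. Suc i < length T \<and> j < length (T ! Suc i) \<longrightarrow> T ! i ! j < T ! Suc i ! j)}"

definition tableaux :: "nat \<Rightarrow> nat \<Rightarrow> tableau set" where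
  "tableaux N k = (\<Union>lam\<in>partitions N k. semistandard k lam)"

definition superstandard :: "nat list \<Rightarrow> tableau" where
  "superstandard lam = map (\<lambda>i. replicate (lam ! i) (Suc i)) [0..<length lam]"

definition restrict_tableau :: "nat \<Rightarrow> tableau \<Rightarrow> tableau" where
  "restrict_tableau j T = filter (\<lambda>r. r \<noteq> []) (map (filter (\<lambda>a. a \<le> j)) T)"


section \<open>Isotypic components\<close>

definition highest_weight_vector :: "nat \<Rightarrow> nat list \<Rightarrow> metapoly \<Rightarrow> bool" where
  "highest_weight_vector n lam \<Delta> \<longleftrightarrow>
    (\<forall>g\<in>GL n. upper_triangular g \<longrightarrow>
      meta_act g \<Delta> = mscale (\<Prod>i<n. g $$ (i, i) ^ part lam i) \<Delta>)"

definition highest_weight_space :: "nat \<Rightarrow> nat \<Rightarrow> nat \<Rightarrow> nat list \<Rightarrow> metapoly set" where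
  "highest_weight_space \<delta> d k lam =
    {\<Delta> \<in> metapolys \<delta> d k. highest_weight_vector k lam \<Delta>}"

definition GL_stable_subspace :: "nat \<Rightarrow> metapoly set \<Rightarrow> bool" where
  "GL_stable_subspace n U \<longleftrightarrow>
    meta.subspace U \<and> (\<forall>g\<in>GL n. \<forall>\<Delta>\<in>U. meta_act g \<Delta> \<in> U)"

definition GL_irreducible :: "nat \<Rightarrow> metapoly set \<Rightarrow> bool" where
  "GL_irreducible n U \<longleftrightarrow>
    GL_stable_subspace n U \<and> U \<noteq> {0} \<and>
    (\<forall>U'. GL_stable_subspace n U' \<and> U' \<subseteq> U \<longrightarrow> U' = {0} \<or> U' = U)"

text \<open>
  The component of type \<open>lam\<close> for the action of \<open>GL n\<close> on the metapolynomials of format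
  \<open>(\<delta>, d, k)\<close>: the sum of all irreducible subrepresentations of highest weight \<open>lam\<close>. The case
  \<open>n < k\<close> is needed for the Gelfand-Tsetlin decomposition.
\<close>

definition isotypic :: "nat \<Rightarrow> nat \<Rightarrow> nat \<Rightarrow> nat \<Rightarrow> nat list \<Rightarrow> metapoly set" where
  "isotypic n \<delta> d k lam =
    meta.span (\<Union>{U. U \<subseteq> metapolys \<delta> d k \<and> GL_irreducible n U \<and>
      (\<exists>\<Delta>\<in>U. \<Delta> \<noteq> 0 \<and> highest_weight_vector n lam \<Delta>)})"

text \<open>
  A semistandard tableau \<open>T\<close> corresponds to the chain of the shapes of its subtableaux of entries
  at most \<open>j\<close>. The \<open>T\<close>-isotypic component consists of the metapolynomials which have type
  the \<open>j\<close>-th shape of this chain under \<open>GL j\<close>, for every \<open>j\<close> in \<open>{1..k}\<close>.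
\<close>

definition tableau_isotypic :: "nat \<Rightarrow> nat \<Rightarrow> nat \<Rightarrow> tableau \<Rightarrow> metapoly set" where
  "tableau_isotypic \<delta> d k T =
    {\<Delta> \<in> metapolys \<delta> d k. \<forall>j\<in>{1..k}. \<Delta> \<in> isotypic j \<delta> d k (shape (restrict_tableau j T))}"


section \<open>Projections\<close>

definition proj_along :: "metapoly set \<Rightarrow> metapoly set \<Rightarrow> metapoly \<Rightarrow> metapoly" where
  "proj_along W U \<Delta> = (THE \<Delta>'. \<Delta>' \<in> W \<and> \<Delta> - \<Delta>' \<in> U)"

definition weight_proj :: "nat \<Rightarrow> nat \<Rightarrow> nat \<Rightarrow> expvec \<Rightarrow> metapoly \<Rightarrow> metapoly" where
  "weight_proj \<delta> d k \<mu> =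
    proj_along (weight_space \<delta> d k \<mu>)
      (meta.span (\<Union>\<nu>\<in>expvecs (d * \<delta>) k - {\<mu>}. weight_space \<delta> d k \<nu>))"

definition isotypic_proj :: "nat \<Rightarrow> nat \<Rightarrow> nat \<Rightarrow> nat list \<Rightarrow> metapoly \<Rightarrow> metapoly" where
  "isotypic_proj \<delta> d k lam =
    proj_along (isotypic k \<delta> d k lam)
      (meta.span (\<Union>\<nu>\<in>partitions (d * \<delta>) k - {lam}. isotypic k \<delta> d k \<nu>))"

definition tableau_proj :: "nat \<Rightarrow> nat \<Rightarrow> nat \<Rightarrow> tableau \<Rightarrow> metapoly \<Rightarrow> metapoly" where
  "tableau_proj \<delta> d k T =
    proj_along (tableau_isotypic \<delta> d k T)
      (meta.span (\<Union>S\<in>tableaux (d * \<delta>) k - {T}. tableau_isotypic \<delta> d k S))"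

text \<open>The highest weight space is the component of the superstandard tableau in the
  decomposition indexed by tableaux, so its complement is the sum of the other components there.\<close>

definition highest_weight_proj :: "nat \<Rightarrow> nat \<Rightarrow> nat \<Rightarrow> nat list \<Rightarrow> metapoly \<Rightarrow> metapoly" where
  "highest_weight_proj \<delta> d k lam =
    proj_along (highest_weight_space \<delta> d k lam)
      (meta.span (\<Union>S\<in>tableaux (d * \<delta>) k - {superstandard lam}. tableau_isotypic \<delta> d k S))"

end

theory Submission
  imports Defs "Jordan_Normal_Form.Determinant"
begin

text \<open>
  Writing \<open>N = d * \<delta>\<close>, all four projections of \<open>\<Delta>\<close> lie in the cyclic module spanned by the translates
  \<open>f \<mapsto> \<Delta> (f \<circ> g)\<close> for \<open>k \<times> k\<close> matrices \<open>g\<close>. The coefficients of such a translate are polynomials in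
  the entries of \<open>g\<close> of degree at most \<open>N\<close> in each entry, so this module has dimension at most
  \<open>(N + 1) ^ k\<^sup>2\<close>. A projection is thus a linear combination of that many translates, each of which has a
  circuit of the same size as \<open>\<Delta>\<close>.

  That a stable subspace is the sum of its intersections with the components follows from a Hermitian
  form for which the adjoint of \<open>g\<close> is its conjugate transpose: orthogonal complements of stable
  subspaces are stable, and every nonzero stable subspace contains a highest weight vector. A matrix
  coefficient \<open>g \<mapsto> \<langle>g v, w\<rangle>\<close> of highest weight vectors is determined by its value at the identity, since
  products of a lower and an upper triangular matrix are dense. Hence components of different highest
  weight are orthogonal. The same argument for a highest weight vector \<open>v\<close> of the subgroup
  \<open>GL\<close> of one dimension less gives the interlacing conditions, which identify the nonzero
  intersections of components along \<open>GL\<^sub>1 \<subseteq> \<dots> \<subseteq> GL\<^sub>k\<close> with semistandard tableaux.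
\<close>

section \<open>Polynomial dependence and Gaussian elimination\<close>

text \<open>One Hermitian form has to serve every \<open>GL n\<close> with \<open>n \<le> k\<close>,
  while metapolynomials are functions without chosen coordinates. So the form is put on coefficient
  families indexed by ordered lists of exponent vectors, a tensor power in which the adjoint
  identity is checked factor by factor, and is then carried along the evaluation map. Restriction to
  \<open>GL n\<close> keeps space and form, so components under different subgroups are compared by
  the same orthogonality. All matrices act, not only the invertible ones: matrix coefficients are
  polynomial on an affine space, and each density argument becomes the fact that a polynomial on a
  line that vanishes off a finite set is zero. Lie algebra operators are avoided likewise: weight
  vectors are read off as coefficients in the parameter of a one-parameter subgroup. The exponent
  \<open>2 * k\<^sup>2\<close> comes from \<open>N + 1 \<le> N\<^sup>2\<close> for
  \<open>N \<ge> 2\<close> and, for \<open>k \<ge> 1\<close>, is at most each of the four exponents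
  claimed. \<open>N = 1\<close> is separate: powers of \<open>N\<close> then leave no room for
  several translates.\<close>

definition polyfun :: "(complex \<Rightarrow> complex) \<Rightarrow> bool" where
  "polyfun f \<longleftrightarrow> (\<exists>p. \<forall>s. f s = poly p s)"

lemma polyfun_const: "polyfun (\<lambda>s. c)"
  unfolding polyfun_def by (rule exI[of _ "[:c:]"]) simp

lemma polyfun_id: "polyfun (\<lambda>s. s)"
  unfolding polyfun_def by (rule exI[of _ "[:0,1:]"]) simp

lemma polyfun_add:
  assumes "polyfun f" "polyfun g"
  shows "polyfun (\<lambda>s. f s + g s)"
proof -
  obtain p q where "\<forall>s. f s = poly p s" "\<forall>s. g s = poly q s"
    using assms unfolding polyfun_def by auto
  then have "\<forall>s. f s + g s = poly (p + q) s" by simp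
  then show ?thesis unfolding polyfun_def by (rule exI)
qed

lemma polyfun_diff:
  assumes "polyfun f" "polyfun g"
  shows "polyfun (\<lambda>s. f s - g s)"
proof -
  obtain p q where "\<forall>s. f s = poly p s" "\<forall>s. g s = poly q s"
    using assms unfolding polyfun_def by auto
  then have "\<forall>s. f s - g s = poly (p - q) s" by simp
  then show ?thesis unfolding polyfun_def by (rule exI)
qed

lemma polyfun_mult:
  assumes "polyfun f" "polyfun g"
  shows "polyfun (\<lambda>s. f s * g s)"
proof -
  obtain p q where "\<forall>s. f s = poly p s" "\<forall>s. g s = poly q s"
    using assms unfolding polyfun_def by auto
  then have "\<forall>s. f s * g s = poly (p * q) s" by simp
  then show ?thesis unfolding polyfun_def by (rule exI)
qed

lemma polyfun_power: "polyfun f \<Longrightarrow> polyfun (\<lambda>s. f s ^ m)"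
  by (induction m) (simp_all add: polyfun_const polyfun_mult)

lemma polyfun_sum:
  assumes "\<And>i. i \<in> I \<Longrightarrow> polyfun (f i)"
  shows "polyfun (\<lambda>s. \<Sum>i\<in>I. f i s)"
  using assms by (induction I rule: infinite_finite_induct) (simp_all add: polyfun_const polyfun_add)

lemma polyfun_prod:
  assumes "\<And>i. i \<in> I \<Longrightarrow> polyfun (f i)"
  shows "polyfun (\<lambda>s. \<Prod>i\<in>I. f i s)"
  using assms by (induction I rule: infinite_finite_induct) (simp_all add: polyfun_const polyfun_mult)

lemmas polyfun_intros =
  polyfun_const polyfun_id polyfun_add polyfun_diff polyfun_mult polyfun_power polyfun_sum polyfun_prod

lemma polyfun_finite_zeros:
  assumes "polyfun f" "f a \<noteq> 0"
  shows "finite {s. f s = 0}"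
proof -
  obtain p where p: "\<forall>s. f s = poly p s" using assms(1) by (auto simp: polyfun_def)
  with assms(2) have "p \<noteq> 0" by auto
  then show ?thesis using poly_roots_finite[of p] p by simp
qed

text \<open>The form in which density is used: the finitely many exceptional parameters are those
  with a zero pivot, a zero entry or a singular matrix.\<close>

lemma polyfun_eq_0:
  assumes "polyfun f" "finite {s. f s \<noteq> 0}"
  shows "f s = 0"
proof (rule ccontr)
  assume "f s \<noteq> 0"
  then have "finite {s. f s = 0}" using polyfun_finite_zeros assms(1) by blast
  with assms(2) have "finite ({s. f s = 0} \<union> {s. f s \<noteq> 0})" by simp
  moreover have "{s. f s = 0} \<union> {s. f s \<noteq> 0} = UNIV" by auto
  ultimately show False using infinite_UNIV_char_0[where 'a = complex] by simp
qed

text \<open>If \<open>a > b\<close>, cancelling \<open>s ^ b\<close> leaves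
  \<open>s ^ (a - b) * F s = c\<close> for nonzero \<open>s\<close>, hence also at
  \<open>s = 0\<close>, which forces \<open>c = 0\<close>. This is the source of the interlacing
  inequalities.\<close>

lemma polyfun_exponent_le:
  assumes "polyfun F" "\<And>s. s \<noteq> 0 \<Longrightarrow> s ^ a * F s = s ^ b * c" "c \<noteq> 0"
  shows "a \<le> b"
proof (rule ccontr)
  assume "\<not> a \<le> b"
  then obtain m where m: "a = b + Suc m" using less_imp_Suc_add[of b a] by auto
  have eq: "s ^ Suc m * F s - c = 0" if "s \<noteq> 0" for s
  proof -
    have "s ^ b * (s ^ Suc m * F s) = s ^ b * c"
      using assms(2)[OF that] by (simp add: m power_add mult.assoc)
    then show ?thesis using that by simp
  qed
  have "polyfun (\<lambda>s. s ^ Suc m * F s - c)" by (intro polyfun_intros assms)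
  moreover have "finite {s. s ^ Suc m * F s - c \<noteq> 0}"
    by (rule finite_subset[of _ "{0}"]) (use eq in auto)
  ultimately have "0 ^ Suc m * F 0 - c = 0" by (rule polyfun_eq_0)
  with assms(3) show False by simp
qed

text \<open>Since 2 is not a root of unity, evaluating a character at 2 recovers its
  exponent.\<close>

lemma two_power_complex_inject: "(2::complex) ^ a = 2 ^ b \<longleftrightarrow> a = b"
proof
  assume "(2::complex) ^ a = 2 ^ b"
  then have "of_nat (2 ^ a) = (of_nat (2 ^ b) :: complex)" by simp
  then have "2 ^ a = (2::nat) ^ b" by (simp only: of_nat_eq_iff)
  then show "a = b" by simp
qed simp

section \<open>Conjugate transposes and diagonal matrices\<close>

lemma index_mult_sum:
  assumes "A \<in> carrier_mat n n" "B \<in> carrier_mat n n" "i < n" "j < n"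
  shows "(A * B) $$ (i, j) = (\<Sum>l<n. A $$ (i, l) * B $$ (l, j))"
  using assms by (simp add: scalar_prod_def lessThan_atLeast0)

definition adj :: "complex mat \<Rightarrow> complex mat" where
  "adj g = mat (dim_col g) (dim_row g) (\<lambda>(i, j). cnj (g $$ (j, i)))"

lemma adj_carrier [simp]: "g \<in> carrier_mat n n \<Longrightarrow> adj g \<in> carrier_mat n n"
  by (auto simp: adj_def)

lemma adj_index [simp]: "g \<in> carrier_mat n n \<Longrightarrow> i < n \<Longrightarrow> j < n \<Longrightarrow> adj g $$ (i, j) = cnj (g $$ (j, i))"
  by (auto simp: adj_def)

lemma adj_adj [simp]: "g \<in> carrier_mat n n \<Longrightarrow> adj (adj g) = g"
  by (rule eq_matI) (auto simp: adj_def)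

definition dg :: "nat \<Rightarrow> (nat \<Rightarrow> complex) \<Rightarrow> complex mat" where
  "dg n t = mat n n (\<lambda>(i, j). if i = j then t i else 0)"

lemma dg_carrier [simp]: "dg n t \<in> carrier_mat n n"
  by (simp add: dg_def)

lemma dg_dim [simp]: "dim_row (dg n t) = n" "dim_col (dg n t) = n"
  by (simp_all add: dg_def)

lemma dg_index [simp]: "i < n \<Longrightarrow> j < n \<Longrightarrow> dg n t $$ (i, j) = (if i = j then t i else 0)"
  by (simp add: dg_def)

lemma dg_upper [simp]: "upper_triangular (dg n t)"
  by (auto simp: dg_def)

lemma dg_mult_index:
  assumes "g \<in> carrier_mat n n" "i < n" "j < n"
  shows "(dg n t * g) $$ (i, j) = t i * g $$ (i, j)" "(g * dg n t) $$ (i, j) = g $$ (i, j) * t j"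
proof -
  have "(dg n t * g) $$ (i, j) = (\<Sum>l<n. dg n t $$ (i, l) * g $$ (l, j))"
    using assms by (intro index_mult_sum) auto
  also have "\<dots> = (\<Sum>l<n. if l = i then t i * g $$ (i, j) else 0)"
    using assms by (intro sum.cong) auto
  finally show "(dg n t * g) $$ (i, j) = t i * g $$ (i, j)" using assms by simp
  have "(g * dg n t) $$ (i, j) = (\<Sum>l<n. g $$ (i, l) * dg n t $$ (l, j))"
    using assms by (intro index_mult_sum) auto
  also have "\<dots> = (\<Sum>l<n. if l = j then g $$ (i, j) * t j else 0)"
    using assms by (intro sum.cong) auto
  finally show "(g * dg n t) $$ (i, j) = g $$ (i, j) * t j" using assms by simp
qed

lemma dg_mult_dg: "dg n t * dg n u = dg n (\<lambda>i. t i * u i)"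
  by (rule eq_matI) (auto simp: dg_mult_index simp del: index_mult_mat(1))

lemma dg_one: "dg n (\<lambda>i. 1) = 1\<^sub>m n"
  by (rule eq_matI) auto

lemma adj_dg: "adj (dg n t) = dg n (\<lambda>i. cnj (t i))"
  by (rule eq_matI) (auto simp: adj_def dg_def)

text \<open>Elimination clears one column at a time with pivots on the diagonal; a vanishing pivot is
  avoided by moving along a line, on which \<open>f\<close> is polynomial.\<close>

lemma gauss_vanishing:
  fixes f :: "complex mat \<Rightarrow> complex"
  assumes line: "\<And>A B. A \<in> carrier_mat n n \<Longrightarrow> B \<in> carrier_mat n n \<Longrightarrow> polyfun (\<lambda>s. f (A + s \<cdot>\<^sub>m B))"
    and cov: "\<And>l g u. l \<in> carrier_mat n n \<Longrightarrow> g \<in> carrier_mat n n \<Longrightarrow> u \<in> carrier_mat n n \<Longrightarrow>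
        (\<forall>i<n. \<forall>j<n. i < j \<longrightarrow> l $$ (i, j) = 0) \<Longrightarrow> (\<forall>i<n. l $$ (i, i) \<noteq> 0) \<Longrightarrow>
        upper_triangular u \<Longrightarrow> (\<forall>i<n. u $$ (i, i) \<noteq> 0) \<Longrightarrow>
        (\<forall>i<n. \<forall>j<n. c \<le> j \<longrightarrow> u $$ (i, j) = (if i = j then 1 else 0)) \<Longrightarrow> f g = 0 \<Longrightarrow> f (l * g * u) = 0"
    and unit_cols: "\<And>g. g \<in> carrier_mat n n \<Longrightarrow> (\<forall>j<c. \<forall>i<n. g $$ (i, j) = (if i = j then 1 else 0)) \<Longrightarrow> f g = 0"
    and c: "c \<le> n" and g: "g \<in> carrier_mat n n"
  shows "f g = 0"
proof -
  \<comment> \<open>Downward induction on the number \<open>m\<close> of leading columns that agree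
    with the identity: \<open>m = c\<close> is \<open>unit_cols\<close>, \<open>m = 0\<close> is the
    claim.\<close>
  have "\<forall>g \<in> carrier_mat n n. (\<forall>j<m. \<forall>i<n. g $$ (i, j) = (if i = j then 1 else 0)) \<longrightarrow> f g = 0"
    if "m \<le> c" for m
    using that
  proof (induction rule: inc_induct)
    case base
    show ?case by (intro ballI impI unit_cols) auto
  next
    case (step m)
    then have mn: "m < n" using c by simp
    have pivot: "f g = 0" if g: "g \<in> carrier_mat n n" and
      unit: "\<forall>j<m. \<forall>i<n. g $$ (i, j) = (if i = j then 1 else 0)" and p: "g $$ (m, m) \<noteq> 0" for g :: "complex mat"
    proof -
      define p where "p = g $$ (m, m)"
      \<comment> \<open>One elimination step \<open>g = l * h * u\<close>: \<open>l\<close> restores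
        the entries below the pivot from row \<open>m\<close>, \<open>u\<close> carries column
        \<open>m\<close> from the pivot upwards, and \<open>h\<close> has one more unit column than
        \<open>g\<close>.\<close>
      define l where "l = mat n n (\<lambda>(i, j). if i = j then 1 else if j = m \<and> m < i then g $$ (i, m) / p else 0)"
      define u where "u = mat n n (\<lambda>(i, j). if j = m then (if i \<le> m then g $$ (i, m) else 0) else if i = j then 1 else 0)"
      define h where "h = mat n n (\<lambda>(i, j). if j \<le> m then (if i = j then 1 else 0)
        else if i \<le> m then g $$ (i, j) else g $$ (i, j) - g $$ (i, m) / p * g $$ (m, j))"
      have carr: "l \<in> carrier_mat n n" "u \<in> carrier_mat n n" "h \<in> carrier_mat n n"
        by (auto simp: l_def u_def h_def)
      have hu: "(h * u) $$ (i, j) = (if j = m then (if i \<le> m then g $$ (i, m) else 0) else h $$ (i, j))"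
        if ij: "i < n" "j < n" for i j
      proof -
        have "(h * u) $$ (i, j) = (\<Sum>a<n. h $$ (i, a) * u $$ (a, j))"
          using carr ij by (simp add: index_mult_sum del: index_mult_mat(1))
        also have "\<dots> = (\<Sum>a<n. if a = (if j = m then i else j) then
            (if j = m then (if i \<le> m then g $$ (i, m) else 0) else h $$ (i, j)) else 0)"
          using ij mn by (intro sum.cong refl) (auto simp: h_def u_def)
        finally show ?thesis using ij by simp
      qed
      have "g = l * (h * u)"
      proof (rule eq_matI)
        fix i j assume "i < dim_row (l * (h * u))" "j < dim_col (l * (h * u))"
        then have ij: "i < n" "j < n" using carr by auto
        have "(l * (h * u)) $$ (i, j) = (\<Sum>a<n. l $$ (i, a) * (h * u) $$ (a, j))"
          using carr ij by (intro index_mult_sum) auto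
        also have "\<dots> = (\<Sum>a<n. (if a = i then (h * u) $$ (i, j) else 0) +
            (if a = m then (if m < i then g $$ (i, m) / p * (h * u) $$ (m, j) else 0) else 0))"
          using ij by (intro sum.cong refl) (auto simp: l_def simp del: index_mult_mat(1))
        also have "\<dots> = (h * u) $$ (i, j) + (if m < i then g $$ (i, m) / p * (h * u) $$ (m, j) else 0)"
          using ij mn by (simp add: sum.distrib del: index_mult_mat(1))
        also have "\<dots> = g $$ (i, j)"
          using ij mn p unit unfolding hu[OF ij] hu[OF mn ij(2)] by (auto simp: h_def p_def)
        finally show "g $$ (i, j) = (l * (h * u)) $$ (i, j)" ..
      qed (use g carr in auto)
      also have "\<dots> = l * h * u" using carr by (simp add: assoc_mult_mat[of _ n n _ n _ n])
      finally have "g = l * h * u" .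
      moreover have "\<forall>j<Suc m. \<forall>i<n. h $$ (i, j) = (if i = j then 1 else 0)"
        using mn by (auto simp: h_def)
      then have "f h = 0" using step.IH carr by blast
      then have "f (l * h * u) = 0"
      proof (intro cov carr)
        show "\<forall>i<n. \<forall>j<n. i < j \<longrightarrow> l $$ (i, j) = 0" "\<forall>i<n. l $$ (i, i) \<noteq> 0"
          by (auto simp: l_def)
        show "upper_triangular u" by (auto simp: u_def)
        show "\<forall>i<n. u $$ (i, i) \<noteq> 0" using p by (auto simp: u_def)
        \<comment> \<open>\<open>u\<close> differs from the identity in column \<open>m < c\<close>
          only, so covariance under matrices with trivial columns from \<open>c\<close> on
          suffices.\<close>
        show "\<forall>i<n. \<forall>j<n. c \<le> j \<longrightarrow> u $$ (i, j) = (if i = j then 1 else 0)"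
          using step.hyps by (auto simp: u_def)
      qed
      ultimately show ?thesis by simp
    qed
    show ?case
    proof (intro ballI impI)
      fix g :: "complex mat" assume g: "g \<in> carrier_mat n n" and
        unit: "\<forall>j<m. \<forall>i<n. g $$ (i, j) = (if i = j then 1 else 0)"
      \<comment> \<open>Adding \<open>s \<cdot>\<^sub>m B\<close> changes only the pivot, which
        becomes zero for a single value of \<open>s\<close>.\<close>
      define B where "B = mat n n (\<lambda>(i, j). if i = m \<and> j = m then 1 else 0 :: complex)"
      have B: "B \<in> carrier_mat n n" by (simp add: B_def)
      have van: "f (g + s \<cdot>\<^sub>m B) = 0" if "s \<noteq> - (g $$ (m, m))" for s
      proof (rule pivot)
        show "(g + s \<cdot>\<^sub>m B) $$ (m, m) \<noteq> 0"
        proof -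
          have "(g + s \<cdot>\<^sub>m B) $$ (m, m) = s + g $$ (m, m)" using g mn by (simp add: B_def)
          then show ?thesis using that by (simp add: eq_neg_iff_add_eq_0)
        qed
        show "\<forall>j<m. \<forall>i<n. (g + s \<cdot>\<^sub>m B) $$ (i, j) = (if i = j then 1 else 0)"
        proof (intro allI impI)
          fix i j assume "j < m" "i < n"
          then have "(g + s \<cdot>\<^sub>m B) $$ (i, j) = g $$ (i, j) + s * B $$ (i, j)" "B $$ (i, j) = 0"
            using g B mn by (simp_all add: B_def)
          then show "(g + s \<cdot>\<^sub>m B) $$ (i, j) = (if i = j then 1 else 0)"
            using unit[rule_format, OF \<open>j < m\<close> \<open>i < n\<close>] by simp
        qed
      qed (use g B in simp)
      have "{s. f (g + s \<cdot>\<^sub>m B) \<noteq> 0} \<subseteq> {- (g $$ (m, m))}"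
      proof
        fix s assume "s \<in> {s. f (g + s \<cdot>\<^sub>m B) \<noteq> 0}"
        then show "s \<in> {- (g $$ (m, m))}" using van[of s] by (cases "s = - (g $$ (m, m))") simp_all
      qed
      then have "finite {s. f (g + s \<cdot>\<^sub>m B) \<noteq> 0}" by (rule finite_subset) simp
      then have "f (g + 0 \<cdot>\<^sub>m B) = 0" by (rule polyfun_eq_0[OF line[OF g B]])
      moreover have "g + 0 \<cdot>\<^sub>m B = g" using g B by (intro eq_matI) auto
      ultimately show "f g = 0" by simp
    qed
  qed
  from this[OF le0] g show ?thesis by fastforce
qed

section \<open>Polynomial representations with an invariant form\<close>

definition entry_mon :: "nat \<Rightarrow> (nat \<times> nat \<Rightarrow> nat) \<Rightarrow> complex mat \<Rightarrow> complex" where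
  "entry_mon n e g = (\<Prod>i<n. \<Prod>j<n. g $$ (i, j) ^ e (i, j))"

text \<open>The bound \<open>N\<close> is on the exponent of each entry separately. The extensional
  function space fixes the values outside the square, so each monomial occurs exactly once and the
  count is \<open>(N + 1) ^ n\<^sup>2\<close>.\<close>

definition exps :: "nat \<Rightarrow> nat \<Rightarrow> (nat \<times> nat \<Rightarrow> nat) set" where
  "exps n N = ({..<n} \<times> {..<n}) \<rightarrow>\<^sub>E {..N}"

lemma finite_exps [simp]: "finite (exps n N)"
  unfolding exps_def by (intro finite_PiE) auto

lemma card_exps: "card (exps n N) = (N + 1) ^ n\<^sup>2"
  unfolding exps_def by (subst card_PiE) (auto simp: power2_eq_square)

lemma entry_mon_scale:
  assumes "\<And>i j. i < n \<Longrightarrow> j < n \<Longrightarrow> h $$ (i, j) = g $$ (i, j) * s ^ w i j"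
  shows "entry_mon n e h = entry_mon n e g * s ^ (\<Sum>i<n. \<Sum>j<n. w i j * e (i, j))"
  using assms
  by (simp add: entry_mon_def power_mult_distrib prod.distrib power_sum flip: power_mult)

lemma polyfun_entry_mon:
  assumes "A \<in> carrier_mat n n" "B \<in> carrier_mat n n"
  shows "polyfun (\<lambda>s. entry_mon n e (A + s \<cdot>\<^sub>m B))"
proof -
  have "(\<lambda>s. entry_mon n e (A + s \<cdot>\<^sub>m B)) = (\<lambda>s. \<Prod>i<n. \<Prod>j<n. (A $$ (i, j) + s * B $$ (i, j)) ^ e (i, j))"
    using assms by (auto simp: entry_mon_def fun_eq_iff intro!: prod.cong)
  then show ?thesis by (simp add: polyfun_intros)
qed

section \<open>Weights and their lexicographic height\<close>

text \<open>Fixing the values from \<open>n\<close> on to be zero makes the set finite and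
  \<open>wheight\<close> injective on it.\<close>

definition wts :: "nat \<Rightarrow> nat \<Rightarrow> (nat \<Rightarrow> nat) set" where
  "wts n N = {\<mu>. (\<forall>i<n. \<mu> i \<le> N) \<and> (\<forall>i\<ge>n. \<mu> i = 0)}"

lemma finite_wts [simp]: "finite (wts n N)"
proof -
  have "wts n N \<subseteq> {f. \<forall>x. (x \<in> {..<n} \<longrightarrow> f x \<in> {..N}) \<and> (x \<notin> {..<n} \<longrightarrow> f x = 0)}"
    by (auto simp: wts_def)
  then show ?thesis
    using finite_subset finite_set_of_finite_funs[of "{..<n}" "{..N}" 0] by blast
qed

definition doms :: "nat \<Rightarrow> nat \<Rightarrow> (nat \<Rightarrow> nat) set" where
  "doms n N = {\<mu> \<in> wts n N. \<forall>i. Suc i < n \<longrightarrow> \<mu> (Suc i) \<le> \<mu> i}"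

definition hgt :: "nat \<Rightarrow> nat \<Rightarrow> nat \<Rightarrow> nat" where
  "hgt n N i = (N + 1) ^ (n - 1 - i)"

text \<open>Reading a weight as a number in base \<open>N + 1\<close> orders the weights lexicographically and lets
  a one-parameter subgroup separate them.\<close>

definition wheight :: "nat \<Rightarrow> nat \<Rightarrow> (nat \<Rightarrow> nat) \<Rightarrow> nat" where
  "wheight n N \<mu> = (\<Sum>i<n. hgt n N i * \<mu> i)"

lemma wheight_Suc: "wheight (Suc n) N \<mu> = (N + 1) * wheight n N \<mu> + \<mu> n"
proof -
  have "hgt (Suc n) N i = (N + 1) * hgt n N i" if "i < n" for i
  proof -
    have "Suc n - 1 - i = Suc (n - 1 - i)" using that by simp
    then show ?thesis by (simp add: hgt_def)
  qed
  then have "(\<Sum>i<n. hgt (Suc n) N i * \<mu> i) = (\<Sum>i<n. (N + 1) * (hgt n N i * \<mu> i))"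
    by (intro sum.cong refl) (simp add: algebra_simps)
  moreover have "hgt (Suc n) N n = 1" by (simp add: hgt_def)
  ultimately show ?thesis by (simp add: wheight_def sum_distrib_left)
qed

lemma wheight_eq_iff:
  assumes "\<forall>i<n. \<mu> i \<le> N" "\<forall>i<n. \<nu> i \<le> N" "wheight n N \<mu> = wheight n N \<nu>"
  shows "\<forall>i<n. \<mu> i = \<nu> i"
  using assms
proof (induction n)
  case (Suc n)
  have lt: "\<mu> n < N + 1" "\<nu> n < N + 1" using Suc.prems by (auto simp: less_Suc_eq_le)
  have "((N + 1) * wheight n N \<mu> + \<mu> n) mod (N + 1) = ((N + 1) * wheight n N \<nu> + \<nu> n) mod (N + 1)"
    using Suc.prems(3) by (simp only: wheight_Suc)
  then have eq: "\<mu> n = \<nu> n" using lt by (simp only: mod_mult_self4 mod_less)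
  then have "(N + 1) * wheight n N \<mu> = (N + 1) * wheight n N \<nu>"
    using Suc.prems(3) by (simp only: wheight_Suc)
  then have "wheight n N \<mu> = wheight n N \<nu>" by (simp only: mult_cancel1) simp
  then have "\<forall>i<n. \<mu> i = \<nu> i" using Suc by simp
  then show ?case using eq by (auto simp: less_Suc_eq)
qed simp

lemma wheight_inj: "inj_on (wheight n N) (wts n N)"
proof (rule inj_onI)
  fix \<mu> \<nu> assume *: "\<mu> \<in> wts n N" "\<nu> \<in> wts n N" "wheight n N \<mu> = wheight n N \<nu>"
  then have "\<forall>i<n. \<mu> i = \<nu> i" by (intro wheight_eq_iff) (auto simp: wts_def)
  then show "\<mu> = \<nu>" using * unfolding wts_def fun_eq_iff mem_Collect_eq by (metis not_le)
qed

lemma hgt_strict: "i < j \<Longrightarrow> j < n \<Longrightarrow> N > 0 \<Longrightarrow> hgt n N j < hgt n N i"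
  unfolding hgt_def by (intro power_strict_increasing) auto

lemma hgt_mono: "i \<le> j \<Longrightarrow> hgt n N j \<le> hgt n N i"
  unfolding hgt_def by (intro power_increasing) auto

text \<open>Moving the larger digit to the more significant place increases the number. Hence a
  weight of greatest height in a stable subspace is dominant.\<close>

lemma wheight_swap:
  assumes "Suc i < n" "\<mu> i < \<mu> (Suc i)" "N > 0"
  shows "wheight n N \<mu> < wheight n N (\<mu> \<circ> Transposition.transpose i (Suc i))"
proof -
  let ?t = "Transposition.transpose i (Suc i)"
  have split: "wheight n N \<nu> = hgt n N i * \<nu> i + (hgt n N (Suc i) * \<nu> (Suc i) + (\<Sum>j\<in>{..<n}-{i}-{Suc i}. hgt n N j * \<nu> j))" for \<nu>
    using assms(1) unfolding wheight_def
    by (subst sum.remove[of _ i], simp, simp, subst sum.remove[of _ "Suc i"]) auto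
  have rest: "(\<Sum>j\<in>{..<n}-{i}-{Suc i}. hgt n N j * (\<mu> \<circ> ?t) j) = (\<Sum>j\<in>{..<n}-{i}-{Suc i}. hgt n N j * \<mu> j)"
    by (intro sum.cong) (auto simp: Transposition.transpose_def)
  obtain a b where ab: "hgt n N i = hgt n N (Suc i) + Suc a" "\<mu> (Suc i) = \<mu> i + Suc b"
    using hgt_strict[of i "Suc i" n N] assms less_imp_Suc_add by (metis add_Suc_right lessI)
  show ?thesis
    unfolding split[of \<mu>] split[of "\<mu> \<circ> ?t"] rest by (simp add: ab algebra_simps)
qed

section \<open>Hermitian spaces and orthogonal projection\<close>

text \<open>The space is a carrier \<open>V\<close> inside the type because metapolynomials form a
  subspace of a function type. Definiteness is stated as anisotropy, which is what Gram-Schmidt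
  needs in order to divide by \<open>ip b b\<close>.\<close>

locale unitary_space = vector_space scale
  for scale :: "complex \<Rightarrow> 'v::ab_group_add \<Rightarrow> 'v" (infixr "*s" 75) +
  fixes V :: "'v set" and ip :: "'v \<Rightarrow> 'v \<Rightarrow> complex"
  assumes V_sub: "subspace V"
    and V_fin: "\<exists>B. finite B \<and> V = span B"
    and ip_add: "u \<in> V \<Longrightarrow> v \<in> V \<Longrightarrow> w \<in> V \<Longrightarrow> ip (u + v) w = ip u w + ip v w"
    and ip_scale: "u \<in> V \<Longrightarrow> w \<in> V \<Longrightarrow> ip (c *s u) w = c * ip u w"
    and ip_sym: "u \<in> V \<Longrightarrow> w \<in> V \<Longrightarrow> ip w u = cnj (ip u w)"
    and ip_definite: "u \<in> V \<Longrightarrow> ip u u = 0 \<Longrightarrow> u = 0"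
begin

lemma V_closed:
  "0 \<in> V" "u \<in> V \<Longrightarrow> v \<in> V \<Longrightarrow> u + v \<in> V" "u \<in> V \<Longrightarrow> v \<in> V \<Longrightarrow> u - v \<in> V" "u \<in> V \<Longrightarrow> c *s u \<in> V"
  "(\<And>i. i \<in> I \<Longrightarrow> f i \<in> V) \<Longrightarrow> sum f I \<in> V"
  using V_sub by (auto simp: subspace_0 subspace_add subspace_diff subspace_scale subspace_sum)

lemma ip_add_right: "u \<in> V \<Longrightarrow> v \<in> V \<Longrightarrow> w \<in> V \<Longrightarrow> ip w (u + v) = ip w u + ip w v"
  using ip_sym[of "u + v" w] ip_sym[of u w] ip_sym[of v w] V_closed by (simp add: ip_add)

lemma ip_scale_right: "u \<in> V \<Longrightarrow> w \<in> V \<Longrightarrow> ip w (c *s u) = cnj c * ip w u"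
  using ip_sym[of "c *s u" w] ip_sym[of u w] V_closed by (simp add: ip_scale)

lemma ip_0 [simp]: "w \<in> V \<Longrightarrow> ip 0 w = 0" "w \<in> V \<Longrightarrow> ip w 0 = 0"
  using ip_scale[of 0 w 0] ip_scale_right[of 0 w 0] V_closed by auto

lemma ip_diff: "u \<in> V \<Longrightarrow> v \<in> V \<Longrightarrow> w \<in> V \<Longrightarrow> ip (u - v) w = ip u w - ip v w"
  using ip_add[of u "(-1) *s v" w] ip_scale[of v w "-1"] V_closed(4)[of v "-1"] by simp

lemma ip_sum: "(\<And>i. i \<in> I \<Longrightarrow> f i \<in> V) \<Longrightarrow> w \<in> V \<Longrightarrow> ip (sum f I) w = (\<Sum>i\<in>I. ip (f i) w)"
  by (induction I rule: infinite_finite_induct) (auto simp: ip_add V_closed)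

lemma ip_0_commute: "u \<in> V \<Longrightarrow> w \<in> V \<Longrightarrow> ip u w = 0 \<Longrightarrow> ip w u = 0"
  using ip_sym[of u w] by simp

lemma subspace_finite_span:
  assumes "subspace U" "U \<subseteq> V"
  shows "\<exists>B. finite B \<and> B \<subseteq> U \<and> span B = U"
proof -
  obtain B where B: "finite B" "V = span B" using V_fin by blast
  obtain C where C: "C \<subseteq> U" "independent C" "U \<subseteq> span C"
    using maximal_independent_subset[of U] by blast
  have "finite C" using independent_span_bound[OF B(1) C(2)] C(1) assms(2) B(2) by auto
  moreover have "span C = U" using C assms(1) by (simp add: span_subspace)
  ultimately show ?thesis using C by blast
qed

text \<open>Gram-Schmidt by one generator at a time: subtracting from \<open>b\<close> its
  projection \<open>b0\<close> leaves \<open>b'\<close> orthogonal to the old span, and then only a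
  one-dimensional projection along \<open>b'\<close> is added. If \<open>b' = 0\<close>, the new
  generator contributes nothing.\<close>

lemma orth_proj_span:
  assumes "finite B" "B \<subseteq> V" "v \<in> V"
  shows "\<exists>u\<in>span B. \<forall>x\<in>span B. ip (v - u) x = 0"
  using assms
proof (induction B arbitrary: v rule: finite_induct)
  case empty
  then show ?case using V_closed by (intro bexI[of _ 0]) auto
next
  case (insert b B)
  have sV: "span B \<subseteq> V" using insert.prems V_sub by (intro span_minimal) auto
  obtain b0 where b0: "b0 \<in> span B" "\<forall>x\<in>span B. ip (b - b0) x = 0" using insert by blast
  obtain u0 where u0: "u0 \<in> span B" "\<forall>x\<in>span B. ip (v - u0) x = 0" using insert by blast
  have mono: "span B \<subseteq> span (insert b B)" by (intro span_mono) auto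
  have bV: "b \<in> V" "b0 \<in> V" "u0 \<in> V" using insert.prems sV b0 u0 by auto
  define b' where "b' = b - b0"
  have b'V: "b' \<in> V" using bV V_closed by (simp add: b'_def)
  have b'S: "b' \<in> span (insert b B)"
    unfolding b'_def using b0 mono by (intro span_diff[OF span_base]) auto
  have dec: "\<exists>c y. y \<in> span B \<and> x = c *s b' + y" if x: "x \<in> span (insert b B)" for x
  proof -
    obtain c where c: "x - c *s b \<in> span B" using x by (auto simp: span_insert)
    have "(x - c *s b) + c *s b0 \<in> span B" using c b0 by (intro span_add span_scale)
    then show ?thesis
      by (intro exI[of _ c] exI[of _ "(x - c *s b) + c *s b0"]) (auto simp: b'_def scale_right_diff_distrib)
  qed
  show ?case
  proof (cases "b' = 0")
    case True
    then show ?thesis using u0 dec mono by (intro bexI[of _ u0]) fastforce+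
  next
    case False
    then have nz: "ip b' b' \<noteq> 0" using b'V ip_definite by blast
    define a where "a = ip v b' / ip b' b'"
    define u where "u = u0 + a *s b'"
    have uV: "u \<in> V" "v - u0 \<in> V" "a *s b' \<in> V" using bV b'V insert.prems V_closed by (auto simp: u_def)
    have vu: "v - u = (v - u0) - a *s b'" by (simp add: u_def)
    have "ip (v - u) b' = ip v b' - ip u0 b' - a * ip b' b'"
      unfolding vu using bV b'V insert.prems uV by (simp add: ip_diff ip_scale)
    moreover have "ip u0 b' = 0" 
      by (rule ip_0_commute[OF b'V bV(3)]) (use b0 u0 in \<open>simp add: b'_def\<close>)
    ultimately have 1: "ip (v - u) b' = 0" using nz by (simp add: a_def)
    have 2: "ip (v - u) y = 0" if "y \<in> span B" for y
    proof -
      have yV: "y \<in> V" using that sV by auto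
      have "ip (v - u) y = ip (v - u0) y - a * ip b' y"
        unfolding vu ip_diff[OF uV(2,3) yV] ip_scale[OF b'V yV] ..
      also have "ip (v - u0) y = 0" using u0 that by blast
      also have "ip b' y = 0" using b0 that by (simp add: b'_def)
      finally show ?thesis by simp
    qed
    have "ip (v - u) x = 0" if x: "x \<in> span (insert b B)" for x
    proof -
      obtain c y where "y \<in> span B" "x = c *s b' + y" using dec x by blast
      then show ?thesis using 1 2 sV b'V uV V_closed insert.prems
        by (subst \<open>x = _\<close>, subst ip_add_right) (auto simp: ip_scale_right)
    qed
    moreover have "u \<in> span (insert b B)" using u0 mono b'S by (auto simp: u_def intro!: span_add span_scale)
    ultimately show ?thesis by blast
  qed
qed

lemma orth_proj:
  assumes "subspace U" "U \<subseteq> V" "v \<in> V"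
  obtains u where "u \<in> U" "\<forall>x\<in>U. ip (v - u) x = 0"
proof -
  obtain B where "finite B" "B \<subseteq> U" "span B = U" using subspace_finite_span assms by blast
  then show ?thesis using orth_proj_span[of B v] assms that by blast
qed

text \<open>A Vandermonde argument without matrices. It extracts the coefficients of a curve lying
  in \<open>U\<close>; with \<open>U = {0}\<close> it compares two expansions coefficient by
  coefficient.\<close>

lemma separate_exponents:
  fixes \<epsilon> :: "'i \<Rightarrow> nat"
  assumes "subspace U" "finite I" "inj_on \<epsilon> I" "\<And>s. s \<noteq> 0 \<Longrightarrow> (\<Sum>i\<in>I. s ^ \<epsilon> i *s y i) \<in> U" "i \<in> I"
  shows "y i \<in> U"
  using assms(2-5)
proof (induction I arbitrary: y i rule: finite_induct)
  case (insert i0 I)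
  \<comment> \<open>Replacing \<open>s\<close> by \<open>2 * s\<close> and subtracting
    \<open>2 ^ \<epsilon> i0\<close> times the original sum cancels the term \<open>i0\<close> and
    multiplies each other term by a nonzero factor.\<close>
  define z where "z j = (2 ^ \<epsilon> j - 2 ^ \<epsilon> i0) *s y j" for j
  have zU: "z j \<in> U" if "j \<in> I" for j
  proof (rule insert.IH[OF _ _ that])
    fix s :: complex assume s: "s \<noteq> 0"
    have "(\<Sum>i\<in>I. s ^ \<epsilon> i *s z i) = (\<Sum>i\<in>insert i0 I. (2 * s) ^ \<epsilon> i *s y i) - 2 ^ \<epsilon> i0 *s (\<Sum>i\<in>insert i0 I. s ^ \<epsilon> i *s y i)"
      using insert.hyps by (simp add: z_def scale_sum_right sum_subtractf scale_left_diff_distrib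
          scale_right_diff_distrib power_mult_distrib mult.commute scale_right_distrib)
    also have "\<dots> \<in> U" using insert.prems(2)[of s] insert.prems(2)[of "2 * s"] s assms(1)
      by (auto intro!: subspace_diff subspace_scale)
    finally show "(\<Sum>i\<in>I. s ^ \<epsilon> i *s z i) \<in> U" .
  qed (use insert.prems in \<open>auto simp: inj_on_def\<close>)
  have yU: "y j \<in> U" if j: "j \<in> I" for j
  proof -
    have "\<epsilon> j \<noteq> \<epsilon> i0" using insert j by (auto simp: inj_on_def)
    then have nz: "(2::complex) ^ \<epsilon> j - 2 ^ \<epsilon> i0 \<noteq> 0"
      by (simp add: two_power_complex_inject)
    have "y j = inverse (2 ^ \<epsilon> j - 2 ^ \<epsilon> i0) *s z j" using nz by (simp add: z_def)
    then show ?thesis using zU[OF j] assms(1) by (simp add: subspace_scale)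
  qed
  have "y i0 = (\<Sum>i\<in>insert i0 I. 1 ^ \<epsilon> i *s y i) - sum y I" using insert.hyps by simp
  also have "\<dots> \<in> U"
    by (rule subspace_diff[OF assms(1) insert.prems(2) subspace_sum[OF assms(1)]]) (auto simp: yU)
  finally show ?case using yU insert.prems by blast
qed simp

end

section \<open>Torus weights and highest weight vectors\<close>

text \<open>The action is one of the multiplicative monoid of all matrices, so products and adjoints
  never leave its domain. \<open>act_poly\<close> is both the polynomiality behind the density
  arguments and the source of the dimension bound. \<open>N > 0\<close> makes the place values
  \<open>hgt n N i\<close> strictly decreasing.\<close>

locale unitary_rep = unitary_space scale V ip
  for scale :: "complex \<Rightarrow> 'v::ab_group_add \<Rightarrow> 'v" (infixr "*s" 75)
    and V :: "'v set" and ip :: "'v \<Rightarrow> 'v \<Rightarrow> complex" +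
  fixes act :: "complex mat \<Rightarrow> 'v \<Rightarrow> 'v" and n N :: nat
  assumes N_pos: "N > 0"
    and act_in: "g \<in> carrier_mat n n \<Longrightarrow> v \<in> V \<Longrightarrow> act g v \<in> V"
    and act_add: "g \<in> carrier_mat n n \<Longrightarrow> u \<in> V \<Longrightarrow> v \<in> V \<Longrightarrow> act g (u + v) = act g u + act g v"
    and act_scale: "g \<in> carrier_mat n n \<Longrightarrow> v \<in> V \<Longrightarrow> act g (c *s v) = c *s act g v"
    and act_one: "v \<in> V \<Longrightarrow> act (1\<^sub>m n) v = v"
    and act_mult: "g \<in> carrier_mat n n \<Longrightarrow> h \<in> carrier_mat n n \<Longrightarrow> v \<in> V \<Longrightarrow> act (g * h) v = act g (act h v)"
    and act_adj: "g \<in> carrier_mat n n \<Longrightarrow> v \<in> V \<Longrightarrow> w \<in> V \<Longrightarrow> ip (act g v) w = ip v (act (adj g) w)"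
    and act_poly: "v \<in> V \<Longrightarrow> \<exists>c. (\<forall>e\<in>exps n N. c e \<in> V) \<and>
      (\<forall>g\<in>carrier_mat n n. act g v = (\<Sum>e\<in>exps n N. entry_mon n e g *s c e))"
begin

lemma act_0 [simp]: "g \<in> carrier_mat n n \<Longrightarrow> act g 0 = 0"
  using act_scale[of g 0 0] V_closed by simp

lemma act_diff: "g \<in> carrier_mat n n \<Longrightarrow> u \<in> V \<Longrightarrow> v \<in> V \<Longrightarrow> act g (u - v) = act g u - act g v"
  using act_add[of g u "(-1) *s v"] act_scale[of g v "-1"] V_closed(4)[of v "-1"] by simp

lemma act_sum: "g \<in> carrier_mat n n \<Longrightarrow> (\<And>i. i \<in> I \<Longrightarrow> f i \<in> V) \<Longrightarrow> act g (sum f I) = (\<Sum>i\<in>I. act g (f i))"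
  by (induction I rule: infinite_finite_induct) (auto simp: act_add V_closed)

definition stable :: "'v set \<Rightarrow> bool" where
  "stable U \<longleftrightarrow> subspace U \<and> U \<subseteq> V \<and> (\<forall>g\<in>carrier_mat n n. \<forall>u\<in>U. act g u \<in> U)"

lemma stableD: assumes "stable U"
  shows "subspace U" "U \<subseteq> V" "g \<in> carrier_mat n n \<Longrightarrow> u \<in> U \<Longrightarrow> act g u \<in> U"
  using assms by (auto simp: stable_def)

definition weight :: "(nat \<Rightarrow> nat) \<Rightarrow> 'v \<Rightarrow> bool" where
  "weight \<mu> v \<longleftrightarrow> (\<forall>t. (\<forall>i<n. t i \<noteq> 0) \<longrightarrow> act (dg n t) v = (\<Prod>i<n. t i ^ \<mu> i) *s v)"

text \<open>A one-parameter subgroup of the torus that acts on weight \<mu> with exponent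
  \<open>wheight n N \<mu>\<close>, so distinct weights in \<open>wts n N\<close> have distinct
  exponents.\<close>

definition hm :: "complex \<Rightarrow> complex mat" where
  "hm r = dg n (\<lambda>i. r ^ hgt n N i)"

lemma hm_carrier [simp]: "hm r \<in> carrier_mat n n"
  by (simp add: hm_def)

lemma weight_hm: "weight \<mu> v \<Longrightarrow> r \<noteq> 0 \<Longrightarrow> act (hm r) v = r ^ wheight n N \<mu> *s v"
  by (simp add: weight_def hm_def wheight_def power_sum flip: power_mult)

text \<open>At a diagonal matrix only monomials in the diagonal entries survive, so the expansion of
  \<open>act_poly\<close> is already a sum of torus characters and its coefficients are the weight
  components. \<open>separate_exponents\<close> along \<open>hm\<close> puts them into
  \<open>U\<close>.\<close>

lemma weight_decomposition:
  assumes U: "stable U" and v: "v \<in> U"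
  obtains x where "v = (\<Sum>\<mu>\<in>wts n N. x \<mu>)" "\<forall>\<mu>\<in>wts n N. x \<mu> \<in> U \<and> weight \<mu> (x \<mu>)"
proof -
  have vV: "v \<in> V" using stableD[OF U] v by auto
  obtain c where c: "\<forall>e\<in>exps n N. c e \<in> V"
    "\<forall>g\<in>carrier_mat n n. act g v = (\<Sum>e\<in>exps n N. entry_mon n e g *s c e)" using act_poly[OF vV] by blast
  define dge where "dge \<mu> = (\<lambda>p\<in>{..<n} \<times> {..<n}. if fst p = snd p then \<mu> (fst p) else 0)" for \<mu> :: "nat \<Rightarrow> nat"
  define x where "x \<mu> = c (dge \<mu>)" for \<mu>
  have dge_in: "dge ` wts n N \<subseteq> exps n N" by (auto simp: dge_def exps_def wts_def split: if_splits)
  have dge_inj: "inj_on dge (wts n N)"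
  proof (rule inj_onI)
    fix \<mu> \<nu> assume *: "\<mu> \<in> wts n N" "\<nu> \<in> wts n N" "dge \<mu> = dge \<nu>"
    have "\<mu> i = \<nu> i" for i
    proof (cases "i < n")
      case True
      then show ?thesis using fun_cong[OF *(3), of "(i, i)"] by (simp add: dge_def)
    qed (use * in \<open>auto simp: wts_def\<close>)
    then show "\<mu> = \<nu>" by auto
  qed
  have mon_dge: "entry_mon n (dge \<mu>) (dg n t) = (\<Prod>i<n. t i ^ \<mu> i)" for \<mu> t
  proof -
    have "entry_mon n (dge \<mu>) (dg n t) = (\<Prod>i<n. \<Prod>j<n. if j = i then t i ^ \<mu> i else 1)"
      unfolding entry_mon_def by (intro prod.cong refl) (auto simp: dge_def)
    then show ?thesis by simp
  qed
  have mon_0: "entry_mon n e (dg n t) = 0" if e: "e \<in> exps n N" "e \<notin> dge ` wts n N" for e t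
  proof (rule ccontr)
    assume nz: "entry_mon n e (dg n t) \<noteq> 0"
    have off: "e (i, j) = 0" if "i < n" "j < n" "i \<noteq> j" for i j
    proof (rule ccontr)
      assume "e (i, j) \<noteq> 0"
      then have z: "(\<Prod>j<n. dg n t $$ (i, j) ^ e (i, j)) = 0"
        using that by (intro prod_zero) (auto intro!: bexI[of _ j])
      have "entry_mon n e (dg n t) = 0"
        unfolding entry_mon_def by (rule prod_zero[OF finite_lessThan], rule bexI[of _ i], rule z) (use that in simp)
      then show False using nz by simp
    qed
    define \<mu> where "\<mu> i = (if i < n then e (i, i) else 0)" for i
    have "\<mu> \<in> wts n N" using e by (auto simp: wts_def \<mu>_def exps_def PiE_def Pi_def)
    moreover have "e = dge \<mu>"
    proof
      fix p show "e p = dge \<mu> p"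
        using off e by (cases p) (auto simp: dge_def \<mu>_def exps_def PiE_def extensional_def)
    qed
    ultimately show False using e by blast
  qed
  have exp: "act (dg n t) v = (\<Sum>\<mu>\<in>wts n N. (\<Prod>i<n. t i ^ \<mu> i) *s x \<mu>)" for t
  proof -
    have "act (dg n t) v = (\<Sum>e\<in>exps n N. entry_mon n e (dg n t) *s c e)" using c by simp
    also have "\<dots> = (\<Sum>e\<in>dge ` wts n N. entry_mon n e (dg n t) *s c e)"
      using dge_in mon_0 by (intro sum.mono_neutral_right) auto
    also have "\<dots> = (\<Sum>\<mu>\<in>wts n N. (\<Prod>i<n. t i ^ \<mu> i) *s x \<mu>)"
      using dge_inj by (subst sum.reindex) (auto simp: mon_dge x_def)
    finally show ?thesis .
  qed
  have exph: "act (dg n (\<lambda>i. t i * s ^ hgt n N i)) v = (\<Sum>\<mu>\<in>wts n N. s ^ wheight n N \<mu> *s ((\<Prod>i<n. t i ^ \<mu> i) *s x \<mu>))" for t s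
    unfolding exp by (intro sum.cong refl)
      (simp add: power_mult_distrib prod.distrib wheight_def power_sum mult.commute flip: power_mult)
  have xV: "x \<mu> \<in> V" if "\<mu> \<in> wts n N" for \<mu> using c dge_in that by (auto simp: x_def)
  have xU: "x \<mu> \<in> U" if "\<mu> \<in> wts n N" for \<mu>
  proof (rule separate_exponents[OF stableD(1)[OF U] finite_wts wheight_inj _ that])
    fix s :: complex
    show "(\<Sum>i\<in>wts n N. s ^ wheight n N i *s x i) \<in> U"
      using exph[of "\<lambda>_. 1" s] stableD(3)[OF U _ v, of "dg n (\<lambda>i. 1 * s ^ hgt n N i)"] by simp
  qed
  have "weight \<mu> (x \<mu>)" if \<mu>: "\<mu> \<in> wts n N" for \<mu>
    unfolding weight_def
  proof (intro allI impI)
    fix t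
    \<comment> \<open>The defect of \<open>x \<nu>\<close> from being a weight vector. Expanding the
      action of \<open>dg n t\<close> combined with the one-parameter subgroup in two ways shows
      that these defects, weighted by powers of \<open>s\<close>, sum to zero for every nonzero
      \<open>s\<close>.\<close>
    define y where "y \<nu> = act (dg n t) (x \<nu>) - (\<Prod>i<n. t i ^ \<nu> i) *s x \<nu>" for \<nu>
    have "y \<mu> \<in> {0}"
    proof (rule separate_exponents[OF _ finite_wts wheight_inj _ \<mu>])
      fix s :: complex
      have "act (dg n (\<lambda>i. t i * s ^ hgt n N i)) v = act (dg n t) (act (dg n (\<lambda>i. 1 * s ^ hgt n N i)) v)"
        using vV by (simp add: dg_mult_dg flip: act_mult)
      also have "\<dots> = (\<Sum>\<mu>\<in>wts n N. s ^ wheight n N \<mu> *s act (dg n t) (x \<mu>))"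
        unfolding exph by (subst act_sum) (auto simp: xV V_closed act_scale)
      finally show "(\<Sum>i\<in>wts n N. s ^ wheight n N i *s y i) \<in> {0}"
        unfolding exph by (simp add: y_def scale_right_diff_distrib sum_subtractf)
    qed (simp add: subspace_def)
    then show "act (dg n t) (x \<mu>) = (\<Prod>i<n. t i ^ \<mu> i) *s x \<mu>" by (simp add: y_def)
  qed
  moreover have "v = (\<Sum>\<mu>\<in>wts n N. x \<mu>)" using exp[of "\<lambda>_. 1"] vV by (simp add: dg_one act_one)
  ultimately show ?thesis using that xU by blast
qed

lemma hm_eigen_weight:
  assumes U: "stable U" and x: "x \<in> U" "x \<noteq> 0" and eig: "\<And>r. r \<noteq> 0 \<Longrightarrow> act (hm r) x = r ^ j *s x"
  obtains \<mu> y where "\<mu> \<in> wts n N" "wheight n N \<mu> = j" "y \<in> U" "y \<noteq> 0" "weight \<mu> y"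
proof -
  obtain c where c: "x = (\<Sum>\<mu>\<in>wts n N. c \<mu>)" "\<forall>\<mu>\<in>wts n N. c \<mu> \<in> U \<and> weight \<mu> (c \<mu>)"
    using weight_decomposition[OF U x(1)] by blast
  have "\<exists>\<mu>\<in>wts n N. wheight n N \<mu> = j \<and> c \<mu> \<noteq> 0"
  proof (rule ccontr)
    assume none: "\<not> (\<exists>\<mu>\<in>wts n N. wheight n N \<mu> = j \<and> c \<mu> \<noteq> 0)"
    define W where "W = {\<mu> \<in> wts n N. wheight n N \<mu> \<noteq> j}"
    \<comment> \<open>The index \<open>None\<close> stands for \<open>- x\<close> with exponent
      \<open>j\<close>. If no weight component of height \<open>j\<close> is nonzero, all exponents
      are distinct and the eigenvector equation forces \<open>x = 0\<close>.\<close>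
    define I where "I = insert None (Some ` W)"
    define \<epsilon> where "\<epsilon> = case_option j (wheight n N)"
    define y where "y = case_option (- x) c"
    have "y None \<in> {0}"
    proof (rule separate_exponents[where I = I and \<epsilon> = \<epsilon>])
      show "inj_on \<epsilon> I" using wheight_inj[of n N] by (auto simp: inj_on_def I_def \<epsilon>_def W_def)
      fix s :: complex assume s: "s \<noteq> 0"
      have "s ^ j *s x = act (hm s) x" using eig s by simp
      also have "\<dots> = (\<Sum>\<mu>\<in>wts n N. s ^ wheight n N \<mu> *s c \<mu>)"
        unfolding c(1) using c(2) stableD(2)[OF U] s
        by (subst act_sum) (auto simp: weight_hm intro!: sum.cong)
      also have "\<dots> = (\<Sum>\<mu>\<in>W. s ^ wheight n N \<mu> *s c \<mu>)"
        using none by (intro sum.mono_neutral_right) (auto simp: W_def)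
      finally have "s ^ j *s x = (\<Sum>\<mu>\<in>W. s ^ wheight n N \<mu> *s c \<mu>)" .
      moreover have "(\<Sum>i\<in>I. s ^ \<epsilon> i *s y i) = - (s ^ j *s x) + (\<Sum>\<mu>\<in>W. s ^ wheight n N \<mu> *s c \<mu>)"
        unfolding I_def by (subst sum.insert) (auto simp: W_def \<epsilon>_def y_def sum.reindex)
      ultimately show "(\<Sum>i\<in>I. s ^ \<epsilon> i *s y i) \<in> {0}" by simp
    qed (auto simp: I_def W_def subspace_def)
    then show False using x by (simp add: y_def)
  qed
  then show ?thesis using c that by blast
qed

text \<open>The zero vector satisfies this for every \<mu>; nonvanishing is assumed separately where
  it matters.\<close>

definition hw :: "(nat \<Rightarrow> nat) \<Rightarrow> 'v \<Rightarrow> bool" where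
  "hw \<mu> v \<longleftrightarrow> v \<in> V \<and> (\<forall>g\<in>carrier_mat n n. upper_triangular g \<longrightarrow> (\<forall>i<n. g $$ (i, i) \<noteq> 0) \<longrightarrow>
    act g v = (\<Prod>i<n. g $$ (i, i) ^ \<mu> i) *s v)"

text \<open>The torus contracts \<open>g\<close> to its diagonal part along a curve
  \<open>gs s\<close> with \<open>gs 1 = g\<close>. The coefficient of \<open>s ^ j\<close> in
  \<open>act (gs s) v\<close> is an \<open>hm\<close>-eigenvector whose height exceeds that of \<mu>
  by \<open>j\<close>, so maximality leaves only \<open>j = 0\<close> and the curve is constant. The
  hypothesis \<open>max\<close> speaks of \<open>hm\<close>-eigenvectors because that is what these
  coefficients are known to be.\<close>

lemma max_weight_hw:
  assumes U: "stable U" and v: "v \<in> U" "weight \<mu> v"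
    and max: "\<And>x j. x \<in> U \<Longrightarrow> wheight n N \<mu> < j \<Longrightarrow> (\<And>r. r \<noteq> 0 \<Longrightarrow> act (hm r) x = r ^ j *s x) \<Longrightarrow> x = 0"
  shows "hw \<mu> v"
  unfolding hw_def
proof (intro conjI ballI impI)
  show vV: "v \<in> V" using U v stableD by blast
  fix g :: "complex mat"
  assume g: "g \<in> carrier_mat n n" and up: "upper_triangular g" and nz: "\<forall>i<n. g $$ (i, i) \<noteq> 0"
  have low: "g $$ (i, j) = 0" if "j < i" "i < n" for i j using up g that by auto
  obtain c where c: "\<forall>e\<in>exps n N. c e \<in> V"
    "\<forall>g\<in>carrier_mat n n. act g v = (\<Sum>e\<in>exps n N. entry_mon n e g *s c e)" using act_poly[OF vV] by blast
  \<comment> \<open>For nonzero \<open>s\<close> this is \<open>g\<close> conjugated by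
    \<open>hm s\<close>. The truncated subtraction is harmless: below the diagonal, where it
    truncates, \<open>g\<close> is zero.\<close>
  define gs where "gs s = mat n n (\<lambda>(i, j). g $$ (i, j) * s ^ (hgt n N i - hgt n N j))" for s
  have gs_c [simp]: "gs s \<in> carrier_mat n n" for s by (simp add: gs_def)
  define \<omega> where "\<omega> e = (\<Sum>i<n. \<Sum>j<n. (hgt n N i - hgt n N j) * e (i, j))" for e
  define y where "y j = (\<Sum>e\<in>{e \<in> exps n N. \<omega> e = j}. entry_mon n e g *s c e)" for j
  define J where "J = \<omega> ` exps n N"
  have yV: "y j \<in> V" for j using c by (auto simp: y_def intro!: V_closed)
  have F: "act (gs s) v = (\<Sum>j\<in>J. s ^ j *s y j)" for s
  proof -
    have "act (gs s) v = (\<Sum>e\<in>exps n N. s ^ \<omega> e *s (entry_mon n e g *s c e))"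
      using c entry_mon_scale[of n "gs s" g s "\<lambda>i j. hgt n N i - hgt n N j"]
      by (simp add: gs_def \<omega>_def mult.commute)
    also have "\<dots> = (\<Sum>j\<in>J. \<Sum>e\<in>{e \<in> exps n N. \<omega> e = j}. s ^ \<omega> e *s (entry_mon n e g *s c e))"
      unfolding J_def by (rule sum.image_gen) simp
    also have "\<dots> = (\<Sum>j\<in>J. s ^ j *s y j)"
      unfolding y_def scale_sum_right by (intro sum.cong) auto
    finally show ?thesis .
  qed
  have comm: "hm r * gs s = gs (r * s) * hm r" for r s
  proof (rule eq_matI)
    fix i j assume "i < dim_row (gs (r * s) * hm r)" "j < dim_col (gs (r * s) * hm r)"
    then have ij: "i < n" "j < n" using hm_carrier[of r] by (auto simp: gs_def)
    have "r ^ hgt n N i * g $$ (i, j) = g $$ (i, j) * r ^ (hgt n N i - hgt n N j) * r ^ hgt n N j"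
    proof (cases "i \<le> j")
      case True
      then have "r ^ hgt n N i = r ^ (hgt n N i - hgt n N j) * r ^ hgt n N j"
        using hgt_mono[of i j n N] by (simp flip: power_add)
      then show ?thesis by simp
    qed (use low ij in simp)
    then show "(hm r * gs s) $$ (i, j) = (gs (r * s) * hm r) $$ (i, j)"
      unfolding hm_def dg_mult_index(1)[OF gs_c ij] dg_mult_index(2)[OF gs_c ij]
      using ij by (auto simp: gs_def power_mult_distrib)
  qed (auto simp: gs_def hm_def)
  have yU: "y j \<in> U" if "j \<in> J" for j
  proof (rule separate_exponents[where I = J and \<epsilon> = "\<lambda>j. j", OF stableD(1)[OF U] _ _ _ that])
    show "(\<Sum>i\<in>J. s ^ i *s y i) \<in> U" for s
      using F[of s] stableD(3)[OF U gs_c v(1)] by metis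
  qed (auto simp: J_def)
  have eig: "act (hm r) (y j) = r ^ (wheight n N \<mu> + j) *s y j" if j: "j \<in> J" and r: "r \<noteq> 0" for r j
  proof -
    define z where "z j = act (hm r) (y j) - r ^ (wheight n N \<mu> + j) *s y j" for j
    have "z j \<in> {0}"
    proof (rule separate_exponents[where I = J and \<epsilon> = "\<lambda>j. j", OF _ _ _ _ j])
      fix s :: complex
      have "act (hm r) (act (gs s) v) = act (gs (r * s)) (act (hm r) v)"
        using comm vV by (simp flip: act_mult)
      also have "\<dots> = r ^ wheight n N \<mu> *s act (gs (r * s)) v"
        using v vV r by (simp add: weight_hm act_scale)
      finally have "(\<Sum>j\<in>J. s ^ j *s act (hm r) (y j)) = (\<Sum>j\<in>J. s ^ j *s (r ^ (wheight n N \<mu> + j) *s y j))"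
        unfolding F by (subst (asm) act_sum)
          (auto simp: yV V_closed act_scale scale_sum_right power_add power_mult_distrib mult_ac)
      then show "(\<Sum>i\<in>J. s ^ i *s z i) \<in> {0}"
        by (simp add: z_def scale_right_diff_distrib sum_subtractf)
    qed (auto simp: J_def subspace_def)
    then show ?thesis by (simp add: z_def)
  qed
  have "y j = 0" if "j \<in> J" "j > 0" for j
    using max[OF yU[OF that(1)], of "wheight n N \<mu> + j"] eig that by auto
  then have const: "s ^ j *s y j = t ^ j *s y j" if "j \<in> J" for s t j
    using that by (cases "j = 0") auto
  have "act (gs 1) v = act (gs 0) v" unfolding F by (intro sum.cong refl const)
  moreover have "gs 1 = g" using g by (intro eq_matI) (auto simp: gs_def)
  moreover have "gs 0 = dg n (\<lambda>i. g $$ (i, i))"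
  proof (rule eq_matI)
    fix i j assume "i < dim_row (dg n (\<lambda>i. g $$ (i, i)))" "j < dim_col (dg n (\<lambda>i. g $$ (i, i)))"
    then show "gs 0 $$ (i, j) = dg n (\<lambda>i. g $$ (i, i)) $$ (i, j)"
      using hgt_strict[of i j n N] N_pos low[of j i] by (cases i j rule: linorder_cases) (auto simp: gs_def)
  qed (auto simp: gs_def)
  ultimately show "act g v = (\<Prod>i<n. g $$ (i, i) ^ \<mu> i) *s v" using v nz by (simp add: weight_def)
qed

text \<open>A weight of greatest height in \<open>U\<close> belongs to highest weight vectors by
  \<open>max_weight_hw\<close>. It is dominant, since a permutation matrix exchanging two adjacent
  coordinates would otherwise produce a greater height. The comparison with \<nu> is what bounds the
  weights of a component in \<open>comp_weight_hw\<close>.\<close>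

lemma hw_exists_above:
  assumes U: "stable U" and y: "y \<in> U" "y \<noteq> 0" "weight \<nu> y" "\<nu> \<in> wts n N"
  obtains \<mu> v where "\<mu> \<in> doms n N" "wheight n N \<nu> \<le> wheight n N \<mu>" "v \<in> U" "v \<noteq> 0" "hw \<mu> v"
proof -
  define H where "H = {\<mu> \<in> wts n N. \<exists>x\<in>U. x \<noteq> 0 \<and> weight \<mu> x}"
  have H: "finite H" "\<nu> \<in> H" using y by (auto simp: H_def)
  obtain \<mu> where \<mu>: "\<mu> \<in> H" "\<forall>\<mu>'\<in>H. wheight n N \<mu>' \<le> wheight n N \<mu>"
  proof -
    have fin: "finite (wheight n N ` H)" using H by simp
    have "Max (wheight n N ` H) \<in> wheight n N ` H" using H fin by (intro Max_in) auto
    then obtain \<mu> where "\<mu> \<in> H" "Max (wheight n N ` H) = wheight n N \<mu>" by auto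
    then show ?thesis using that[of \<mu>] Max_ge[OF fin] by auto
  qed
  obtain v where v: "v \<in> U" "v \<noteq> 0" "weight \<mu> v" using \<mu> by (auto simp: H_def)
  have vV: "v \<in> V" using stableD[OF U] v by auto
  have hw: "hw \<mu> v"
  proof (rule max_weight_hw[OF U v(1,3)])
    fix x j assume x: "x \<in> U" "wheight n N \<mu> < j" "\<And>r. r \<noteq> 0 \<Longrightarrow> act (hm r) x = r ^ j *s x"
    show "x = 0"
    proof (rule ccontr)
      assume "x \<noteq> 0"
      then obtain \<mu>' y' where "\<mu>' \<in> wts n N" "wheight n N \<mu>' = j" "y' \<in> U" "y' \<noteq> 0" "weight \<mu>' y'"
        using hm_eigen_weight[OF U x(1) _ x(3)] by blast
      then show False using \<mu>(2) x(2) by (auto simp: H_def)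
    qed
  qed
  have "\<mu> (Suc i) \<le> \<mu> i" if i: "Suc i < n" for i
  proof (rule ccontr)
    assume lt: "\<not> \<mu> (Suc i) \<le> \<mu> i"
    define \<sigma> where "\<sigma> = Transposition.transpose i (Suc i)"
    define sw where "sw = mat n n (\<lambda>(a, b). if a = \<sigma> b then 1 else 0 :: complex)"
    have sw_c: "sw \<in> carrier_mat n n" by (simp add: sw_def)
    have \<sigma>n: "\<sigma> a < n \<longleftrightarrow> a < n" for a using i by (auto simp: \<sigma>_def Transposition.transpose_def)
    have \<sigma>\<sigma>: "\<sigma> (\<sigma> a) = a" for a by (simp add: \<sigma>_def)
    have sws: "sw * sw = 1\<^sub>m n"
    proof (rule eq_matI)
      fix a b assume "a < dim_row (1\<^sub>m n)" "b < dim_col (1\<^sub>m n)"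
      then have ab: "a < n" "b < n" by auto
      have "(sw * sw) $$ (a, b) = (\<Sum>l<n. sw $$ (a, l) * sw $$ (l, b))"
        using ab sw_c by (intro index_mult_sum)
      also have "\<dots> = (\<Sum>l<n. if l = \<sigma> b then (if a = b then 1 else 0) else 0)"
        using ab by (intro sum.cong refl) (auto simp: sw_def \<sigma>\<sigma>)
      finally show "(sw * sw) $$ (a, b) = 1\<^sub>m n $$ (a, b)" using ab \<sigma>n by simp
    qed (auto simp: sw_def)
    have comm: "dg n t * sw = sw * dg n (t \<circ> \<sigma>)" for t
    proof (rule eq_matI)
      fix a b assume "a < dim_row (sw * dg n (t \<circ> \<sigma>))" "b < dim_col (sw * dg n (t \<circ> \<sigma>))"
      then have ab: "a < n" "b < n" by (auto simp: sw_def)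
      show "(dg n t * sw) $$ (a, b) = (sw * dg n (t \<circ> \<sigma>)) $$ (a, b)"
        unfolding dg_mult_index[OF sw_c ab] using ab by (simp add: sw_def)
    qed (auto simp: sw_def)
    have "weight (\<mu> \<circ> \<sigma>) (act sw v)"
      unfolding weight_def
    proof (intro allI impI)
      fix t :: "nat \<Rightarrow> complex" assume "\<forall>i<n. t i \<noteq> 0"
      then have t: "\<forall>i<n. (t \<circ> \<sigma>) i \<noteq> 0" using \<sigma>n by auto
      have "act (dg n t) (act sw v) = act sw (act (dg n (t \<circ> \<sigma>)) v)"
        using sw_c vV comm by (simp flip: act_mult)
      also have "\<dots> = (\<Prod>i<n. t (\<sigma> i) ^ \<mu> i) *s act sw v"
        using v vV sw_c t by (simp add: weight_def act_scale)
      also have "(\<Prod>i<n. t (\<sigma> i) ^ \<mu> i) = (\<Prod>i<n. t i ^ \<mu> (\<sigma> i))"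
        by (rule prod.reindex_bij_witness[of _ \<sigma> \<sigma>]) (auto simp: \<sigma>\<sigma> \<sigma>n)
      finally show "act (dg n t) (act sw v) = (\<Prod>i<n. t i ^ (\<mu> \<circ> \<sigma>) i) *s act sw v" by simp
    qed
    moreover have "act sw v \<in> U" using stableD(3)[OF U sw_c v(1)] .
    moreover have "act sw v \<noteq> 0"
      using v(2) act_one[OF vV] act_mult[OF sw_c sw_c vV] sws sw_c by auto
    moreover have "\<mu> \<circ> \<sigma> \<in> wts n N" 
    proof -
      have "\<mu> \<in> wts n N" using \<mu>(1) by (simp add: H_def)
      moreover have "\<sigma> a \<ge> n" if "a \<ge> n" for a using \<sigma>n[of a] that by linarith
      ultimately show ?thesis using \<sigma>n by (simp add: wts_def)
    qed
    ultimately have "wheight n N (\<mu> \<circ> \<sigma>) \<le> wheight n N \<mu>" using \<mu>(2) by (auto simp: H_def)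
    then show False using wheight_swap[of i n \<mu> N] i lt N_pos by (simp add: \<sigma>_def)
  qed
  then have "\<mu> \<in> doms n N" using \<mu>(1) by (auto simp: doms_def H_def)
  then show ?thesis using that v hw \<mu>(2) H(2) by blast
qed

lemma hw_exists:
  assumes U: "stable U" and "U \<noteq> {0}"
  obtains \<mu> v where "\<mu> \<in> doms n N" "v \<in> U" "v \<noteq> 0" "hw \<mu> v"
proof -
  obtain v where v: "v \<in> U" "v \<noteq> 0" using assms subspace_0[OF stableD(1)[OF U]] by blast
  obtain x where x: "v = (\<Sum>\<mu>\<in>wts n N. x \<mu>)" "\<forall>\<mu>\<in>wts n N. x \<mu> \<in> U \<and> weight \<mu> (x \<mu>)"
    using weight_decomposition[OF U v(1)] by blast
  then obtain \<mu> where "\<mu> \<in> wts n N" "x \<mu> \<noteq> 0" using v(2) by (metis sum.neutral)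
  then show ?thesis using hw_exists_above[OF U, of "x \<mu>" \<mu>] x that by blast
qed

end

section \<open>Cyclic modules, components and their orthogonality\<close>

context unitary_rep
begin

lemma stable_span:
  assumes "S \<subseteq> V" "\<And>g x. g \<in> carrier_mat n n \<Longrightarrow> x \<in> S \<Longrightarrow> act g x \<in> span S"
  shows "stable (span S)"
proof -
  have SV: "span S \<subseteq> V" using assms(1) V_sub by (intro span_minimal)
  have "span S \<subseteq> {x \<in> V. act g x \<in> span S}" if g: "g \<in> carrier_mat n n" for g
  proof (rule span_minimal)
    show "S \<subseteq> {x \<in> V. act g x \<in> span S}" using assms g by auto
    show "subspace {x \<in> V. act g x \<in> span S}"
      by (rule subspaceI) (auto simp: g V_closed act_add act_scale span_zero span_add span_scale)
  qed
  then show ?thesis unfolding stable_def using SV by auto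
qed

lemma stable_V: "stable V"
  using V_sub act_in by (auto simp: stable_def)

lemma stable_orth:
  assumes U: "stable U" and Y: "stable Y"
  shows "stable {x \<in> U. \<forall>y\<in>Y. ip x y = 0}"
  unfolding stable_def
proof (intro conjI ballI)
  have UV: "x \<in> V" if "x \<in> U" for x using stableD(2)[OF U] that by auto
  have YV: "x \<in> V" if "x \<in> Y" for x using stableD(2)[OF Y] that by auto
  show "subspace {x \<in> U. \<forall>y\<in>Y. ip x y = 0}"
    by (rule subspaceI) (auto simp: UV YV ip_add ip_scale subspace_0[OF stableD(1)[OF U]]
      subspace_add[OF stableD(1)[OF U]] subspace_scale[OF stableD(1)[OF U]])
  show "{x \<in> U. \<forall>y\<in>Y. ip x y = 0} \<subseteq> V" using UV by auto
  fix g :: "complex mat" and x assume g: "g \<in> carrier_mat n n" and x: "x \<in> {x \<in> U. \<forall>y\<in>Y. ip x y = 0}"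
  have "ip (act g x) y = 0" if y: "y \<in> Y" for y
    using act_adj[OF g UV YV[OF y]] x stableD(3)[OF Y adj_carrier[OF g] y] by auto
  then show "act g x \<in> {x \<in> U. \<forall>y\<in>Y. ip x y = 0}" using x stableD(3)[OF U g] by auto
qed

definition cyc :: "'v \<Rightarrow> 'v set" where
  "cyc v = span {act g v | g. g \<in> carrier_mat n n}"

lemma cyc_stable: assumes "v \<in> V" shows "stable (cyc v)"
  unfolding cyc_def
proof (rule stable_span)
  show "{act g v | g. g \<in> carrier_mat n n} \<subseteq> V" using assms act_in by auto
  fix g :: "complex mat" and x assume g: "g \<in> carrier_mat n n" and "x \<in> {act g v | g. g \<in> carrier_mat n n}"
  then obtain h where "h \<in> carrier_mat n n" "x = act h v" by auto
  then show "act g x \<in> span {act g v | g. g \<in> carrier_mat n n}"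
    using act_mult[OF g _ assms, of h] g by (auto intro!: span_base exI[of _ "g * h"])
qed

lemma cyc_self: assumes "v \<in> V" shows "v \<in> cyc v"
  unfolding cyc_def using act_one[OF assms] by (intro span_base) (force intro!: exI[of _ "1\<^sub>m n"])

lemma cyc_least: "stable U \<Longrightarrow> v \<in> U \<Longrightarrow> cyc v \<subseteq> U"
  unfolding cyc_def by (intro span_minimal) (auto simp: stable_def)

text \<open>The coefficient vectors from \<open>act_poly\<close> span all translates and bound the
  size of any independent set of them. A basis is nevertheless chosen among the translates
  themselves, because only translates come with circuits.\<close>

lemma cyc_combination:
  assumes v: "v \<in> V" and x: "x \<in> cyc v"
  obtains G c where "finite G" "G \<subseteq> carrier_mat n n" "card G \<le> (N + 1) ^ n\<^sup>2" "x = (\<Sum>g\<in>G. c g *s act g v)"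
proof -
  obtain c where c: "\<forall>g\<in>carrier_mat n n. act g v = (\<Sum>e\<in>exps n N. entry_mon n e g *s c e)"
    using act_poly[OF v] by blast
  obtain B where B: "B \<subseteq> {act g v | g. g \<in> carrier_mat n n}" "independent B"
    "{act g v | g. g \<in> carrier_mat n n} \<subseteq> span B"
    using maximal_independent_subset[of "{act g v | g. g \<in> carrier_mat n n}"] by blast
  have "{act g v | g. g \<in> carrier_mat n n} \<subseteq> span (c ` exps n N)"
  proof clarify
    fix g :: "complex mat" assume "g \<in> carrier_mat n n"
    then have "act g v = (\<Sum>e\<in>exps n N. entry_mon n e g *s c e)" using c by simp
    also have "\<dots> \<in> span (c ` exps n N)" by (intro span_sum span_scale) (auto intro: span_base)
    finally show "act g v \<in> span (c ` exps n N)" .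
  qed
  then have fin: "finite B" "card B \<le> card (c ` exps n N)"
    using independent_span_bound[of "c ` exps n N" B] B by auto
  have "card (c ` exps n N) \<le> (N + 1) ^ n\<^sup>2" using card_image_le[of "exps n N" c] by (simp add: card_exps)
  with fin have card: "card B \<le> (N + 1) ^ n\<^sup>2" by simp
  have "\<forall>b\<in>B. \<exists>g. g \<in> carrier_mat n n \<and> act g v = b" using B(1) by fast
  then obtain \<gamma> where \<gamma>: "\<forall>b\<in>B. \<gamma> b \<in> carrier_mat n n \<and> act (\<gamma> b) v = b" by metis
  have inj: "inj_on \<gamma> B" using \<gamma> by (metis inj_onI)
  have "cyc v \<subseteq> span B" unfolding cyc_def using B(3) by (intro span_minimal) auto
  then obtain u where u: "x = (\<Sum>b\<in>B. u b *s b)" using x span_finite[OF fin(1)] by auto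
  show ?thesis
  proof (rule that[of "\<gamma> ` B" "\<lambda>g. u (act g v)"])
    show "card (\<gamma> ` B) \<le> (N + 1) ^ n\<^sup>2" using card card_image_le[OF fin(1), of \<gamma>] by simp
    show "x = (\<Sum>g\<in>\<gamma> ` B. u (act g v) *s act g v)"
      using \<gamma> by (simp add: u sum.reindex[OF inj])
  qed (use fin \<gamma> in auto)
qed

text \<open>Generated by highest weight vectors rather than by irreducible subspaces, which makes
  orthogonality accessible through matrix coefficients. \<open>isotypic_eq\<close> identifies it
  with the isotypic component.\<close>

definition comp :: "(nat \<Rightarrow> nat) \<Rightarrow> 'v set" where
  "comp \<mu> = span {act g v | g v. g \<in> carrier_mat n n \<and> hw \<mu> v}"

lemma hw_V: "hw \<mu> v \<Longrightarrow> v \<in> V"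
  by (simp add: hw_def)

lemma comp_stable: "stable (comp \<mu>)"
  unfolding comp_def
proof (rule stable_span)
  show "{act g v | g v. g \<in> carrier_mat n n \<and> hw \<mu> v} \<subseteq> V" using act_in hw_V by auto
  fix g :: "complex mat" and x assume g: "g \<in> carrier_mat n n" and "x \<in> {act g v | g v. g \<in> carrier_mat n n \<and> hw \<mu> v}"
  then obtain h v where h: "h \<in> carrier_mat n n" "hw \<mu> v" "x = act h v" by auto
  then show "act g x \<in> span {act g v | g v. g \<in> carrier_mat n n \<and> hw \<mu> v}"
    using act_mult[OF g h(1) hw_V[OF h(2)]] g by (intro span_base) (force intro!: exI[of _ "g * h"])
qed

lemma comp_V: "comp \<mu> \<subseteq> V"
  using comp_stable stableD by blast

lemma hw_in_comp: assumes "hw \<mu> v" shows "v \<in> comp \<mu>"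
proof -
  have "act (1\<^sub>m n) v \<in> comp \<mu>" 
    unfolding comp_def using assms one_carrier_mat by (intro span_base) blast
  then show ?thesis using act_one hw_V[OF assms] by simp
qed

lemma cyc_in_comp: "hw \<mu> v \<Longrightarrow> cyc v \<subseteq> comp \<mu>"
  using cyc_least comp_stable hw_in_comp by blast

text \<open>The adjoint of a lower triangular matrix is upper triangular and acts on
  \<open>w\<close> by a character; the conjugations from \<open>adj\<close> and from the second
  argument of the form cancel.\<close>

lemma hw_lower:
  assumes w: "hw \<mu> w" and l: "l \<in> carrier_mat n n" "\<forall>i<n. \<forall>j<n. i < j \<longrightarrow> l $$ (i, j) = 0"
    "\<forall>i<n. l $$ (i, i) \<noteq> 0" and x: "x \<in> V"
  shows "ip (act l x) w = (\<Prod>i<n. l $$ (i, i) ^ \<mu> i) * ip x w"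
proof -
  have "upper_triangular (adj l)" using l by (auto simp: adj_def)
  then have "act (adj l) w = (\<Prod>i<n. adj l $$ (i, i) ^ \<mu> i) *s w"
    using w l unfolding hw_def by auto
  moreover have "(\<Prod>i<n. adj l $$ (i, i) ^ \<mu> i) = cnj (\<Prod>i<n. l $$ (i, i) ^ \<mu> i)"
    using l by simp
  ultimately show ?thesis
    using act_adj[OF l(1) x hw_V[OF w]] hw_V[OF w] x by (simp add: ip_scale_right)
qed

lemma polyfun_ip_act:
  assumes "v \<in> V" "w \<in> V" "A \<in> carrier_mat n n" "B \<in> carrier_mat n n"
  shows "polyfun (\<lambda>s. ip (act (A + s \<cdot>\<^sub>m B) v) w)"
proof -
  obtain c where c: "\<forall>e\<in>exps n N. c e \<in> V" "\<forall>g\<in>carrier_mat n n. act g v = (\<Sum>e\<in>exps n N. entry_mon n e g *s c e)"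
    using act_poly[OF assms(1)] by blast
  have "ip (act (A + s \<cdot>\<^sub>m B) v) w = (\<Sum>e\<in>exps n N. entry_mon n e (A + s \<cdot>\<^sub>m B) * ip (c e) w)" for s
  proof -
    have "act (A + s \<cdot>\<^sub>m B) v = (\<Sum>e\<in>exps n N. entry_mon n e (A + s \<cdot>\<^sub>m B) *s c e)" using c assms by simp
    then show ?thesis using c assms by (simp add: ip_sum V_closed ip_scale)
  qed
  then show ?thesis using assms by (simp add: polyfun_intros polyfun_entry_mon)
qed

lemma hw_orth:
  assumes v: "hw \<mu> v" and w: "hw \<nu> w" and 0: "ip v w = 0" and g: "g \<in> carrier_mat n n"
  shows "ip (act g v) w = 0"
\<comment> \<open>With \<open>c = n\<close> the base case of the elimination is the identity matrix
  alone, where the coefficient is \<open>ip v w\<close>.\<close>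
proof (rule gauss_vanishing[where c = n and n = n])
  fix l g u :: "complex mat" assume *: "l \<in> carrier_mat n n" "g \<in> carrier_mat n n" "u \<in> carrier_mat n n"
    "\<forall>i<n. \<forall>j<n. i < j \<longrightarrow> l $$ (i, j) = 0" "\<forall>i<n. l $$ (i, i) \<noteq> 0" "upper_triangular u"
    "\<forall>i<n. u $$ (i, i) \<noteq> 0" "ip (act g v) w = 0"
  have "act (l * g * u) v = act l (act g (act u v))"
    using * hw_V[OF v] by (simp add: act_mult act_in)
  also have "act u v = (\<Prod>i<n. u $$ (i, i) ^ \<mu> i) *s v" using v * unfolding hw_def by blast
  finally show "ip (act (l * g * u) v) w = 0"
    using * hw_V[OF v] hw_V[OF w] hw_lower[OF w *(1,4,5), of "act g v"]
    by (simp add: act_scale act_in V_closed ip_scale)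
next
  fix g :: "complex mat" assume "g \<in> carrier_mat n n" "\<forall>j<n. \<forall>i<n. g $$ (i, j) = (if i = j then 1 else 0)"
  then have "g = 1\<^sub>m n" by (intro eq_matI) auto
  then show "ip (act g v) w = 0" using 0 act_one hw_V[OF v] by simp
qed (use hw_V[OF v] hw_V[OF w] g polyfun_ip_act in auto)

lemma hw_weight: assumes "hw \<mu> v" shows "weight \<mu> v"
  unfolding weight_def
proof (intro allI impI)
  fix t :: "nat \<Rightarrow> complex" assume "\<forall>i<n. t i \<noteq> 0"
  then show "act (dg n t) v = (\<Prod>i<n. t i ^ \<mu> i) *s v"
    using assms[unfolded hw_def, THEN conjunct2, rule_format, of "dg n t"] by simp
qed

text \<open>The diagonal matrix with 2 at place \<open>i\<close> and 1 elsewhere is self-adjoint,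
  and its eigenvalues on \<open>v\<close> and \<open>w\<close> are different powers of 2.\<close>

lemma weight_orth:
  assumes v: "v \<in> V" "weight \<mu> v" and w: "w \<in> V" "weight \<nu> w" and i: "i < n" "\<mu> i \<noteq> \<nu> i"
  shows "ip v w = 0"
proof -
  define t where "t j = (if j = i then 2 else 1 :: complex)" for j
  have P: "(\<Prod>j<n. t j ^ \<kappa> j) = 2 ^ \<kappa> i" for \<kappa>
  proof -
    have "(\<Prod>j<n. t j ^ \<kappa> j) = (\<Prod>j<n. if j = i then 2 ^ \<kappa> i else 1)"
      by (intro prod.cong) (auto simp: t_def)
    then show ?thesis using i by simp
  qed
  have tn: "\<forall>i<n. t i \<noteq> 0" by (simp add: t_def)
  have "adj (dg n t) = dg n t" unfolding adj_dg by (rule arg_cong[where f = "dg n"]) (auto simp: t_def)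
  then have "ip (act (dg n t) v) w = ip v (act (dg n t) w)" using act_adj[of "dg n t" v w] v w by simp
  moreover have "act (dg n t) v = 2 ^ \<mu> i *s v" "act (dg n t) w = 2 ^ \<nu> i *s w"
    using v w tn by (auto simp: weight_def P)
  ultimately have "2 ^ \<mu> i * ip v w = 2 ^ \<nu> i * ip v w"
    using v w by (simp add: ip_scale ip_scale_right)
  moreover have "(2::complex) ^ \<mu> i \<noteq> 2 ^ \<nu> i" using i by (simp add: two_power_complex_inject)
  ultimately show ?thesis by simp
qed

lemma span_orth:
  assumes "S \<subseteq> V" "w \<in> V" "\<And>x. x \<in> S \<Longrightarrow> ip x w = 0" "x \<in> span S"
  shows "ip x w = 0"
proof -
  have "span S \<subseteq> {x \<in> V. ip x w = 0}"
  proof (rule span_minimal)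
    show "subspace {x \<in> V. ip x w = 0}"
      by (rule subspaceI) (auto simp: assms V_closed ip_add ip_scale)
  qed (use assms in auto)
  then show ?thesis using assms(4) by auto
qed

text \<open>On generators, moving \<open>h\<close> to the other side turns the product of
  \<open>act g v\<close> and \<open>act h w\<close> into a matrix coefficient of \<open>v\<close>
  and \<open>w\<close> at \<open>adj h * g\<close>; it vanishes because \<open>v\<close> and
  \<open>w\<close> have different weights.\<close>

lemma comp_orth:
  assumes "i < n" "\<mu> i \<noteq> \<nu> i" "x \<in> comp \<mu>" "y \<in> comp \<nu>"
  shows "ip x y = 0"
proof -
  let ?S = "\<lambda>\<mu>. {act g v | g v. g \<in> carrier_mat n n \<and> hw \<mu> v}"
  have SV: "?S \<kappa> \<subseteq> V" for \<kappa> using act_in hw_V by auto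
  have gen: "ip a b = 0" if ab: "a \<in> ?S \<mu>" "b \<in> ?S \<nu>" for a b
  proof -
    obtain g v h w where *: "a = act g v" "b = act h w" "g \<in> carrier_mat n n" "h \<in> carrier_mat n n"
      "hw \<mu> v" "hw \<nu> w" using ab by auto
    have vw: "v \<in> V" "w \<in> V" using * hw_V by auto
    have "ip v w = 0" using weight_orth[of v \<mu> w \<nu> i] vw * hw_weight assms by blast
    then have "ip (act (adj h * g) v) w = 0"
      by (intro hw_orth[OF *(5,6) _ mult_carrier_mat[OF adj_carrier[OF *(4)] *(3)]])
    then have "ip (act (adj h) (act g v)) w = 0" using * vw by (simp add: act_mult)
    then show ?thesis using act_adj[of "adj h" "act g v" w] * vw act_in by simp
  qed
  have "ip x b = 0" if "b \<in> ?S \<nu>" for b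
    by (rule span_orth[OF SV subsetD[OF SV that] gen[OF _ that] assms(3)[unfolded comp_def]])
  then have bx: "ip b x = 0" if "b \<in> ?S \<nu>" for b
    using that SV comp_V assms(3) by (meson ip_0_commute subsetD)
  have "ip y x = 0"
    by (rule span_orth[OF SV subsetD[OF comp_V assms(3)] bx assms(4)[unfolded comp_def]])
  then show ?thesis using assms comp_V by (meson ip_0_commute subsetD)
qed

lemma hw_comp_unique:
  assumes "hw \<mu> v" "v \<in> comp \<nu>" "v \<noteq> 0" "i < n"
  shows "\<mu> i = \<nu> i"
  using comp_orth[OF assms(4), of \<mu> \<nu> v v] hw_in_comp[OF assms(1)] assms ip_definite hw_V by blast

text \<open>Let \<open>Y\<close> be the span of the pieces of \<open>U\<close>. Its orthogonal
  complement in \<open>U\<close> is stable; if it were nonzero it would contain a highest weight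
  vector, which lies in \<open>Y\<close> by definition and so would be orthogonal to itself.\<close>

lemma stable_decomposition:
  assumes U: "stable U" and x: "x \<in> U"
  shows "x \<in> span (\<Union>\<mu>\<in>doms n N. U \<inter> comp \<mu>)"
proof (rule ccontr)
  define Y where "Y = span (\<Union>\<mu>\<in>doms n N. U \<inter> comp \<mu>)"
  assume "x \<notin> span (\<Union>\<mu>\<in>doms n N. U \<inter> comp \<mu>)"
  then have xY: "x \<notin> Y" by (simp add: Y_def)
  have Y: "stable Y" unfolding Y_def
  proof (rule stable_span)
    show "(\<Union>\<mu>\<in>doms n N. U \<inter> comp \<mu>) \<subseteq> V" using comp_V by auto
    fix g :: "complex mat" and x assume "g \<in> carrier_mat n n" "x \<in> (\<Union>\<mu>\<in>doms n N. U \<inter> comp \<mu>)"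
    then obtain \<mu> where "\<mu> \<in> doms n N" "act g x \<in> U \<inter> comp \<mu>"
      using stableD(3)[OF U] stableD(3)[OF comp_stable] by auto
    then show "act g x \<in> span (\<Union>\<mu>\<in>doms n N. U \<inter> comp \<mu>)" by (intro span_base) auto
  qed
  have YU: "Y \<subseteq> U" unfolding Y_def using stableD(1)[OF U] by (intro span_minimal) auto
  have xV: "x \<in> V" using stableD(2)[OF U] x by auto
  obtain y where y: "y \<in> Y" "\<forall>z\<in>Y. ip (x - y) z = 0"
    using orth_proj[OF stableD(1,2)[OF Y] xV] by blast
  define Z where "Z = {x \<in> U. \<forall>y\<in>Y. ip x y = 0}"
  have Z: "stable Z" unfolding Z_def by (rule stable_orth[OF U Y])
  have "x - y \<in> Z" using y x YU subspace_diff[OF stableD(1)[OF U]] by (auto simp: Z_def)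
  moreover have "x - y \<noteq> 0" using xY y by auto
  ultimately have "Z \<noteq> {0}" by auto
  then obtain \<mu> v where v: "\<mu> \<in> doms n N" "v \<in> Z" "v \<noteq> 0" "hw \<mu> v" using hw_exists[OF Z] by blast
  then have "v \<in> Y" unfolding Y_def using hw_in_comp by (intro span_base) (auto simp: Z_def)
  then have "ip v v = 0" using v(2) by (simp add: Z_def)
  then show False using v hw_V ip_definite by blast
qed

lemma hw_diff:
  assumes "hw \<mu> v" "hw \<mu> w" shows "hw \<mu> (v - c *s w)"
  unfolding hw_def
proof (intro conjI ballI impI)
  have V: "v \<in> V" "w \<in> V" using assms hw_V by auto
  then show "v - c *s w \<in> V" by (simp add: V_closed)
  fix g :: "complex mat" assume g: "g \<in> carrier_mat n n" "upper_triangular g" "\<forall>i<n. g $$ (i, i) \<noteq> 0"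
  then have "act g v = (\<Prod>i<n. g $$ (i, i) ^ \<mu> i) *s v" "act g w = (\<Prod>i<n. g $$ (i, i) ^ \<mu> i) *s w"
    using assms unfolding hw_def by blast+
  then show "act g (v - c *s w) = (\<Prod>i<n. g $$ (i, i) ^ \<mu> i) *s (v - c *s w)"
    using V g by (simp add: act_diff act_scale V_closed scale_right_diff_distrib mult.commute)
qed

text \<open>The projection \<open>v1\<close> of \<open>v\<close> to \<open>U\<close> is again a
  highest weight vector of weight \<mu>, and inside \<open>cyc v\<close> these are the multiples of
  \<open>v\<close>. So \<open>v1\<close> is a multiple of \<open>v\<close>: a nonzero one puts
  \<open>v\<close> into \<open>U\<close>, and zero makes \<open>U\<close> orthogonal to all of
  \<open>cyc v\<close>.\<close>

lemma cyc_irreducible: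
  assumes v: "hw \<mu> v" "v \<noteq> 0" and U: "stable U" "U \<subseteq> cyc v"
  shows "U = {0} \<or> U = cyc v"
proof -
  have vV: "v \<in> V" using v hw_V by blast
  obtain v1 where v1: "v1 \<in> U" "\<forall>x\<in>U. ip (v - v1) x = 0"
    using orth_proj[OF stableD(1,2)[OF U(1)] vV] by blast
  have v1V: "v1 \<in> V" "v - v1 \<in> V" using v1 stableD(2)[OF U(1)] vV V_closed by auto
  have hw1: "hw \<mu> v1"
    unfolding hw_def
  proof (intro conjI ballI impI v1V)
    fix g :: "complex mat" assume g: "g \<in> carrier_mat n n" "upper_triangular g" "\<forall>i<n. g $$ (i, i) \<noteq> 0"
    define \<chi> where "\<chi> = (\<Prod>i<n. g $$ (i, i) ^ \<mu> i)"
    \<comment> \<open>\<open>z\<close> lies in \<open>U\<close>, and since \<open>act g v\<close>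
      equals \<open>\<chi> *s v\<close> it is also a combination of \<open>v - v1\<close> and its
      translate, both orthogonal to \<open>U\<close>.\<close>
    define z where "z = act g v1 - \<chi> *s v1"
    have zU: "z \<in> U" unfolding z_def using v1 U g
      by (intro subspace_diff subspace_scale stableD) auto
    have zV: "z \<in> V" using zU stableD(2)[OF U(1)] by auto
    have "act g v = \<chi> *s v" using v g unfolding hw_def \<chi>_def by blast
    then have "ip z z = ip (\<chi> *s (v - v1) - act g (v - v1)) z"
      using g vV v1V by (simp add: z_def act_diff scale_right_diff_distrib)
    moreover have "ip (act g (v - v1)) z = 0"
      using stable_orth[OF stable_V U(1)] v1 v1V g(1) zU by (auto simp: stable_def)
    moreover have "ip (\<chi> *s (v - v1)) z = 0" using v1 zU v1V zV by (simp add: ip_scale)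
    ultimately have "ip z z = 0"
      using ip_diff[OF V_closed(4)[OF v1V(2), of \<chi>] act_in[OF g(1) v1V(2)] zV] by simp
    then have "z = 0" using zV ip_definite by blast
    then show "act g v1 = (\<Prod>i<n. g $$ (i, i) ^ \<mu> i) *s v1" by (simp add: z_def \<chi>_def)
  qed
  \<comment> \<open>Chosen so that \<open>v1 - c *s v\<close> is orthogonal to \<open>v\<close>; by
    \<open>hw_orth\<close> it is then orthogonal to \<open>cyc v\<close>, which contains it.\<close>
  define c where "c = ip v1 v / ip v v"
  define z where "z = v1 - c *s v"
  have nz: "ip v v \<noteq> 0" using v vV ip_definite by blast
  have hwz: "hw \<mu> z" unfolding z_def by (rule hw_diff[OF hw1 v(1)])
  have zV: "z \<in> V" using hwz hw_V by blast
  have "ip z v = 0" using nz vV v1V V_closed(4)[OF vV, of c] by (simp add: z_def ip_diff ip_scale c_def)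
  then have vz: "ip v z = 0" using ip_0_commute zV vV by blast
  have orth: "ip x z = 0" if "x \<in> cyc v" for x
  proof (rule span_orth[OF _ zV _ that[unfolded cyc_def]])
    show "{act g v | g. g \<in> carrier_mat n n} \<subseteq> V" using act_in vV by auto
    show "ip y z = 0" if "y \<in> {act g v | g. g \<in> carrier_mat n n}" for y
      using that hw_orth[OF v(1) hwz vz] by auto
  qed
  have "z \<in> cyc v" unfolding z_def using v1 U cyc_self[OF vV] stableD(1)[OF cyc_stable[OF vV]]
    by (intro subspace_diff subspace_scale) auto
  then have "z = 0" using orth zV ip_definite by blast
  then have v1c: "v1 = c *s v" by (simp add: z_def)
  show ?thesis
  proof (cases "c = 0")
    case True
    then have vU: "ip v x = 0" if "x \<in> U" for x using v1 v1c that by simp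
    have "v \<in> {x \<in> V. \<forall>y\<in>U. ip x y = 0}" using vU vV by simp
    then have "cyc v \<subseteq> {x \<in> V. \<forall>y\<in>U. ip x y = 0}" by (rule cyc_least[OF stable_orth[OF stable_V U(1)]])
    then have "ip x x = 0" if "x \<in> U" for x using U(2) that by blast
    then have "x = 0" if "x \<in> U" for x using that stableD(2)[OF U(1)] ip_definite by blast
    then show ?thesis using subspace_0[OF stableD(1)[OF U(1)]] by blast
  next
    case False
    then have "v = inverse c *s v1" by (simp add: v1c)
    then have "v \<in> U" using v1 subspace_scale[OF stableD(1)[OF U(1)]] by simp
    then show ?thesis using cyc_least[OF U(1)] U(2) by blast
  qed
qed

text \<open>Scalar matrices are central, so they act on every translate as on the highest weight
  vector. This detects the size of \<mu>.\<close>

lemma comp_scalar: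
  assumes x: "x \<in> comp \<mu>" and t: "t \<noteq> 0"
  shows "act (dg n (\<lambda>_. t)) x = t ^ (\<Sum>i<n. \<mu> i) *s x"
proof -
  let ?S = "{act g v | g v. g \<in> carrier_mat n n \<and> hw \<mu> v}"
  let ?T = "{x \<in> V. act (dg n (\<lambda>_. t)) x = t ^ (\<Sum>i<n. \<mu> i) *s x}"
  have "span ?S \<subseteq> ?T"
  proof (rule span_minimal)
    show "subspace ?T"
      by (rule subspaceI) (auto simp: V_closed act_add act_scale scale_right_distrib mult.commute)
    have "act (dg n (\<lambda>_. t)) (act g v) = t ^ (\<Sum>i<n. \<mu> i) *s act g v"
      if g: "g \<in> carrier_mat n n" and v: "hw \<mu> v" for g v
    proof -
      have "dg n (\<lambda>_. t) * g = g * dg n (\<lambda>_. t)"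
        by (rule eq_matI) (use g in \<open>auto simp: dg_mult_index simp del: index_mult_mat(1)\<close>)
      then have "act (dg n (\<lambda>_. t)) (act g v) = act g (act (dg n (\<lambda>_. t)) v)"
        using g hw_V[OF v] by (simp flip: act_mult)
      also have "act (dg n (\<lambda>_. t)) v = t ^ (\<Sum>i<n. \<mu> i) *s v"
        using hw_weight[OF v] t by (simp add: weight_def power_sum)
      finally show ?thesis using g hw_V[OF v] by (simp add: act_scale)
    qed
    then show "?S \<subseteq> ?T" using act_in hw_V by auto
  qed
  then show ?thesis using x unfolding comp_def by auto
qed

text \<open>No weight in \<open>comp \<mu>\<close> is higher than \<mu>: a higher one would give, by
  \<open>hw_exists_above\<close>, a highest weight vector in \<open>comp \<mu>\<close> whose weight
  differs from \<mu>.\<close>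

lemma comp_weight_hw:
  assumes x: "x \<in> comp \<mu>" "weight \<mu> x"
  shows "hw \<mu> x"
proof (rule max_weight_hw[OF comp_stable x])
  fix y j assume y: "y \<in> comp \<mu>" "wheight n N \<mu> < j" "\<And>r. r \<noteq> 0 \<Longrightarrow> act (hm r) y = r ^ j *s y"
  show "y = 0"
  proof (rule ccontr)
    assume "y \<noteq> 0"
    then obtain \<nu> z where z: "\<nu> \<in> wts n N" "wheight n N \<nu> = j" "z \<in> comp \<mu>" "z \<noteq> 0" "weight \<nu> z"
      using hm_eigen_weight[OF comp_stable y(1) _ y(3)] by blast
    obtain \<kappa> v where v: "wheight n N \<nu> \<le> wheight n N \<kappa>" "v \<in> comp \<mu>" "v \<noteq> 0" "hw \<kappa> v"
      using hw_exists_above[OF comp_stable z(3,4,5,1)] by blast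
    then have "\<kappa> i = \<mu> i" if "i < n" for i using hw_comp_unique that by blast
    then have "wheight n N \<kappa> = wheight n N \<mu>" by (simp add: wheight_def)
    then show False using v z y by simp
  qed
qed

text \<open>The matrix coefficient \<open>g \<mapsto> \<langle>g v, w\<rangle>\<close> is, up to characters, determined by its value at
  the unipotent matrix \<open>g0\<close> with ones in the last column. Along two explicit lines it equals a
  monomial in the parameter, whose exponent must be nonnegative.\<close>

lemma branching:
  assumes n: "n = Suc m" and v: "v \<in> V"
    and v_hw: "\<And>u. u \<in> carrier_mat n n \<Longrightarrow> upper_triangular u \<Longrightarrow> \<forall>i<n. u $$ (i, i) \<noteq> 0 \<Longrightarrow>
      \<forall>i<n. \<forall>j<n. m \<le> j \<longrightarrow> u $$ (i, j) = (if i = j then 1 else 0) \<Longrightarrow> act u v = (\<Prod>i<m. u $$ (i, i) ^ \<mu> i) *s v"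
    and w: "hw \<kappa> w" and g: "g \<in> carrier_mat n n" "ip (act g v) w \<noteq> 0" and i: "i < m"
  shows "\<kappa> (Suc i) \<le> \<mu> i" "\<mu> i \<le> \<kappa> i"
proof -
  define f where "f g = ip (act g v) w" for g
  define low where "low l \<longleftrightarrow> l \<in> carrier_mat n n \<and> (\<forall>i<n. \<forall>j<n. i < j \<longrightarrow> l $$ (i, j) = 0) \<and> (\<forall>i<n. l $$ (i, i) \<noteq> 0)" for l :: "complex mat"
  \<comment> \<open>These are the invertible upper triangular matrices of the smaller group,
    embedded as the upper left block.\<close>
  define upp where "upp u \<longleftrightarrow> u \<in> carrier_mat n n \<and> upper_triangular u \<and> (\<forall>i<n. u $$ (i, i) \<noteq> 0) \<and>
      (\<forall>i<n. \<forall>j<n. m \<le> j \<longrightarrow> u $$ (i, j) = (if i = j then 1 else 0))" for u :: "complex mat"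
  have cov: "f (l * g * u) = (\<Prod>i<n. l $$ (i, i) ^ \<kappa> i) * (\<Prod>i<m. u $$ (i, i) ^ \<mu> i) * f g"
    if l: "low l" and g: "g \<in> carrier_mat n n" and u: "upp u" for l g u
  proof -
    have c: "l \<in> carrier_mat n n" "u \<in> carrier_mat n n" using l u by (auto simp: low_def upp_def)
    have "act (l * g * u) v = act l (act g (act u v))" using c g v by (simp add: act_mult act_in)
    also have "act u v = (\<Prod>i<m. u $$ (i, i) ^ \<mu> i) *s v" using u v_hw by (simp add: upp_def)
    finally show ?thesis
      unfolding f_def using c g v hw_V[OF w] hw_lower[OF w c(1), of "act g v"] l
      by (simp add: act_scale act_in V_closed ip_scale low_def mult.commute mult.left_commute)
  qed
  have line: "polyfun (\<lambda>s. f (A + s \<cdot>\<^sub>m B))" if "A \<in> carrier_mat n n" "B \<in> carrier_mat n n" for A B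
    unfolding f_def using that v hw_V[OF w] by (intro polyfun_ip_act)
  define g0 where "g0 = mat n n (\<lambda>(a, b). if a = b \<or> b = m then 1 else 0 :: complex)"
  have g0c: "g0 \<in> carrier_mat n n" by (simp add: g0_def)
  have dgi: "(dg n t * g0 * dg n u) $$ (a, b) = t a * g0 $$ (a, b) * u b" if "a < n" "b < n" for t u a b
  proof -
    have "dg n t * g0 \<in> carrier_mat n n" using g0c by auto
    then show ?thesis using dg_mult_index(2)[OF _ that, of "dg n t * g0" u] dg_mult_index(1)[OF g0c that, of t] by simp
  qed
  have nz: "f g0 \<noteq> 0"
  proof
    assume 0: "f g0 = 0"
    have "f g = 0"
    proof (rule gauss_vanishing[where c = m and n = n, OF line])
      fix l g u :: "complex mat" assume "l \<in> carrier_mat n n" "g \<in> carrier_mat n n" "u \<in> carrier_mat n n"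
        "\<forall>i<n. \<forall>j<n. i < j \<longrightarrow> l $$ (i, j) = 0" "\<forall>i<n. l $$ (i, i) \<noteq> 0" "upper_triangular u"
        "\<forall>i<n. u $$ (i, i) \<noteq> 0" "\<forall>i<n. \<forall>j<n. m \<le> j \<longrightarrow> u $$ (i, j) = (if i = j then 1 else 0)" "f g = 0"
      then show "f (l * g * u) = 0" using cov[of l g u] by (simp add: low_def upp_def)
    next
      fix g :: "complex mat" assume g: "g \<in> carrier_mat n n"
        and unit: "\<forall>j<m. \<forall>i<n. g $$ (i, j) = (if i = j then 1 else 0)"
      \<comment> \<open>Shifting the last column makes all its entries nonzero for all but finitely
        many \<open>s\<close>. Scaling rows then reduces that column to ones, and scaling the first
        \<open>m\<close> columns back gives \<open>g0\<close>.\<close>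
      define B where "B = mat n n (\<lambda>(a, b). if b = m then 1 else 0 :: complex)"
      have B: "B \<in> carrier_mat n n" by (simp add: B_def)
      have van: "f (g + s \<cdot>\<^sub>m B) = 0" if s: "\<forall>a<n. s \<noteq> - (g $$ (a, m))" for s
      proof -
        define t where "t a = g $$ (a, m) + s" for a
        define u where "u b = (if b < m then inverse (t b) else 1)" for b
        have t: "t a \<noteq> 0" if "a < n" for a using s that by (auto simp: t_def add_eq_0_iff)
        have "g + s \<cdot>\<^sub>m B = dg n t * g0 * dg n u"
        proof (rule eq_matI)
          fix a b assume "a < dim_row (dg n t * g0 * dg n u)" "b < dim_col (dg n t * g0 * dg n u)"
          then have ab: "a < n" "b < n" by auto
          then have "b < m \<or> b = m" using n by auto
          then show "(g + s \<cdot>\<^sub>m B) $$ (a, b) = (dg n t * g0 * dg n u) $$ (a, b)"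
            unfolding dgi[OF ab] using ab g unit t by (auto simp: B_def g0_def t_def u_def)
        qed (use g B in auto)
        moreover have "low (dg n t)" "upp (dg n u)" using t n by (auto simp: low_def upp_def u_def)
        ultimately show ?thesis using cov[OF _ g0c] 0 by simp
      qed
      have "{s. f (g + s \<cdot>\<^sub>m B) \<noteq> 0} \<subseteq> (\<lambda>a. - (g $$ (a, m))) ` {..<n}"
      proof
        fix s assume "s \<in> {s. f (g + s \<cdot>\<^sub>m B) \<noteq> 0}"
        then have "\<not> (\<forall>a<n. s \<noteq> - (g $$ (a, m)))" using van[of s] by auto
        then show "s \<in> (\<lambda>a. - (g $$ (a, m))) ` {..<n}" by auto
      qed
      then have "finite {s. f (g + s \<cdot>\<^sub>m B) \<noteq> 0}" by (rule finite_subset) simp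
      then have "f (g + 0 \<cdot>\<^sub>m B) = 0" by (rule polyfun_eq_0[OF line[OF g B]])
      moreover have "g + 0 \<cdot>\<^sub>m B = g" using g B by (intro eq_matI) auto
      ultimately show "f g = 0" by simp
    qed (use n g in auto)
    then show False using g by (simp add: f_def)
  qed
  have one: "(\<Prod>a<k. (if a = b then x else 1) ^ \<kappa> a) = x ^ \<kappa> b" if "b < k" for k b :: nat and \<kappa> and x :: complex
  proof -
    have "(\<Prod>a<k. (if a = b then x else 1) ^ \<kappa> a) = (\<Prod>a<k. if a = b then x ^ \<kappa> b else 1)"
      by (intro prod.cong) auto
    then show ?thesis using that by simp
  qed
  show "\<mu> i \<le> \<kappa> i"
  proof -
    \<comment> \<open>The line replaces the entry \<open>(i, m)\<close> of \<open>g0\<close> by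
      \<open>s\<close>. For nonzero \<open>s\<close> it is obtained from \<open>g0\<close> by
      scaling row \<open>i\<close> by \<open>s\<close> and column \<open>i\<close> by its inverse,
      so \<open>f\<close> equals \<open>f g0\<close> times \<open>s\<close> to the power
      \<open>\<kappa> i - \<mu> i\<close>.\<close>
    define A where "A = mat n n (\<lambda>(a, b). if a = i \<and> b = m then 0 else g0 $$ (a, b))"
    define B where "B = mat n n (\<lambda>(a, b). if a = i \<and> b = m then 1 else 0 :: complex)"
    have AB: "A \<in> carrier_mat n n" "B \<in> carrier_mat n n" by (auto simp: A_def B_def)
    show ?thesis
    proof (rule polyfun_exponent_le[OF line[OF AB] _ nz])
      fix s :: complex assume s: "s \<noteq> 0"
      define t where "t a = (if a = i then s else 1)" for a
      define u where "u a = (if a = i then inverse s else 1)" for a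
      have "A + s \<cdot>\<^sub>m B = dg n t * g0 * dg n u"
      proof (rule eq_matI)
        fix a b assume "a < dim_row (dg n t * g0 * dg n u)" "b < dim_col (dg n t * g0 * dg n u)"
        then have ab: "a < n" "b < n" by auto
        show "(A + s \<cdot>\<^sub>m B) $$ (a, b) = (dg n t * g0 * dg n u) $$ (a, b)"
          unfolding dgi[OF ab] using ab AB i s by (auto simp: A_def B_def g0_def t_def u_def)
      qed (use AB in auto)
      moreover have "low (dg n t)" "upp (dg n u)" using i s n by (auto simp: low_def upp_def t_def u_def)
      ultimately have "f (A + s \<cdot>\<^sub>m B) = (\<Prod>a<n. dg n t $$ (a, a) ^ \<kappa> a) * (\<Prod>a<m. dg n u $$ (a, a) ^ \<mu> a) * f g0"
        using cov[OF _ g0c] by simp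
      also have "(\<Prod>a<n. dg n t $$ (a, a) ^ \<kappa> a) = s ^ \<kappa> i" using i n one[of i n s \<kappa>] by (simp add: t_def)
      also have "(\<Prod>a<m. dg n u $$ (a, a) ^ \<mu> a) = inverse s ^ \<mu> i" using i n one[of i m "inverse s" \<mu>] by (simp add: u_def)
      finally show "s ^ \<mu> i * f (A + s \<cdot>\<^sub>m B) = s ^ \<kappa> i * f g0" using s by (simp add: field_simps)
    qed
  qed
  show "\<kappa> (Suc i) \<le> \<mu> i"
  proof -
    \<comment> \<open>For nonzero \<open>s\<close> the line arises from \<open>g0\<close> in two
      steps: \<open>u\<close> scales column \<open>i\<close> by \<open>s\<close> and adds the old
      column \<open>i\<close> to the next one; \<open>l\<close> replaces row \<open>Suc i\<close> by
      its difference with row \<open>i\<close>, divided by \<open>s\<close>. The result is affine in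
      \<open>s\<close>, although \<open>l\<close> has poles.\<close>
    define A where "A = mat n n (\<lambda>(a, b). if a = i then (if b = Suc i \<or> b = m then 1 else 0)
      else if a = Suc i then (if b = i then -1 else 0) else g0 $$ (a, b))"
    define B where "B = mat n n (\<lambda>(a, b). if a = i \<and> b = i then 1 else 0 :: complex)"
    have AB: "A \<in> carrier_mat n n" "B \<in> carrier_mat n n" by (auto simp: A_def B_def)
    have i': "i < n" "Suc i < n" using i n by auto
    show ?thesis
    proof (rule polyfun_exponent_le[OF line[OF AB] _ nz])
      fix s :: complex assume s: "s \<noteq> 0"
      define l where "l = mat n n (\<lambda>(a, b). if a = Suc i \<and> b = i then - inverse s
        else if a = b then (if a = Suc i then inverse s else 1) else 0)"
      \<comment> \<open>If \<open>Suc i = m\<close>, the column addition is omitted: the last column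
        of \<open>g0\<close> already has equal entries in rows \<open>i\<close> and
        \<open>Suc i\<close>, and \<open>u\<close> must leave it fixed.\<close>
      define u where "u = mat n n (\<lambda>(a, b). if a = i \<and> b = Suc i \<and> Suc i < m then 1
        else if a = b then (if a = i then s else 1) else 0)"
      have c: "l \<in> carrier_mat n n" "u \<in> carrier_mat n n" by (auto simp: l_def u_def)
      have gu: "(g0 * u) $$ (a, b) = (if b = i then s * g0 $$ (a, i) else
        if b = Suc i \<and> Suc i < m then g0 $$ (a, i) + g0 $$ (a, b) else g0 $$ (a, b))" if ab: "a < n" "b < n" for a b
      proof -
        have "(g0 * u) $$ (a, b) = (\<Sum>d<n. g0 $$ (a, d) * u $$ (d, b))" using ab c g0c by (intro index_mult_sum)
        also have "\<dots> = (\<Sum>d<n. (if d = b then (if b = i then s * g0 $$ (a, i) else g0 $$ (a, b)) else 0) +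
            (if d = i then (if b = Suc i \<and> Suc i < m then g0 $$ (a, i) else 0) else 0))"
          using ab by (intro sum.cong refl) (auto simp: u_def)
        finally show ?thesis using ab i' by (auto simp: sum.distrib)
      qed
      have "A + s \<cdot>\<^sub>m B = l * (g0 * u)"
      proof (rule eq_matI)
        fix a b assume "a < dim_row (l * (g0 * u))" "b < dim_col (l * (g0 * u))"
        then have ab: "a < n" "b < n" using c by auto
        have "(l * (g0 * u)) $$ (a, b) = (\<Sum>d<n. l $$ (a, d) * (g0 * u) $$ (d, b))"
          using ab c g0c by (intro index_mult_sum) auto
        also have "\<dots> = (\<Sum>d<n. (if d = a then (if a = Suc i then inverse s * (g0 * u) $$ (a, b) else (g0 * u) $$ (a, b)) else 0) +
            (if d = i then (if a = Suc i then - inverse s * (g0 * u) $$ (i, b) else 0) else 0))"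
          using ab by (intro sum.cong refl) (auto simp: l_def simp del: index_mult_mat(1))
        also have "\<dots> = (if a = Suc i then inverse s * (g0 * u) $$ (a, b) else (g0 * u) $$ (a, b)) +
            (if a = Suc i then - inverse s * (g0 * u) $$ (i, b) else 0)"
          using ab i' by (simp add: sum.distrib del: index_mult_mat(1))
        also have "\<dots> = (A + s \<cdot>\<^sub>m B) $$ (a, b)"
          unfolding gu[OF ab] gu[OF i'(1) ab(2)] using ab i i' n s AB
          by (auto simp: A_def B_def g0_def)
        finally show "(A + s \<cdot>\<^sub>m B) $$ (a, b) = (l * (g0 * u)) $$ (a, b)" ..
      qed (use AB c in auto)
      also have "\<dots> = l * g0 * u" using c g0c by (simp add: assoc_mult_mat[of _ n n _ n _ n])
      finally have "A + s \<cdot>\<^sub>m B = l * g0 * u" .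
      moreover have "low l" "upp u" using i s n by (auto simp: low_def upp_def l_def u_def)
      ultimately have "f (A + s \<cdot>\<^sub>m B) = (\<Prod>a<n. l $$ (a, a) ^ \<kappa> a) * (\<Prod>a<m. u $$ (a, a) ^ \<mu> a) * f g0"
        using cov[OF _ g0c] by simp
      also have "(\<Prod>a<n. l $$ (a, a) ^ \<kappa> a) = inverse s ^ \<kappa> (Suc i)"
      proof -
        have "(\<Prod>a<n. l $$ (a, a) ^ \<kappa> a) = (\<Prod>a<n. (if a = Suc i then inverse s else 1) ^ \<kappa> a)"
          by (intro prod.cong) (auto simp: l_def)
        then show ?thesis using i' one[of "Suc i" n "inverse s" \<kappa>] by simp
      qed
      also have "(\<Prod>a<m. u $$ (a, a) ^ \<mu> a) = s ^ \<mu> i"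
      proof -
        have "(\<Prod>a<m. u $$ (a, a) ^ \<mu> a) = (\<Prod>a<m. (if a = i then s else 1) ^ \<mu> a)"
          using n by (intro prod.cong) (auto simp: u_def)
        then show ?thesis using i one[of i m s \<mu>] by simp
      qed
      finally show "s ^ \<kappa> (Suc i) * f (A + s \<cdot>\<^sub>m B) = s ^ \<mu> i * f g0" using s by (simp add: field_simps)
    qed
  qed
qed

end

section \<open>Linear substitutions\<close>

lemma Const_simps: "Const 0 = 0" "Const 1 = 1" "Const (a + b) = Const a + Const b" "Const (a * b) = Const a * Const b"
  by (simp_all add: Const_def single_add mult_single)

lemma Const_sum: "Const (sum f I) = (\<Sum>i\<in>I. Const (f i))"
  by (induction I rule: infinite_finite_induct) (simp_all add: Const_simps)

lemma poly_mapping_sum_single: "f = (\<Sum>m\<in>Poly_Mapping.keys f. Poly_Mapping.single m (Poly_Mapping.lookup f m))"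
proof (rule poly_mapping_eqI)
  fix i
  have "(\<Sum>m\<in>Poly_Mapping.keys f. Poly_Mapping.lookup (Poly_Mapping.single m (Poly_Mapping.lookup f m)) i)
    = (\<Sum>m\<in>Poly_Mapping.keys f. if m = i then Poly_Mapping.lookup f i else 0)"
    by (intro sum.cong) (auto simp: lookup_single when_def)
  then show "Poly_Mapping.lookup f i = Poly_Mapping.lookup (\<Sum>m\<in>Poly_Mapping.keys f. Poly_Mapping.single m (Poly_Mapping.lookup f m)) i"
    by (simp add: lookup_sum in_keys_iff)
qed

lemma lookup_Const_mult: "Poly_Mapping.lookup (Const c * p) i = c * Poly_Mapping.lookup p i"
proof -
  have "Poly_Mapping.lookup (Const c * p) i =
    Poly_Mapping.lookup (Const c * (\<Sum>m\<in>Poly_Mapping.keys p. Poly_Mapping.single m (Poly_Mapping.lookup p m))) i"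
    using poly_mapping_sum_single[of p] by simp
  also have "\<dots> = (\<Sum>m\<in>Poly_Mapping.keys p. c * Poly_Mapping.lookup (Poly_Mapping.single m (Poly_Mapping.lookup p m)) i)"
    by (simp add: sum_distrib_left Const_def mult_single lookup_sum lookup_single mult_when)
  also have "\<dots> = c * Poly_Mapping.lookup (\<Sum>m\<in>Poly_Mapping.keys p. Poly_Mapping.single m (Poly_Mapping.lookup p m)) i"
    by (simp add: sum_distrib_left lookup_sum)
  finally show ?thesis using poly_mapping_sum_single[of p] by simp
qed

definition mono_subst :: "complex mat \<Rightarrow> expvec \<Rightarrow> cpoly" where
  "mono_subst h m = (\<Prod>a\<in>Poly_Mapping.keys m. linear_form h a ^ Poly_Mapping.lookup m a)"

lemma mono_subst_superset:
  "finite A \<Longrightarrow> Poly_Mapping.keys m \<subseteq> A \<Longrightarrow> mono_subst h m = (\<Prod>a\<in>A. linear_form h a ^ Poly_Mapping.lookup m a)"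
  unfolding mono_subst_def by (intro prod.mono_neutral_left) (auto simp: in_keys_iff)

lemma mono_subst_0 [simp]: "mono_subst h 0 = 1"
  by (simp add: mono_subst_def)

lemma mono_subst_single [simp]: "mono_subst h (Poly_Mapping.single a (Suc 0)) = linear_form h a"
  by (simp add: mono_subst_def)

lemma mono_subst_add: "mono_subst h (m + l) = mono_subst h m * mono_subst h l"
proof -
  let ?A = "Poly_Mapping.keys m \<union> Poly_Mapping.keys l"
  have "mono_subst h (m + l) = (\<Prod>a\<in>?A. linear_form h a ^ Poly_Mapping.lookup (m + l) a)"
    by (rule mono_subst_superset[OF _ keys_add]) simp
  also have "\<dots> = (\<Prod>a\<in>?A. linear_form h a ^ Poly_Mapping.lookup m a) * (\<Prod>a\<in>?A. linear_form h a ^ Poly_Mapping.lookup l a)"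
    by (simp add: lookup_add power_add prod.distrib)
  also have "\<dots> = mono_subst h m * mono_subst h l"
    by (subst (1 2) mono_subst_superset[of ?A]) auto
  finally show ?thesis .
qed

lemma subst_linear_superset:
  assumes "finite A" "Poly_Mapping.keys f \<subseteq> A"
  shows "subst_linear h f = (\<Sum>m\<in>A. Const (Poly_Mapping.lookup f m) * mono_subst h m)"
  unfolding subst_linear_def mono_subst_def[symmetric] using assms
  by (intro sum.mono_neutral_left) (auto simp: in_keys_iff Const_simps)

lemma subst_linear_add: "subst_linear h (f + g) = subst_linear h f + subst_linear h g"
proof -
  let ?A = "Poly_Mapping.keys f \<union> Poly_Mapping.keys g"
  have "subst_linear h (f + g) = (\<Sum>m\<in>?A. Const (Poly_Mapping.lookup (f + g) m) * mono_subst h m)"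
    by (rule subst_linear_superset[OF _ keys_add]) simp
  also have "\<dots> = (\<Sum>m\<in>?A. Const (Poly_Mapping.lookup f m) * mono_subst h m) + (\<Sum>m\<in>?A. Const (Poly_Mapping.lookup g m) * mono_subst h m)"
    by (simp add: lookup_add Const_simps algebra_simps sum.distrib)
  also have "\<dots> = subst_linear h f + subst_linear h g"
    by (subst (1 2) subst_linear_superset[of ?A]) auto
  finally show ?thesis .
qed

lemma subst_linear_single: "subst_linear h (Poly_Mapping.single m c) = Const c * mono_subst h m"
  by (subst subst_linear_superset[of "{m}"]) auto

lemma subst_linear_0 [simp]: "subst_linear h 0 = 0"
  by (simp add: subst_linear_def)

lemma subst_linear_sum: "subst_linear h (sum f I) = (\<Sum>i\<in>I. subst_linear h (f i))"
  by (induction I rule: infinite_finite_induct) (simp_all add: subst_linear_add)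

lemma subst_linear_mult: "subst_linear h (f * g) = subst_linear h f * subst_linear h g"
proof -
  let ?s = "\<lambda>f m. Poly_Mapping.single m (Poly_Mapping.lookup f m) :: cpoly"
  have sm: "subst_linear h (?s f m * ?s g l) = subst_linear h (?s f m) * subst_linear h (?s g l)" for m l
    by (simp add: mult_single subst_linear_single mono_subst_add Const_simps mult_ac)
  have "subst_linear h (f * g) = subst_linear h ((\<Sum>m\<in>Poly_Mapping.keys f. ?s f m) * (\<Sum>l\<in>Poly_Mapping.keys g. ?s g l))"
    using poly_mapping_sum_single[of f] poly_mapping_sum_single[of g] by simp
  also have "\<dots> = (\<Sum>m\<in>Poly_Mapping.keys f. \<Sum>l\<in>Poly_Mapping.keys g. subst_linear h (?s f m) * subst_linear h (?s g l))"
    by (simp only: sum_product subst_linear_sum sm)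
  also have "\<dots> = subst_linear h (\<Sum>m\<in>Poly_Mapping.keys f. ?s f m) * subst_linear h (\<Sum>l\<in>Poly_Mapping.keys g. ?s g l)"
    by (simp only: sum_product subst_linear_sum)
  finally show ?thesis using poly_mapping_sum_single[of f] poly_mapping_sum_single[of g] by simp
qed

lemma subst_linear_Const [simp]: "subst_linear h (Const c) = Const c"
  unfolding Const_def subst_linear_single by (simp add: Const_def)

lemma subst_linear_1 [simp]: "subst_linear h 1 = 1"
  using subst_linear_Const[of h 1] by (simp add: Const_simps)

lemma subst_linear_Var [simp]: "subst_linear h (Var a) = linear_form h a"
  unfolding Var_def subst_linear_single by (simp add: Const_simps)

lemma subst_linear_power: "subst_linear h (f ^ r) = subst_linear h f ^ r"
  by (induction r) (simp_all add: subst_linear_mult)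

lemma subst_linear_prod: "subst_linear h (prod f I) = (\<Prod>i\<in>I. subst_linear h (f i))"
  by (induction I rule: infinite_finite_induct) (simp_all add: subst_linear_mult)

lemma subst_linear_linear_form:
  assumes "g \<in> carrier_mat k k" "h \<in> carrier_mat k k"
  shows "subst_linear h (linear_form g a) = linear_form (g * h) a"
proof (cases "a < k")
  case True
  have "subst_linear h (linear_form g a) = (\<Sum>b<k. Const (g $$ (a, b)) * linear_form h b)"
    using assms True by (simp add: linear_form_def subst_linear_sum subst_linear_mult)
  also have "\<dots> = (\<Sum>b<k. \<Sum>c<k. Const (g $$ (a, b) * h $$ (b, c)) * Var c)"
    using assms by (intro sum.cong refl) (simp add: linear_form_def sum_distrib_left Const_simps mult.assoc)
  also have "\<dots> = (\<Sum>c<k. \<Sum>b<k. Const (g $$ (a, b) * h $$ (b, c)) * Var c)" by (rule sum.swap)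
  also have "\<dots> = (\<Sum>c<k. Const ((g * h) $$ (a, c)) * Var c)"
    using assms True
    by (intro sum.cong refl) (simp add: index_mult_sum Const_sum sum_distrib_right del: index_mult_mat(1))
  finally show ?thesis using assms True by (simp add: linear_form_def)
qed (use assms in \<open>auto simp: linear_form_def\<close>)

lemma subst_linear_mono_subst:
  assumes "g \<in> carrier_mat k k" "h \<in> carrier_mat k k"
  shows "subst_linear h (mono_subst g m) = mono_subst (g * h) m"
  unfolding mono_subst_def subst_linear_prod subst_linear_power subst_linear_linear_form[OF assms] ..

lemma subst_linear_subst_linear:
  assumes "g \<in> carrier_mat k k" "h \<in> carrier_mat k k"
  shows "subst_linear h (subst_linear g f) = subst_linear (g * h) f"
proof -
  have "subst_linear h (subst_linear g f) =
    (\<Sum>m\<in>Poly_Mapping.keys f. Const (Poly_Mapping.lookup f m) * mono_subst (g * h) m)"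
    unfolding subst_linear_superset[OF finite_keys subset_refl, of g f] subst_linear_sum subst_linear_mult
      subst_linear_Const subst_linear_mono_subst[OF assms] ..
  then show ?thesis by (simp add: subst_linear_superset[OF finite_keys subset_refl, of "g * h"])
qed

section \<open>Monomials as words and the coefficients of a substitution\<close>

text \<open>Representing a monomial by a word of variables turns a substitution into a plain sum
  over words, with no multinomial expansion.\<close>

definition wcontent :: "nat list \<Rightarrow> expvec" where
  "wcontent w = (\<Sum>a\<leftarrow>w. Poly_Mapping.single a (Suc 0))"

lemma wcontent_simps [simp]: "wcontent [] = 0" "wcontent (a # w) = Poly_Mapping.single a (Suc 0) + wcontent w"
  by (simp_all add: wcontent_def)

definition expdeg :: "expvec \<Rightarrow> nat" where
  "expdeg m = (\<Sum>a\<in>Poly_Mapping.keys m. Poly_Mapping.lookup m a)"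

lemma expdeg_superset:
  "finite A \<Longrightarrow> Poly_Mapping.keys m \<subseteq> A \<Longrightarrow> expdeg m = (\<Sum>a\<in>A. Poly_Mapping.lookup m a)"
  unfolding expdeg_def by (intro sum.mono_neutral_left) (auto simp: in_keys_iff)

lemma expdeg_add: "expdeg (m + l) = expdeg m + expdeg l"
proof -
  let ?A = "Poly_Mapping.keys m \<union> Poly_Mapping.keys l"
  have "expdeg (m + l) = (\<Sum>a\<in>?A. Poly_Mapping.lookup (m + l) a)"
    by (rule expdeg_superset[OF _ keys_add]) simp
  also have "\<dots> = (\<Sum>a\<in>?A. Poly_Mapping.lookup m a) + (\<Sum>a\<in>?A. Poly_Mapping.lookup l a)"
    by (simp add: lookup_add sum.distrib)
  also have "\<dots> = expdeg m + expdeg l" by (subst (1 2) expdeg_superset[of ?A]) auto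
  finally show ?thesis .
qed

lemma expdeg_wcontent [simp]: "expdeg (wcontent w) = length w"
  by (induction w) (simp_all add: expdeg_add, simp_all add: expdeg_def)

lemma keys_single_add: "Poly_Mapping.keys (Poly_Mapping.single a (Suc 0) + m) = insert a (Poly_Mapping.keys m)"
proof (rule Set.set_eqI)
  fix b show "b \<in> Poly_Mapping.keys (Poly_Mapping.single a (Suc 0) + m) \<longleftrightarrow> b \<in> insert a (Poly_Mapping.keys m)"
    by (cases "b = a") (simp_all add: in_keys_iff lookup_add lookup_single)
qed

lemma keys_wcontent [simp]: "Poly_Mapping.keys (wcontent w) = set w"
  by (induction w) (simp_all add: keys_single_add)

lemma exists_word: "\<exists>w. wcontent w = m"
proof (induction "expdeg m" arbitrary: m)
  case 0
  then have "\<forall>a. Poly_Mapping.lookup m a = 0" by (auto simp: expdeg_def in_keys_iff)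
  then have "m = 0" by (intro poly_mapping_eqI) simp
  then show ?case by (intro exI[of _ "[]"]) simp
next
  case (Suc r)
  have "expdeg m = 0" if "\<forall>a. Poly_Mapping.lookup m a = 0" using that by (simp add: expdeg_def)
  then obtain a where a: "Poly_Mapping.lookup m a \<noteq> 0" using Suc(2) by fastforce
  define l where "l = m - Poly_Mapping.single a (Suc 0)"
  have m: "m = Poly_Mapping.single a (Suc 0) + l"
    by (rule poly_mapping_eqI) (use a in \<open>auto simp: l_def lookup_add lookup_minus lookup_single when_def\<close>)
  have "expdeg (Poly_Mapping.single a (Suc 0)) = 1" by (simp add: expdeg_def)
  then have "r = expdeg l" using Suc(2) m expdeg_add by (metis Suc_eq_plus1_left nat.inject)
  then obtain w where "wcontent w = l" using Suc(1) by blast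
  then show ?case using m by (intro exI[of _ "a # w"]) simp
qed

definition lists_len :: "'a set \<Rightarrow> nat \<Rightarrow> 'a list set" where
  "lists_len A r = {w. set w \<subseteq> A \<and> length w = r}"

lemma finite_lists_len [simp]: "finite A \<Longrightarrow> finite (lists_len A r)"
  unfolding lists_len_def by (rule finite_lists_length_eq)

lemma lists_len_0 [simp]: "lists_len A 0 = {[]}"
  by (auto simp: lists_len_def)

lemma lists_len_Suc: "lists_len A (Suc r) = (\<lambda>(c, b). c # b) ` (A \<times> lists_len A r)"
  by (auto simp: lists_len_def length_Suc_conv image_iff)

lemma sum_lists_len_Suc: "(\<Sum>b\<in>lists_len A (Suc r). F b) = (\<Sum>c\<in>A. \<Sum>b\<in>lists_len A r. F (c # b))"
  unfolding lists_len_Suc sum.cartesian_product by (subst sum.reindex) (auto simp: inj_on_def case_prod_beta)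

lemma prod_list_sum:
  "prod_list (map (\<lambda>i. \<Sum>m\<in>A. h m i :: complex) I) = (\<Sum>J\<in>lists_len A (length I). prod_list (map2 h J I))"
  by (induction I) (simp_all add: sum_lists_len_Suc sum_product)

definition words :: "nat \<Rightarrow> nat \<Rightarrow> nat list set" where
  "words d k = lists_len {..<k} d"

lemma finite_words [simp]: "finite (words d k)"
  by (simp add: words_def)

lemma expvecs_wcontent: "expvecs d k = wcontent ` words d k"
proof
  show "wcontent ` words d k \<subseteq> expvecs d k"
    using expdeg_wcontent by (auto simp: expvecs_def words_def lists_len_def expdeg_def)
  show "expvecs d k \<subseteq> wcontent ` words d k"
  proof
    fix i assume i: "i \<in> expvecs d k"
    obtain w where w: "wcontent w = i" using exists_word by blast
    then have "w \<in> words d k" using i keys_wcontent[of w] expdeg_wcontent[of w]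
      by (simp add: expvecs_def words_def lists_len_def expdeg_def)
    then show "i \<in> wcontent ` words d k" using w by blast
  qed
qed

lemma finite_expvecs [simp]: "finite (expvecs d k)"
  by (simp add: expvecs_wcontent)

text \<open>For words of the same length this is an entry of the tensor power of \<open>g\<close> in
  the basis of words.\<close>

definition word_entry :: "complex mat \<Rightarrow> nat list \<Rightarrow> nat list \<Rightarrow> complex" where
  "word_entry g w b = prod_list (map2 (\<lambda>a c. g $$ (a, c)) w b)"

lemma mono_subst_wcontent:
  assumes "g \<in> carrier_mat k k" "set w \<subseteq> {..<k}"
  shows "mono_subst g (wcontent w) = (\<Sum>b\<in>words (length w) k. Poly_Mapping.single (wcontent b) (word_entry g w b))"
  using assms(2)
proof (induction w)
  case Nil
  show ?case by (simp add: word_entry_def words_def)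
next
  case (Cons a w)
  have "linear_form g a = (\<Sum>c<k. Poly_Mapping.single (Poly_Mapping.single c (Suc 0)) (g $$ (a, c)))"
    using assms(1) Cons.prems by (simp add: linear_form_def Const_def Var_def mult_single)
  then have "mono_subst g (wcontent (a # w)) = (\<Sum>c<k. \<Sum>b\<in>words (length w) k.
      Poly_Mapping.single (Poly_Mapping.single c (Suc 0)) (g $$ (a, c)) * Poly_Mapping.single (wcontent b) (word_entry g w b))"
    using Cons by (simp add: mono_subst_add sum_product)
  also have "\<dots> = (\<Sum>b\<in>words (length (a # w)) k. Poly_Mapping.single (wcontent b) (word_entry g (a # w) b))"
    by (simp add: words_def sum_lists_len_Suc mult_single word_entry_def)
  finally show ?case .
qed

definition mcoef :: "complex mat \<Rightarrow> expvec \<Rightarrow> expvec \<Rightarrow> complex" where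
  "mcoef g m i = Poly_Mapping.lookup (mono_subst g m) i"

lemma mcoef_wcontent:
  assumes "g \<in> carrier_mat k k" "w \<in> words d k"
  shows "mcoef g (wcontent w) i = (\<Sum>b\<in>{b \<in> words d k. wcontent b = i}. word_entry g w b)"
proof -
  have "mcoef g (wcontent w) i = (\<Sum>b\<in>words d k. if wcontent b = i then word_entry g w b else 0)"
    unfolding mcoef_def using assms
    by (subst mono_subst_wcontent) (auto simp: words_def lists_len_def lookup_sum lookup_single when_def)
  then show ?thesis by (simp add: sum.inter_filter)
qed

text \<open>Substitution preserves the degree and keeps variables of index at least \<open>k\<close>
  as factors. Hence the coefficients read by a metapolynomial depend only on those in
  \<open>expvecs d k\<close>, even though \<open>f\<close> is an arbitrary polynomial.\<close>

lemma mcoef_0: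
  assumes g: "g \<in> carrier_mat k k" and i: "i \<in> expvecs d k" and m: "m \<notin> expvecs d k"
  shows "mcoef g m i = 0"
proof -
  obtain w where w: "m = wcontent w" using exists_word by metis
  show ?thesis
  proof (cases "set w \<subseteq> {..<k}")
    case True
    then have "w \<in> words (length w) k" by (simp add: words_def lists_len_def)
    then have "length w \<noteq> d" using m by (auto simp: w expvecs_wcontent)
    moreover have "expdeg i = d" using i by (simp add: expvecs_def expdeg_def)
    ultimately have "{b \<in> words (length w) k. wcontent b = i} = {}" by (auto simp: words_def lists_len_def)
    then show ?thesis using mcoef_wcontent[OF g \<open>w \<in> words (length w) k\<close>] w by (simp only: sum.empty)
  next
    case False
    then obtain a where a: "a \<in> set w" "a \<ge> k" by (meson lessThan_iff not_le subsetI)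
    then obtain u v where "w = u @ a # v" by (meson split_list)
    then have "m = Poly_Mapping.single a (Suc 0) + wcontent (u @ v)"
      by (simp add: w wcontent_def add.left_commute)
    then have "mono_subst g m = Var a * mono_subst g (wcontent (u @ v))"
      using a g by (simp add: mono_subst_add linear_form_def)
    moreover have "i \<notin> Poly_Mapping.keys (Var a * p)" for p
    proof
      assume "i \<in> Poly_Mapping.keys (Var a * p)"
      then obtain b where "i = Poly_Mapping.single a 1 + b" using keys_mult[of "Var a" p] by (auto simp: Var_def)
      then have "a \<in> Poly_Mapping.keys i" by (simp add: in_keys_iff lookup_add)
      then show False using i a by (auto simp: expvecs_def)
    qed
    ultimately show ?thesis by (simp add: mcoef_def in_keys_iff)
  qed
qed

lemma lookup_subst_linear:
  assumes g: "g \<in> carrier_mat k k" and i: "i \<in> expvecs d k"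
  shows "Poly_Mapping.lookup (subst_linear g f) i = (\<Sum>m\<in>expvecs d k. mcoef g m i * Poly_Mapping.lookup f m)"
proof -
  let ?A = "Poly_Mapping.keys f \<union> expvecs d k"
  have "Poly_Mapping.lookup (subst_linear g f) i = (\<Sum>m\<in>?A. mcoef g m i * Poly_Mapping.lookup f m)"
  proof -
    have "Poly_Mapping.lookup (subst_linear g f) i = (\<Sum>m\<in>?A. Poly_Mapping.lookup f m * mcoef g m i)"
      by (subst subst_linear_superset[of ?A]) (simp_all add: lookup_sum lookup_Const_mult mcoef_def)
    then show ?thesis by (simp add: mult.commute)
  qed
  also have "\<dots> = (\<Sum>m\<in>expvecs d k. mcoef g m i * Poly_Mapping.lookup f m)"
    using mcoef_0[OF g i] by (intro sum.mono_neutral_right) auto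
  finally show ?thesis .
qed

lemma linear_form_one: "linear_form (1\<^sub>m k) a = Var a"
proof (cases "a < k")
  case True
  then have "linear_form (1\<^sub>m k) a = (\<Sum>b<k. Const (if a = b then 1 else 0) * Var b)"
    by (simp add: linear_form_def)
  also have "\<dots> = (\<Sum>b<k. if b = a then Var a else 0)"
    by (intro sum.cong refl) (auto simp: Const_simps)
  finally show ?thesis using True by simp
qed (simp add: linear_form_def)

lemma mono_subst_one: "mono_subst (1\<^sub>m k) m = Poly_Mapping.single m 1"
proof -
  have "mono_subst (1\<^sub>m k) (wcontent w) = Poly_Mapping.single (wcontent w) 1" for w
    by (induction w) (simp_all add: mono_subst_add linear_form_one Var_def mult_single)
  then show ?thesis using exists_word by metis
qed

lemma subst_linear_one: "subst_linear (1\<^sub>m k) f = f"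
  unfolding subst_linear_superset[OF finite_keys subset_refl] mono_subst_one
  using poly_mapping_sum_single[of f] by (simp add: Const_def mult_single)

text \<open>The multinomial coefficient of the exponent vector, for \<open>i\<close> in
  \<open>expvecs d k\<close>.\<close>

definition word_count :: "nat \<Rightarrow> nat \<Rightarrow> expvec \<Rightarrow> nat" where
  "word_count d k i = card {w \<in> words d k. wcontent w = i}"

lemma word_count_pos: "i \<in> expvecs d k \<Longrightarrow> word_count d k i > 0"
  unfolding word_count_def by (subst card_gt_0_iff) (auto simp: expvecs_wcontent)

lemma word_entry_adj:
  assumes "g \<in> carrier_mat k k" "w \<in> words d k" "b \<in> words d k"
  shows "cnj (word_entry (adj g) b w) = word_entry g w b"
proof -
  have "length w = length b" "set w \<subseteq> {..<k}" "set b \<subseteq> {..<k}" using assms by (auto simp: words_def lists_len_def)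
  then show ?thesis
    by (induction w b rule: list_induct2) (use assms(1) in \<open>auto simp: word_entry_def\<close>)
qed

text \<open>Both sides count pairs of words with contents \<open>m\<close> and \<open>i\<close>; this is why the metavariables are
  orthogonal with norms given by multinomial coefficients.\<close>

lemma mcoef_adj:
  assumes g: "g \<in> carrier_mat k k" and i: "i \<in> expvecs d k" "m \<in> expvecs d k"
  shows "of_nat (word_count d k m) * mcoef g m i = of_nat (word_count d k i) * cnj (mcoef (adj g) i m)"
proof -
  let ?W = "\<lambda>m. {w \<in> words d k. wcontent w = m}"
  have *: "of_nat (word_count d k m) * mcoef h m i = (\<Sum>w\<in>?W m. \<Sum>b\<in>?W i. word_entry h w b)"
    if "h \<in> carrier_mat k k" for h m i
  proof -
    have "(\<Sum>w\<in>?W m. \<Sum>b\<in>?W i. word_entry h w b) = (\<Sum>w\<in>?W m. mcoef h m i)"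
      by (intro sum.cong refl) (use mcoef_wcontent[OF that] in auto)
    then show ?thesis by (simp add: word_count_def)
  qed
  have "of_nat (word_count d k i) * cnj (mcoef (adj g) i m) = cnj (of_nat (word_count d k i) * mcoef (adj g) i m)"
    by simp
  also have "\<dots> = (\<Sum>b\<in>?W i. \<Sum>w\<in>?W m. word_entry g w b)"
    unfolding *[OF adj_carrier[OF g]] cnj_sum by (intro sum.cong refl) (use word_entry_adj[OF g] in auto)
  also have "\<dots> = (\<Sum>w\<in>?W m. \<Sum>b\<in>?W i. word_entry g w b)" by (rule sum.swap)
  finally show ?thesis using *[OF g] by simp
qed

section \<open>Polynomial dependence on the matrix entries\<close>

text \<open>\<open>D\<close> bounds the degree in each entry separately. It adds under products, so
  a product over \<delta> metavariables of degree \<open>d\<close> ends at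
  \<open>d * \<delta>\<close>.\<close>

definition entry_poly :: "nat \<Rightarrow> nat \<Rightarrow> (complex mat \<Rightarrow> complex) \<Rightarrow> bool" where
  "entry_poly n D F \<longleftrightarrow> (\<exists>c. \<forall>g\<in>carrier_mat n n. F g = (\<Sum>e\<in>exps n D. c e * entry_mon n e g))"

lemma entry_poly_const: "entry_poly n D (\<lambda>g. x)"
proof -
  define e0 where "e0 = (\<lambda>p\<in>{..<n} \<times> {..<n}. 0 :: nat)"
  have "e0 \<in> exps n D" by (auto simp: e0_def exps_def)
  moreover have "entry_mon n e0 g = 1" for g by (simp add: entry_mon_def e0_def)
  moreover have "(if e = e0 then x else 0) * entry_mon n e g = (if e = e0 then x * entry_mon n e0 g else 0)" for e g
    by simp
  ultimately have "\<forall>g\<in>carrier_mat n n. x = (\<Sum>e\<in>exps n D. (if e = e0 then x else 0) * entry_mon n e g)"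
    by simp
  then show ?thesis unfolding entry_poly_def by (rule exI[of _ "\<lambda>e. if e = e0 then x else 0"])
qed

lemma entry_poly_entry:
  assumes "a < n" "b < n"
  shows "entry_poly n 1 (\<lambda>g. g $$ (a, b))"
proof -
  define e1 where "e1 = (\<lambda>p\<in>{..<n} \<times> {..<n}. if p = (a, b) then 1 else 0 :: nat)"
  have "e1 \<in> exps n 1" by (auto simp: e1_def exps_def)
  moreover have "entry_mon n e1 g = g $$ (a, b)" for g
  proof -
    have "(\<Prod>j<n. g $$ (i, j) ^ e1 (i, j)) = (if i = a then g $$ (a, b) else 1)" if "i < n" for i
    proof -
      have "(\<Prod>j<n. g $$ (i, j) ^ e1 (i, j)) = (\<Prod>j<n. if j = b then if i = a then g $$ (a, b) else 1 else 1)"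
        using that by (intro prod.cong refl) (auto simp: e1_def)
      then show ?thesis using assms by simp
    qed
    then show ?thesis using assms by (simp add: entry_mon_def)
  qed
  moreover have "(if e = e1 then 1 else 0) * entry_mon n e g = (if e = e1 then entry_mon n e1 g else 0)" for e g
    by simp
  ultimately have "\<forall>g\<in>carrier_mat n n. g $$ (a, b) = (\<Sum>e\<in>exps n 1. (if e = e1 then 1 else 0) * entry_mon n e g)"
    by simp
  then show ?thesis unfolding entry_poly_def by (rule exI[of _ "\<lambda>e. if e = e1 then 1 else 0"])
qed

lemma entry_poly_add:
  assumes "entry_poly n D F" "entry_poly n D G"
  shows "entry_poly n D (\<lambda>g. F g + G g)"
proof -
  obtain c c' where "\<forall>g\<in>carrier_mat n n. F g = (\<Sum>e\<in>exps n D. c e * entry_mon n e g)"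
    "\<forall>g\<in>carrier_mat n n. G g = (\<Sum>e\<in>exps n D. c' e * entry_mon n e g)"
    using assms unfolding entry_poly_def by auto
  then have "\<forall>g\<in>carrier_mat n n. F g + G g = (\<Sum>e\<in>exps n D. (c e + c' e) * entry_mon n e g)"
    by (simp add: distrib_right sum.distrib)
  then show ?thesis unfolding entry_poly_def by (rule exI[of _ "\<lambda>e. c e + c' e"])
qed

lemma entry_poly_sum:
  assumes "\<And>i. i \<in> I \<Longrightarrow> entry_poly n D (F i)"
  shows "entry_poly n D (\<lambda>g. \<Sum>i\<in>I. F i g)"
  using assms by (induction I rule: infinite_finite_induct) (simp_all add: entry_poly_const entry_poly_add)

lemma entry_poly_mult:
  assumes "entry_poly n D F" "entry_poly n D' G"
  shows "entry_poly n (D + D') (\<lambda>g. F g * G g)"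
proof -
  obtain c c' where c: "\<forall>g\<in>carrier_mat n n. F g = (\<Sum>e\<in>exps n D. c e * entry_mon n e g)"
    "\<forall>g\<in>carrier_mat n n. G g = (\<Sum>e\<in>exps n D'. c' e * entry_mon n e g)"
    using assms unfolding entry_poly_def by auto
  define \<phi> where "\<phi> = (\<lambda>(e, e'). \<lambda>p\<in>{..<n} \<times> {..<n}. e p + e' p :: nat)"
  define P where "P = exps n D \<times> exps n D'"
  have "e p \<le> D" if "e \<in> exps n D" "p \<in> {..<n} \<times> {..<n}" for e p D
    using that unfolding exps_def by (auto simp: PiE_def Pi_def)
  then have \<phi>: "\<phi> p \<in> exps n (D + D')" if "p \<in> P" for p
    using that unfolding \<phi>_def P_def by (auto simp: exps_def intro!: add_mono split: if_splits)
  have mon: "entry_mon n (\<phi> p) g = entry_mon n (fst p) g * entry_mon n (snd p) g" for p g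
    by (simp add: entry_mon_def \<phi>_def case_prod_beta power_add prod.distrib)
  have "F g * G g = (\<Sum>e\<in>exps n (D + D'). (\<Sum>p\<in>{p \<in> P. \<phi> p = e}. c (fst p) * c' (snd p)) * entry_mon n e g)"
    if g: "g \<in> carrier_mat n n" for g
  proof -
    have "F g * G g = (\<Sum>p\<in>P. c (fst p) * c' (snd p) * entry_mon n (\<phi> p) g)"
    proof -
      have "F g * G g = (\<Sum>e\<in>exps n D. \<Sum>e'\<in>exps n D'. (c e * entry_mon n e g) * (c' e' * entry_mon n e' g))"
        using c g by (simp add: sum_product)
      also have "\<dots> = (\<Sum>p\<in>P. (c (fst p) * entry_mon n (fst p) g) * (c' (snd p) * entry_mon n (snd p) g))"
        by (simp add: sum.cartesian_product P_def case_prod_beta)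
      also have "\<dots> = (\<Sum>p\<in>P. c (fst p) * c' (snd p) * entry_mon n (\<phi> p) g)"
        by (intro sum.cong refl) (simp add: mon mult_ac)
      finally show ?thesis .
    qed
    also have "\<dots> = (\<Sum>e\<in>exps n (D + D'). \<Sum>p\<in>{p \<in> P. \<phi> p = e}. c (fst p) * c' (snd p) * entry_mon n (\<phi> p) g)"
      using \<phi> by (intro sum.group[symmetric]) (auto simp: P_def)
    also have "\<dots> = (\<Sum>e\<in>exps n (D + D'). (\<Sum>p\<in>{p \<in> P. \<phi> p = e}. c (fst p) * c' (snd p)) * entry_mon n e g)"
      by (intro sum.cong refl) (simp add: sum_distrib_right)
    finally show ?thesis .
  qed
  then have "\<forall>g\<in>carrier_mat n n. F g * G g =
    (\<Sum>e\<in>exps n (D + D'). (\<Sum>p\<in>{p \<in> P. \<phi> p = e}. c (fst p) * c' (snd p)) * entry_mon n e g)" by blast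
  then show ?thesis unfolding entry_poly_def
    by (rule exI[of _ "\<lambda>e. \<Sum>p\<in>{p \<in> P. \<phi> p = e}. c (fst p) * c' (snd p)"])
qed

lemma entry_poly_word_entry:
  assumes "length w = length b" "set w \<subseteq> {..<n}" "set b \<subseteq> {..<n}"
  shows "entry_poly n (length w) (\<lambda>g. word_entry g w b)"
  using assms
proof (induction w b rule: list_induct2)
  case Nil
  then show ?case by (simp add: word_entry_def entry_poly_const)
next
  case (Cons a w c b)
  then have "entry_poly n (1 + length w) (\<lambda>g. g $$ (a, c) * word_entry g w b)"
    by (intro entry_poly_mult entry_poly_entry) auto
  then show ?case by (simp add: word_entry_def)
qed

lemma entry_poly_cong:
  assumes "entry_poly n D F" "\<And>g. g \<in> carrier_mat n n \<Longrightarrow> F g = G g"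
  shows "entry_poly n D G"
  using assms unfolding entry_poly_def by auto

lemma entry_poly_mcoef:
  assumes "m \<in> expvecs d k"
  shows "entry_poly k d (\<lambda>g. mcoef g m i)"
proof -
  obtain w where w: "m = wcontent w" "w \<in> words d k" using assms by (auto simp: expvecs_wcontent)
  have "entry_poly k d (\<lambda>g. word_entry g w b)" if "b \<in> words d k" for b
    using entry_poly_word_entry[of w b k] w that by (auto simp: words_def lists_len_def)
  then have "entry_poly k d (\<lambda>g. \<Sum>b\<in>{b \<in> words d k. wcontent b = i}. word_entry g w b)"
    by (intro entry_poly_sum) auto
  then show ?thesis by (rule entry_poly_cong) (use mcoef_wcontent w in auto)
qed

section \<open>An invariant form on metapolynomials\<close>

definition emb :: "nat \<Rightarrow> complex mat \<Rightarrow> complex mat" where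
  "emb n g = mat n n (\<lambda>(i, j). if i < dim_row g \<and> j < dim_row g then g $$ (i, j) else if i = j then 1 else 0)"

lemma emb_carrier [simp]: "emb n g \<in> carrier_mat n n"
  by (simp add: emb_def)

lemma emb_dim [simp]: "dim_row (emb n g) = n" "dim_col (emb n g) = n"
  by (simp_all add: emb_def)

lemma emb_index:
  "g \<in> carrier_mat m m \<Longrightarrow> i < n \<Longrightarrow> j < n \<Longrightarrow>
    emb n g $$ (i, j) = (if i < m \<and> j < m then g $$ (i, j) else if i = j then 1 else 0)"
  by (simp add: emb_def)

lemma emb_one: "m \<le> n \<Longrightarrow> emb n (1\<^sub>m m) = 1\<^sub>m n"
  by (rule eq_matI) (auto simp: emb_def)

lemma emb_adj: "g \<in> carrier_mat m m \<Longrightarrow> emb n (adj g) = adj (emb n g)"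
  by (rule eq_matI) (auto simp: emb_def adj_def)

lemma emb_mult:
  assumes "g \<in> carrier_mat m m" "h \<in> carrier_mat m m" "m \<le> n"
  shows "emb n (g * h) = emb n g * emb n h"
proof (rule eq_matI)
  fix i j assume "i < dim_row (emb n g * emb n h)" "j < dim_col (emb n g * emb n h)"
  then have ij: "i < n" "j < n" by auto
  have gh: "g * h \<in> carrier_mat m m" using assms by auto
  have *: "(emb n g * emb n h) $$ (i, j) = (\<Sum>l<n. emb n g $$ (i, l) * emb n h $$ (l, j))"
    using ij by (intro index_mult_sum) auto
  show "emb n (g * h) $$ (i, j) = (emb n g * emb n h) $$ (i, j)"
  proof (cases "i < m")
    case True
    have "(\<Sum>l<n. emb n g $$ (i, l) * emb n h $$ (l, j)) = (\<Sum>l<m. emb n g $$ (i, l) * emb n h $$ (l, j))"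
      using assms ij True by (intro sum.mono_neutral_right) (auto simp: emb_index[of _ m])
    also have "\<dots> = emb n (g * h) $$ (i, j)"
      using assms ij True gh
      by (auto simp: emb_index[of _ m] index_mult_sum[of _ m] simp del: index_mult_mat(1) intro!: sum.cong)
    finally show ?thesis using * by simp
  next
    case False
    have "(\<Sum>l<n. emb n g $$ (i, l) * emb n h $$ (l, j)) = (\<Sum>l<n. if l = i then emb n h $$ (i, j) else 0)"
      using assms ij False by (intro sum.cong refl) (auto simp: emb_index[of _ m])
    then show ?thesis using * assms ij False gh by (simp add: emb_index[of _ m])
  qed
qed auto

text \<open>Outside the block the entries of \<open>emb n g\<close> are constants, 1 on the diagonal
  and 0 off it, so a monomial either loses these factors or vanishes.\<close>

lemma entry_mon_emb:
  assumes g: "g \<in> carrier_mat m m" and mn: "m \<le> n"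
  shows "entry_mon n e (emb n g) =
    (if \<forall>i<n. \<forall>j<n. i \<noteq> j \<and> (m \<le> i \<or> m \<le> j) \<longrightarrow> e (i, j) = 0 then entry_mon m e g else 0)"
proof (cases "\<forall>i<n. \<forall>j<n. i \<noteq> j \<and> (m \<le> i \<or> m \<le> j) \<longrightarrow> e (i, j) = 0")
  case True
  have inner: "(\<Prod>j<n. emb n g $$ (i, j) ^ e (i, j)) = (if i < m then \<Prod>j<m. g $$ (i, j) ^ e (i, j) else 1)" if i: "i < n" for i
  proof (cases "i < m")
    case im: True
    have "(\<Prod>j<n. emb n g $$ (i, j) ^ e (i, j)) = (\<Prod>j<m. emb n g $$ (i, j) ^ e (i, j))"
      using mn True im i by (intro prod.mono_neutral_right) auto
    also have "\<dots> = (\<Prod>j<m. g $$ (i, j) ^ e (i, j))"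
      using mn im i g by (intro prod.cong) (auto simp: emb_index[of _ m])
    finally show ?thesis using im by simp
  next
    case False
    then have "(\<Prod>j<n. emb n g $$ (i, j) ^ e (i, j)) = 1"
      using True i g by (intro prod.neutral ballI) (auto simp: emb_index[of _ m])
    then show ?thesis using False by simp
  qed
  have "entry_mon n e (emb n g) = (\<Prod>i<n. if i < m then \<Prod>j<m. g $$ (i, j) ^ e (i, j) else 1)"
    unfolding entry_mon_def using inner by (intro prod.cong) auto
  also have "\<dots> = (\<Prod>i<m. if i < m then \<Prod>j<m. g $$ (i, j) ^ e (i, j) else 1)"
    using mn by (intro prod.mono_neutral_right) auto
  also have "\<dots> = entry_mon m e g" unfolding entry_mon_def by (intro prod.cong) auto
  finally show ?thesis using True by simp
next
  case False
  then obtain i j where ij: "i < n" "j < n" "i \<noteq> j" "m \<le> i \<or> m \<le> j" "e (i, j) \<noteq> 0" by auto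
  then have "emb n g $$ (i, j) ^ e (i, j) = 0" using g by (auto simp: emb_index[of _ m])
  then have z: "(\<Prod>j<n. emb n g $$ (i, j) ^ e (i, j)) = 0"
    by (intro prod_zero[OF finite_lessThan] bexI[of _ j]) (use ij in auto)
  have "entry_mon n e (emb n g) = 0"
    unfolding entry_mon_def by (rule prod_zero[OF finite_lessThan], rule bexI[of _ i], rule z) (use ij in simp)
  then show ?thesis using False by auto
qed

text \<open>\<open>emb\<close> respects products, the identity and adjoints, so the same space with
  the same form represents the smaller group. Keeping \<open>N\<close> also keeps one height
  function scale for all levels.\<close>

lemma (in unitary_rep) unitary_rep_restrict:
  assumes mn: "m \<le> n" and act': "\<And>g v. g \<in> carrier_mat m m \<Longrightarrow> v \<in> V \<Longrightarrow> act' g v = act (emb n g) v"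
  shows "unitary_rep scale V ip act' m N"
proof (intro unitary_rep.intro unitary_rep_axioms.intro unitary_space_axioms N_pos)
  show act_in': "act' g v \<in> V" if "g \<in> carrier_mat m m" "v \<in> V" for g v
    using that by (simp add: act' act_in)
  show "act' g (u + v) = act' g u + act' g v" if "g \<in> carrier_mat m m" "u \<in> V" "v \<in> V" for g u v
    using that by (simp add: act' act_add V_closed)
  show "act' g (c *s v) = c *s act' g v" if "g \<in> carrier_mat m m" "v \<in> V" for g v c
    using that by (simp add: act' act_scale V_closed)
  show "act' (1\<^sub>m m) v = v" if "v \<in> V" for v
    using that mn by (simp add: act' emb_one act_one)
  show "act' (g * h) v = act' g (act' h v)"
    if "g \<in> carrier_mat m m" "h \<in> carrier_mat m m" "v \<in> V" for g h v
  proof -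
    have "g * h \<in> carrier_mat m m" using that by auto
    then show ?thesis using that mn by (simp add: act' emb_mult act_mult act_in)
  qed
  show "ip (act' g v) w = ip v (act' (adj g) w)" if "g \<in> carrier_mat m m" "v \<in> V" "w \<in> V" for g v w
    using that act_adj[of "emb n g" v w] by (simp add: act' emb_adj[of g m])
  fix v assume v: "v \<in> V"
  obtain c where c: "\<forall>e\<in>exps n N. c e \<in> V" "\<forall>g\<in>carrier_mat n n. act g v = (\<Sum>e\<in>exps n N. entry_mon n e g *s c e)"
    using act_poly[OF v] by blast
  define E where "E = {e \<in> exps n N. \<forall>i<n. \<forall>j<n. i \<noteq> j \<and> (m \<le> i \<or> m \<le> j) \<longrightarrow> e (i, j) = 0}"
  define \<rho> where "\<rho> e = restrict e ({..<m} \<times> {..<m})" for e :: "nat \<times> nat \<Rightarrow> nat"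
  \<comment> \<open>Several monomials in the entries of the large matrix restrict to the same
    monomial of the block; their coefficients are added.\<close>
  define c' where "c' e' = (\<Sum>e\<in>{e \<in> E. \<rho> e = e'}. c e)" for e'
  have \<rho>: "\<rho> e \<in> exps m N" if "e \<in> E" for e
    using that mn unfolding E_def exps_def \<rho>_def by (auto simp: PiE_def Pi_def)
  have mon_\<rho>: "entry_mon m (\<rho> e) g = entry_mon m e g" for e g
    by (simp add: entry_mon_def \<rho>_def)
  have "act' g v = (\<Sum>e\<in>exps m N. entry_mon m e g *s c' e)" if g: "g \<in> carrier_mat m m" for g
  proof -
    have "act' g v = (\<Sum>e\<in>exps n N. entry_mon n e (emb n g) *s c e)" using g v c act' by simp
    also have "\<dots> = (\<Sum>e\<in>E. entry_mon m (\<rho> e) g *s c e)"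
      unfolding mon_\<rho> using entry_mon_emb[OF g mn]
      by (intro sum.mono_neutral_cong_right) (auto simp: E_def)
    also have "\<dots> = (\<Sum>e'\<in>exps m N. \<Sum>e\<in>{e \<in> E. \<rho> e = e'}. entry_mon m (\<rho> e) g *s c e)"
      using \<rho> by (intro sum.group[symmetric]) (auto simp: E_def)
    also have "\<dots> = (\<Sum>e\<in>exps m N. entry_mon m e g *s c' e)"
      unfolding c'_def scale_sum_right by (intro sum.cong) auto
    finally show ?thesis .
  qed
  moreover have "c' e \<in> V" for e unfolding c'_def using c by (intro V_closed) (auto simp: E_def)
  ultimately show "\<exists>c. (\<forall>e\<in>exps m N. c e \<in> V) \<and> (\<forall>g\<in>carrier_mat m m. act' g v = (\<Sum>e\<in>exps m N. entry_mon m e g *s c e))"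
    by blast
qed

text \<open>The quotient of a unitary space by the kernel of \<open>\<pi>\<close> is identified with the orthogonal
  complement of the kernel.\<close>

lemma (in unitary_space) quotient_form:
  fixes \<pi> :: "'v \<Rightarrow> 'w::ab_group_add" and sc :: "complex \<Rightarrow> 'w \<Rightarrow> 'w"
  assumes \<pi>_add: "\<And>u v. u \<in> V \<Longrightarrow> v \<in> V \<Longrightarrow> \<pi> (u + v) = \<pi> u + \<pi> v"
    and \<pi>_scale: "\<And>c u. u \<in> V \<Longrightarrow> \<pi> (c *s u) = sc c (\<pi> u)"
  obtains q where "\<And>x y z. x \<in> \<pi> ` V \<Longrightarrow> y \<in> \<pi> ` V \<Longrightarrow> z \<in> \<pi> ` V \<Longrightarrow> q (x + y) z = q x z + q y z"
    "\<And>c x z. x \<in> \<pi> ` V \<Longrightarrow> z \<in> \<pi> ` V \<Longrightarrow> q (sc c x) z = c * q x z"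
    "\<And>x z. x \<in> \<pi> ` V \<Longrightarrow> z \<in> \<pi> ` V \<Longrightarrow> q z x = cnj (q x z)"
    "\<And>x. x \<in> \<pi> ` V \<Longrightarrow> q x x = 0 \<Longrightarrow> x = 0"
    "\<And>A B A' B' x y. (\<And>u. u \<in> V \<Longrightarrow> A u \<in> V \<and> B u \<in> V \<and> \<pi> (A u) = A' (\<pi> u) \<and> \<pi> (B u) = B' (\<pi> u)) \<Longrightarrow>
      A' 0 = 0 \<Longrightarrow> B' 0 = 0 \<Longrightarrow> (\<And>u v. u \<in> V \<Longrightarrow> v \<in> V \<Longrightarrow> ip (A u) v = ip u (B v)) \<Longrightarrow>
      x \<in> \<pi> ` V \<Longrightarrow> y \<in> \<pi> ` V \<Longrightarrow> q (A' x) y = q x (B' y)"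
proof -
  have \<pi>0: "\<pi> 0 = 0" using \<pi>_add[of 0 0] V_closed(1) by simp
  have sc0: "sc c 0 = 0" for c using \<pi>_scale[of 0 c] V_closed(1) \<pi>0 by simp
  have \<pi>_diff: "\<pi> (u - v) = \<pi> u - \<pi> v" if "u \<in> V" "v \<in> V" for u v
    using \<pi>_add[of "u - v" v] that V_closed by (simp add: eq_diff_eq)
  define K where "K = {v \<in> V. \<pi> v = 0}"
  have K: "subspace K" "K \<subseteq> V"
    unfolding K_def by (rule subspaceI) (auto simp: V_closed \<pi>0 \<pi>_add \<pi>_scale sc0)
  define P where "P x u \<longleftrightarrow> u \<in> V \<and> \<pi> u = x \<and> (\<forall>\<kappa>\<in>K. ip u \<kappa> = 0)" for x u
  define lft where "lft x = (SOME u. P x u)" for x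
  have uniq: "u = v" if "P x u" "P x v" for x u v
  proof -
    have uv: "u \<in> V" "v \<in> V" "\<pi> u = x" "\<pi> v = x" using that by (auto simp: P_def)
    then have k: "u - v \<in> K" by (auto simp: K_def V_closed \<pi>_diff)
    then have "ip u (u - v) = 0" "ip v (u - v) = 0" using that unfolding P_def by blast+
    then have "ip (u - v) (u - v) = 0" using uv V_closed(3)[OF uv(1,2)] by (simp add: ip_diff)
    then show ?thesis using ip_definite[of "u - v"] uv V_closed by simp
  qed
  have P: "P x (lft x)" if x: "x \<in> \<pi> ` V" for x
  proof -
    obtain v where v: "v \<in> V" "x = \<pi> v" using x by blast
    obtain \<kappa> where \<kappa>: "\<kappa> \<in> K" "\<forall>z\<in>K. ip (v - \<kappa>) z = 0" using orth_proj[OF K v(1)] by blast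
    have "P x (v - \<kappa>)" using v \<kappa> K unfolding P_def by (auto simp: V_closed \<pi>_diff K_def)
    then show ?thesis unfolding lft_def by (rule someI)
  qed
  have L: "lft x \<in> V" "\<pi> (lft x) = x" "\<And>\<kappa>. \<kappa> \<in> K \<Longrightarrow> ip (lft x) \<kappa> = 0" if "x \<in> \<pi> ` V" for x
    using P[OF that] by (auto simp: P_def)
  have lftI: "lft x = u" if "P x u" for x u
  proof -
    have "x \<in> \<pi> ` V" using that by (auto simp: P_def)
    then show ?thesis using uniq P that by blast
  qed
  have KV: "\<kappa> \<in> K \<Longrightarrow> \<kappa> \<in> V" for \<kappa> using K by blast
  have lft_add: "lft (x + y) = lft x + lft y" if "x \<in> \<pi> ` V" "y \<in> \<pi> ` V" for x y
    using L[OF that(1)] L[OF that(2)] by (intro lftI) (auto simp: P_def V_closed \<pi>_add ip_add KV)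
  have lft_scale: "lft (sc c x) = c *s lft x" if "x \<in> \<pi> ` V" for x c
    using L[OF that] by (intro lftI) (auto simp: P_def V_closed \<pi>_scale ip_scale KV)
  define q where "q x y = ip (lft x) (lft y)" for x y
  show ?thesis
  proof (rule that[of q])
    show "q (x + y) z = q x z + q y z" if "x \<in> \<pi> ` V" "y \<in> \<pi> ` V" "z \<in> \<pi> ` V" for x y z
      using that L(1) by (simp add: q_def lft_add ip_add)
    show "q (sc c x) z = c * q x z" if "x \<in> \<pi> ` V" "z \<in> \<pi> ` V" for c x z
      using that L(1) by (simp add: q_def lft_scale ip_scale)
    show "q z x = cnj (q x z)" if "x \<in> \<pi> ` V" "z \<in> \<pi> ` V" for x z
      unfolding q_def using that L(1) by (intro ip_sym) auto
    show "x = 0" if x: "x \<in> \<pi> ` V" and "q x x = 0" for x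
    proof -
      have "lft x = 0" using that L(1) ip_definite by (simp add: q_def)
      then show ?thesis using L(2)[OF x] \<pi>0 by simp
    qed
    fix A B A' B' x y
    assume AB: "\<And>u. u \<in> V \<Longrightarrow> A u \<in> V \<and> B u \<in> V \<and> \<pi> (A u) = A' (\<pi> u) \<and> \<pi> (B u) = B' (\<pi> u)"
      and 0: "A' 0 = 0" "B' 0 = 0" and ad: "\<And>u v. u \<in> V \<Longrightarrow> v \<in> V \<Longrightarrow> ip (A u) v = ip u (B v)"
      and xy: "x \<in> \<pi> ` V" "y \<in> \<pi> ` V"
    \<comment> \<open>Both operators preserve the kernel of \<pi>, so by the adjoint relation both
      also preserve its orthogonal complement and hence commute with the lift.\<close>
    have AK: "A \<kappa> \<in> K" "B \<kappa> \<in> K" if "\<kappa> \<in> K" for \<kappa> using AB[of \<kappa>] that 0 by (auto simp: K_def)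
    have "lft (A' x) = A (lft x)"
      using L[OF xy(1)] AB AK by (intro lftI) (auto simp: P_def ad KV)
    moreover have "lft (B' y) = B (lft y)"
    proof (rule lftI)
      \<comment> \<open>The adjoint relation is assumed with \<open>A\<close> on the left only, so
        for \<open>B\<close> it is read backwards through the symmetry of the form.\<close>
      have "ip (B (lft y)) \<kappa> = 0" if \<kappa>: "\<kappa> \<in> K" for \<kappa>
      proof -
        have "ip (A \<kappa>) (lft y) = 0"
          using ip_0_commute[of "lft y" "A \<kappa>"] L[OF xy(2)] AK[OF \<kappa>] KV by simp
        then have "ip \<kappa> (B (lft y)) = 0" using ad[OF KV[OF \<kappa>] L(1)[OF xy(2)]] by simp
        then show ?thesis using ip_0_commute KV[OF \<kappa>] AB[OF L(1)[OF xy(2)]] by blast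
      qed
      then show "P (B' y) (B (lft y))" using L[OF xy(2)] AB by (simp add: P_def)
    qed
    ultimately show "q (A' x) y = q x (B' y)" using ad L(1) xy by (simp add: q_def)
  qed
qed

section \<open>Metapolynomials as a quotient of a tensor power\<close>

text \<open>Makes sense for singular matrices and agrees with \<open>meta_act\<close> on
  \<open>GL n\<close>, where the two inverses cancel. Composition of substitutions reverses the
  order and precomposition reverses it again, so this is a left action.\<close>

definition meta_subst :: "complex mat \<Rightarrow> metapoly \<Rightarrow> metapoly" where
  "meta_subst g \<Delta> = (\<lambda>f. \<Delta> (subst_linear g f))"

definition tscale :: "complex \<Rightarrow> ('a \<Rightarrow> complex) \<Rightarrow> 'a \<Rightarrow> complex" where
  "tscale c t = (\<lambda>I. c * t I)"

lemma vector_space_tscale: "vector_space tscale"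
  by unfold_locales (auto simp: tscale_def fun_eq_iff algebra_simps)

lemma fun_sum_apply: "(\<Sum>i\<in>I. F i) x = (\<Sum>i\<in>I. F i x)"
  by (induction I rule: infinite_finite_induct) auto

text \<open>Ordered lists in place of multisets: on them the action is a tensor power. Lists that
  are permutations of each other give the same function; the resulting kernel is removed by
  \<open>quotient_form\<close>.\<close>

definition list_mono :: "expvec list \<Rightarrow> metapoly" where
  "list_mono I = (\<lambda>f. prod_list (map (Poly_Mapping.lookup f) I))"

lemma metamonomial_mset: "metamonomial (mset I) = list_mono I"
  by (induction I) (auto simp: metamonomial_def list_mono_def metavar_def fun_eq_iff)

lemma metamonomials_eq:
  "{metamonomial M | M. size M = \<delta> \<and> set_mset M \<subseteq> expvecs d k} = list_mono ` lists_len (expvecs d k) \<delta>"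
proof -
  have "\<exists>I\<in>lists_len (expvecs d k) \<delta>. metamonomial M = list_mono I" if "size M = \<delta>" "set_mset M \<subseteq> expvecs d k" for M
  proof -
    obtain I where "mset I = M" using ex_mset by blast
    then show ?thesis using that metamonomial_mset[of I] by (intro bexI[of _ I]) (auto simp: lists_len_def)
  qed
  moreover have "\<exists>M. list_mono I = metamonomial M \<and> size M = \<delta> \<and> set_mset M \<subseteq> expvecs d k" if "I \<in> lists_len (expvecs d k) \<delta>" for I
    using that metamonomial_mset[of I] by (intro exI[of _ "mset I"]) (auto simp: lists_len_def)
  ultimately show ?thesis by (auto simp: image_iff)
qed

lemma metapolys_eq: "metapolys \<delta> d k = meta.span (list_mono ` lists_len (expvecs d k) \<delta>)"
  by (simp add: metapolys_def metamonomials_eq)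

text \<open>An entry of the tensor power of the matrix by which \<open>g\<close> acts on
  metavariables.\<close>

definition list_coef :: "complex mat \<Rightarrow> expvec list \<Rightarrow> expvec list \<Rightarrow> complex" where
  "list_coef g J I = prod_list (map2 (mcoef g) J I)"

lemma list_mono_subst:
  assumes g: "g \<in> carrier_mat k k" and I: "I \<in> lists_len (expvecs d k) \<delta>"
  shows "list_mono I (subst_linear g f) = (\<Sum>J\<in>lists_len (expvecs d k) \<delta>. list_coef g J I * list_mono J f)"
proof -
  have pr: "prod_list (map2 (\<lambda>m i. mcoef g m i * Poly_Mapping.lookup f m) J I) = list_coef g J I * list_mono J f"
    if "length J = length I" for J
    using that by (induction J I rule: list_induct2) (simp_all add: list_coef_def list_mono_def)
  have "list_mono I (subst_linear g f) = prod_list (map (\<lambda>i. \<Sum>m\<in>expvecs d k. mcoef g m i * Poly_Mapping.lookup f m) I)"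
    using I lookup_subst_linear[OF g] unfolding list_mono_def
    by (intro arg_cong[where f = prod_list] map_cong) (auto simp: lists_len_def)
  also have "\<dots> = (\<Sum>J\<in>lists_len (expvecs d k) \<delta>. prod_list (map2 (\<lambda>m i. mcoef g m i * Poly_Mapping.lookup f m) J I))"
    unfolding prod_list_sum using I by (simp add: lists_len_def)
  also have "\<dots> = (\<Sum>J\<in>lists_len (expvecs d k) \<delta>. list_coef g J I * list_mono J f)"
    using I pr by (intro sum.cong) (auto simp: lists_len_def)
  finally show ?thesis .
qed

definition list_count :: "nat \<Rightarrow> nat \<Rightarrow> expvec list \<Rightarrow> nat" where
  "list_count d k I = prod_list (map (word_count d k) I)"

lemma list_coef_adj:
  assumes g: "g \<in> carrier_mat k k" and IJ: "I \<in> lists_len (expvecs d k) \<delta>" "J \<in> lists_len (expvecs d k) \<delta>"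
  shows "of_nat (list_count d k J) * list_coef g J I = of_nat (list_count d k I) * cnj (list_coef (adj g) I J)"
proof -
  have "length J = length I" "set J \<subseteq> expvecs d k" "set I \<subseteq> expvecs d k" using IJ by (auto simp: lists_len_def)
  then show ?thesis
  proof (induction J I rule: list_induct2)
    case (Cons m J i I)
    have "of_nat (list_count d k (m # J)) * list_coef g (m # J) (i # I) =
      (of_nat (word_count d k m) * mcoef g m i) * (of_nat (list_count d k J) * list_coef g J I)"
      by (simp add: list_count_def list_coef_def)
    also have "\<dots> = (of_nat (word_count d k i) * cnj (mcoef (adj g) i m)) *
        (of_nat (list_count d k I) * cnj (list_coef (adj g) I J))"
      using Cons mcoef_adj[OF g, of i d m] by simp
    finally show ?case by (simp add: list_count_def list_coef_def)
  qed (simp add: list_count_def list_coef_def)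
qed

lemma list_count_pos: "I \<in> lists_len (expvecs d k) \<delta> \<Longrightarrow> list_count d k I > 0"
proof -
  have "set I \<subseteq> expvecs d k \<Longrightarrow> list_count d k I > 0"
    by (induction I) (auto simp: list_count_def word_count_pos)
  then show "I \<in> lists_len (expvecs d k) \<delta> \<Longrightarrow> list_count d k I > 0" by (simp add: lists_len_def)
qed

lemma entry_poly_list_coef:
  assumes "I \<in> lists_len (expvecs d k) \<delta>" "J \<in> lists_len (expvecs d k) \<delta>"
  shows "entry_poly k (d * \<delta>) (\<lambda>g. list_coef g J I)"
proof -
  have "length J = length I \<Longrightarrow> set J \<subseteq> expvecs d k \<Longrightarrow> entry_poly k (d * length J) (\<lambda>g. list_coef g J I)"
  proof (induction J I rule: list_induct2)
    case Nil
    then show ?case by (simp add: list_coef_def entry_poly_const)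
  next
    case (Cons m J i I)
    then have "entry_poly k (d + d * length J) (\<lambda>g. mcoef g m i * list_coef g J I)"
      by (intro entry_poly_mult entry_poly_mcoef) auto
    then show ?case by (simp add: list_coef_def)
  qed
  then show ?thesis using assms by (simp add: lists_len_def)
qed

text \<open>The form on coefficient families weights each list by the product of the multinomial
  coefficients of its members; these weights are exactly what \<open>list_coef_adj\<close> requires.
  The evaluation map \<pi> intertwines the tensor action \<open>T\<close> with substitution, and
  \<open>quotient_form\<close> carries form and adjoints to its image.\<close>

lemma metapolys_unitary_rep_full:
  assumes N: "d * \<delta> > 0"
  obtains q where "unitary_rep mscale (metapolys \<delta> d k) q meta_subst k (d * \<delta>)"
proof -
  define L where "L = lists_len (expvecs d k) \<delta>"
  have finL [simp]: "finite L" by (simp add: L_def)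
  define V where "V = {t :: expvec list \<Rightarrow> complex. \<forall>I. I \<notin> L \<longrightarrow> t I = 0}"
  define form where "form t u = (\<Sum>I\<in>L. of_nat (list_count d k I) * (t I * cnj (u I)))" for t u
  interpret t: vector_space "tscale :: complex \<Rightarrow> (expvec list \<Rightarrow> complex) \<Rightarrow> _" by (rule vector_space_tscale)
  define ind where "ind J = (\<lambda>I. if I = J then 1 else 0 :: complex)" for J :: "expvec list"
  have V_sum: "t = (\<Sum>J\<in>L. tscale (t J) (ind J))" if "t \<in> V" for t
  proof
    fix I show "t I = (\<Sum>J\<in>L. tscale (t J) (ind J)) I"
      using that by (auto simp: fun_sum_apply tscale_def ind_def V_def if_distrib cong: if_cong)
  qed
  have V_sub: "t.subspace V" by (rule t.subspaceI) (auto simp: V_def tscale_def)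
  interpret U: unitary_space "tscale :: complex \<Rightarrow> (expvec list \<Rightarrow> complex) \<Rightarrow> _" V form
  proof
    show "t.subspace V" by (rule V_sub)
    show "\<exists>B. finite B \<and> V = t.span B"
    proof (intro exI conjI)
      show "V = t.span (ind ` L)"
      proof
        show "V \<subseteq> t.span (ind ` L)"
        proof
          fix t assume "t \<in> V"
          then have "t = (\<Sum>J\<in>L. tscale (t J) (ind J))" by (rule V_sum)
          also have "\<dots> \<in> t.span (ind ` L)" by (intro t.span_sum t.span_scale t.span_base) auto
          finally show "t \<in> t.span (ind ` L)" .
        qed
        show "t.span (ind ` L) \<subseteq> V" by (rule t.span_minimal[OF _ V_sub]) (auto simp: V_def ind_def)
      qed
    qed simp
    show "form (u + v) w = form u w + form v w" for u v w
      by (simp add: form_def algebra_simps sum.distrib)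
    show "form (tscale c u) w = c * form u w" for c u w
      by (simp add: form_def tscale_def sum_distrib_left mult_ac)
    show "form w u = cnj (form u w)" for u w
      by (simp add: form_def mult_ac)
    show "u = 0" if u: "u \<in> V" "form u u = 0" for u
    proof -
      have "form u u = of_real (\<Sum>I\<in>L. real (list_count d k I) * (cmod (u I))\<^sup>2)"
        by (simp add: form_def complex_norm_square del: of_real_power)
      then have "(\<Sum>I\<in>L. real (list_count d k I) * (cmod (u I))\<^sup>2) = 0" using u(2) of_real_eq_0_iff by metis
      then have "\<forall>I\<in>L. real (list_count d k I) * (cmod (u I))\<^sup>2 = 0"
        by (subst (asm) sum_nonneg_eq_0_iff) auto
      then have "u I = 0" if "I \<in> L" for I
        using that list_count_pos[of I d k \<delta>] by (auto simp: L_def)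
      then show ?thesis using u(1) by (auto simp: V_def fun_eq_iff)
    qed
  qed
  define \<pi> where "\<pi> t = (\<Sum>I\<in>L. mscale (t I) (list_mono I))" for t
  have \<pi>_apply: "\<pi> t f = (\<Sum>I\<in>L. t I * list_mono I f)" for t f
    by (simp add: \<pi>_def fun_sum_apply mscale_def)
  have \<pi>_add: "\<pi> (t + u) = \<pi> t + \<pi> u" for t u
    by (simp add: fun_eq_iff \<pi>_apply algebra_simps sum.distrib)
  have \<pi>_scale: "\<pi> (tscale c t) = mscale c (\<pi> t)" for c t
    by (simp add: fun_eq_iff \<pi>_apply tscale_def mscale_def sum_distrib_left mult_ac)
  have ind_V: "ind I \<in> V" if "I \<in> L" for I using that by (auto simp: V_def ind_def)
  have \<pi>_ind: "\<pi> (ind I) = list_mono I" if "I \<in> L" for I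
    using that by (auto simp: fun_eq_iff \<pi>_apply ind_def if_distrib[of "\<lambda>x. x * _"] cong: if_cong)
  have \<pi>V: "metapolys \<delta> d k = \<pi> ` V"
  proof
    have "meta.subspace (\<pi> ` V)"
    proof (rule meta.subspaceI)
      have "\<pi> 0 = 0" by (simp add: fun_eq_iff \<pi>_apply)
      then show "0 \<in> \<pi> ` V" using U.V_closed(1) by (metis imageI)
      show "x + y \<in> \<pi> ` V" if "x \<in> \<pi> ` V" "y \<in> \<pi> ` V" for x y
        using that U.V_closed(2) \<pi>_add by (auto simp: image_iff) metis
      show "mscale c x \<in> \<pi> ` V" if "x \<in> \<pi> ` V" for c x
        using that U.V_closed(4) \<pi>_scale by (auto simp: image_iff) metis
    qed
    moreover have "list_mono ` L \<subseteq> \<pi> ` V" using ind_V \<pi>_ind by force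
    ultimately show "metapolys \<delta> d k \<subseteq> \<pi> ` V"
      unfolding metapolys_eq L_def[symmetric] by (intro meta.span_minimal)
    show "\<pi> ` V \<subseteq> metapolys \<delta> d k"
      unfolding metapolys_eq L_def[symmetric] \<pi>_def
      by (auto intro!: meta.span_sum meta.span_scale intro: meta.span_base)
  qed
  define T where "T g t = (\<lambda>J. if J \<in> L then \<Sum>I\<in>L. list_coef g J I * t I else 0)" for g t
  have TV: "T g t \<in> V" for g t by (auto simp: V_def T_def)
  have \<pi>T: "\<pi> (T g t) = meta_subst g (\<pi> t)" if g: "g \<in> carrier_mat k k" for g t
  proof
    fix f
    have "\<pi> (T g t) f = (\<Sum>J\<in>L. \<Sum>I\<in>L. list_coef g J I * t I * list_mono J f)"
      unfolding \<pi>_apply T_def by (intro sum.cong refl) (simp add: sum_distrib_right)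
    also have "\<dots> = (\<Sum>I\<in>L. \<Sum>J\<in>L. list_coef g J I * t I * list_mono J f)" by (rule sum.swap)
    also have "\<dots> = (\<Sum>I\<in>L. t I * list_mono I (subst_linear g f))"
      using list_mono_subst[OF g, of _ d \<delta> f] unfolding L_def
      by (intro sum.cong refl) (simp add: sum_distrib_left mult_ac)
    also have "\<dots> = meta_subst g (\<pi> t) f" by (simp add: meta_subst_def \<pi>_apply)
    finally show "\<pi> (T g t) f = meta_subst g (\<pi> t) f" .
  qed
  have adjT: "form (T g t) u = form t (T (adj g) u)" if g: "g \<in> carrier_mat k k" for g t u
  proof -
    have "form (T g t) u = (\<Sum>J\<in>L. \<Sum>I\<in>L. (of_nat (list_count d k J) * list_coef g J I) * (t I * cnj (u J)))"
      unfolding form_def T_def by (intro sum.cong refl) (simp add: sum_distrib_left sum_distrib_right mult_ac)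
    also have "\<dots> = (\<Sum>I\<in>L. \<Sum>J\<in>L. (of_nat (list_count d k J) * list_coef g J I) * (t I * cnj (u J)))"
      by (rule sum.swap)
    also have "\<dots> = (\<Sum>I\<in>L. \<Sum>J\<in>L. (of_nat (list_count d k I) * cnj (list_coef (adj g) I J)) * (t I * cnj (u J)))"
      by (intro sum.cong refl arg_cong2[where f = "(*)"] list_coef_adj[OF g]) (auto simp: L_def)
    also have "\<dots> = form t (T (adj g) u)"
      unfolding form_def T_def by (intro sum.cong refl) (simp add: sum_distrib_left sum_distrib_right mult_ac)
    finally show ?thesis .
  qed
  show ?thesis
  proof (rule U.quotient_form[of \<pi> mscale])
  fix q assume q: "\<And>x y z. x \<in> \<pi> ` V \<Longrightarrow> y \<in> \<pi> ` V \<Longrightarrow> z \<in> \<pi> ` V \<Longrightarrow> q (x + y) z = q x z + q y z"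
    "\<And>c x z. x \<in> \<pi> ` V \<Longrightarrow> z \<in> \<pi> ` V \<Longrightarrow> q (mscale c x) z = c * q x z"
    "\<And>x z. x \<in> \<pi> ` V \<Longrightarrow> z \<in> \<pi> ` V \<Longrightarrow> q z x = cnj (q x z)"
    "\<And>x. x \<in> \<pi> ` V \<Longrightarrow> q x x = 0 \<Longrightarrow> x = 0"
    "\<And>A B A' B' x y. (\<And>u. u \<in> V \<Longrightarrow> A u \<in> V \<and> B u \<in> V \<and> \<pi> (A u) = A' (\<pi> u) \<and> \<pi> (B u) = B' (\<pi> u)) \<Longrightarrow>
      A' 0 = 0 \<Longrightarrow> B' 0 = 0 \<Longrightarrow> (\<And>u v. u \<in> V \<Longrightarrow> v \<in> V \<Longrightarrow> form (A u) v = form u (B v)) \<Longrightarrow>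
      x \<in> \<pi> ` V \<Longrightarrow> y \<in> \<pi> ` V \<Longrightarrow> q (A' x) y = q x (B' y)"
  note q' = q[folded \<pi>V]
  have "unitary_rep mscale (metapolys \<delta> d k) q meta_subst k (d * \<delta>)"
  proof (intro unitary_rep.intro unitary_space.intro unitary_space_axioms.intro unitary_rep_axioms.intro)
    show "Vector_Spaces.vector_space mscale" by (rule meta.vector_space_axioms)
    show "meta.subspace (metapolys \<delta> d k)" by (simp add: metapolys_def)
    show "\<exists>B. finite B \<and> metapolys \<delta> d k = meta.span B" unfolding metapolys_eq
      by (rule exI[of _ "list_mono ` lists_len (expvecs d k) \<delta>"]) simp
    show "meta_subst g v \<in> metapolys \<delta> d k" if "g \<in> carrier_mat k k" "v \<in> metapolys \<delta> d k" for g v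
      using that TV \<pi>T unfolding \<pi>V by (auto simp: image_iff) metis
    show "meta_subst g (u + v) = meta_subst g u + meta_subst g v" for g u v
      by (simp add: meta_subst_def fun_eq_iff)
    show "meta_subst g (mscale c v) = mscale c (meta_subst g v)" for g c v
      by (simp add: meta_subst_def mscale_def)
    show "meta_subst (1\<^sub>m k) v = v" for v
      by (simp add: meta_subst_def subst_linear_one)
    show "meta_subst (g * h) v = meta_subst g (meta_subst h v)" if "g \<in> carrier_mat k k" "h \<in> carrier_mat k k" for g h v
      by (simp add: meta_subst_def subst_linear_subst_linear[OF that])
    show "q (meta_subst g v) w = q v (meta_subst (adj g) w)"
      if g: "g \<in> carrier_mat k k" and vw: "v \<in> metapolys \<delta> d k" "w \<in> metapolys \<delta> d k" for g v w
      by (rule q'(5)[where A = "T g" and B = "T (adj g)"])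
        (use g vw TV \<pi>T adjT adj_carrier in \<open>auto simp: meta_subst_def fun_eq_iff\<close>)
    fix v assume "v \<in> metapolys \<delta> d k"
    then obtain t where t: "t \<in> V" "v = \<pi> t" unfolding \<pi>V by blast
    have "\<exists>c. \<forall>I\<in>L. \<forall>J\<in>L. \<forall>g\<in>carrier_mat k k. list_coef g J I = (\<Sum>e\<in>exps k (d * \<delta>). c I J e * entry_mon k e g)"
      using entry_poly_list_coef[of _ d k \<delta>] unfolding entry_poly_def L_def by metis
    then obtain c where c: "\<forall>I\<in>L. \<forall>J\<in>L. \<forall>g\<in>carrier_mat k k. list_coef g J I = (\<Sum>e\<in>exps k (d * \<delta>). c I J e * entry_mon k e g)"
      by blast
    define C where "C e = (\<Sum>I\<in>L. \<Sum>J\<in>L. mscale (t I * c I J e) (list_mono J))" for e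
    have "meta_subst g v = (\<Sum>e\<in>exps k (d * \<delta>). mscale (entry_mon k e g) (C e))" if g: "g \<in> carrier_mat k k" for g
    proof
      fix f
      have "meta_subst g v f = (\<Sum>I\<in>L. t I * (\<Sum>J\<in>L. list_coef g J I * list_mono J f))"
        unfolding t(2) meta_subst_def \<pi>_apply using list_mono_subst[OF g, of _ d \<delta> f]
        by (intro sum.cong refl) (simp add: L_def)
      also have "\<dots> = (\<Sum>I\<in>L. \<Sum>J\<in>L. \<Sum>e\<in>exps k (d * \<delta>). entry_mon k e g * (t I * c I J e * list_mono J f))"
        unfolding sum_distrib_left using c g
        by (intro sum.cong refl) (simp add: sum_distrib_left sum_distrib_right mult_ac)
      also have "\<dots> = (\<Sum>I\<in>L. \<Sum>e\<in>exps k (d * \<delta>). \<Sum>J\<in>L. entry_mon k e g * (t I * c I J e * list_mono J f))"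
        by (intro sum.cong refl sum.swap)
      also have "\<dots> = (\<Sum>e\<in>exps k (d * \<delta>). \<Sum>I\<in>L. \<Sum>J\<in>L. entry_mon k e g * (t I * c I J e * list_mono J f))"
        by (rule sum.swap)
      also have "\<dots> = (\<Sum>e\<in>exps k (d * \<delta>). mscale (entry_mon k e g) (C e)) f"
        by (simp add: C_def fun_sum_apply mscale_def sum_distrib_left)
      finally show "meta_subst g v f = (\<Sum>e\<in>exps k (d * \<delta>). mscale (entry_mon k e g) (C e)) f" .
    qed
    moreover have "C e \<in> metapolys \<delta> d k" for e
      unfolding C_def metapolys_eq L_def[symmetric]
      by (intro meta.span_sum meta.span_scale) (auto intro: meta.span_base)
    ultimately show "\<exists>c. (\<forall>e\<in>exps k (d * \<delta>). c e \<in> metapolys \<delta> d k) \<and>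
      (\<forall>g\<in>carrier_mat k k. meta_subst g v = (\<Sum>e\<in>exps k (d * \<delta>). mscale (entry_mon k e g) (c e)))" by blast
  qed (rule q'(1), assumption+, rule q'(2), assumption+, rule q'(3), assumption+, rule q'(4), assumption+, rule N)
  then show ?thesis using that by blast
  qed (simp_all add: \<pi>_add \<pi>_scale)
qed

lemma subst_linear_emb:
  assumes "g \<in> carrier_mat n n" "n \<le> k"
  shows "subst_linear (emb k g) f = subst_linear g f"
proof -
  have "linear_form (emb k g) a = linear_form g a" for a
  proof -
    consider "a < n" | "n \<le> a" "a < k" | "k \<le> a" by linarith
    then show ?thesis
    proof cases
      case 1
      have "(\<Sum>b<k. Const (emb k g $$ (a, b)) * Var b) = (\<Sum>b<n. Const (g $$ (a, b)) * Var b)"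
        using 1 assms by (intro sum.mono_neutral_cong_right) (auto simp: emb_index[of _ n] Const_simps)
      then show ?thesis using 1 assms by (simp add: linear_form_def)
    next
      case 2
      have "(\<Sum>b<k. Const (emb k g $$ (a, b)) * Var b) = (\<Sum>b<k. if b = a then Var a else 0)"
        using 2 assms by (intro sum.cong refl) (auto simp: emb_index[of _ n] Const_simps)
      then show ?thesis using 2 assms by (simp add: linear_form_def)
    qed (use assms in \<open>auto simp: linear_form_def\<close>)
  qed
  then show ?thesis by (simp add: subst_linear_def)
qed

lemma metapolys_unitary_rep:
  assumes N: "d * \<delta> > 0"
  obtains q where "\<And>n. n \<le> k \<Longrightarrow> unitary_rep mscale (metapolys \<delta> d k) q meta_subst n (d * \<delta>)"
proof -
  obtain q where q: "unitary_rep mscale (metapolys \<delta> d k) q meta_subst k (d * \<delta>)"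
    using metapolys_unitary_rep_full[OF N] by blast
  show ?thesis
  proof (rule that)
    fix n assume "n \<le> k"
    then show "unitary_rep mscale (metapolys \<delta> d k) q meta_subst n (d * \<delta>)"
      by (rule unitary_rep.unitary_rep_restrict[OF q]) (simp add: meta_subst_def subst_linear_emb \<open>n \<le> k\<close>)
  qed
qed

section \<open>Circuits\<close>

lemma affine_metapolys_subst:
  assumes g: "g \<in> carrier_mat k k" and A: "A \<in> affine_metapolys d k"
  shows "meta_subst g A \<in> affine_metapolys d k"
proof -
  obtain a b where A: "A = (\<lambda>f. a + (\<Sum>i\<in>expvecs d k. b i * metavar i f))" using A by (auto simp: affine_metapolys_def)
  have "meta_subst g A f = a + (\<Sum>m\<in>expvecs d k. (\<Sum>i\<in>expvecs d k. b i * mcoef g m i) * metavar m f)" for f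
  proof -
    have "(\<Sum>i\<in>expvecs d k. b i * metavar i (subst_linear g f)) =
        (\<Sum>i\<in>expvecs d k. \<Sum>m\<in>expvecs d k. b i * mcoef g m i * metavar m f)"
      unfolding metavar_def using lookup_subst_linear[OF g]
      by (intro sum.cong refl) (simp add: sum_distrib_left mult.assoc)
    also have "\<dots> = (\<Sum>m\<in>expvecs d k. \<Sum>i\<in>expvecs d k. b i * mcoef g m i * metavar m f)" by (rule sum.swap)
    finally show ?thesis by (simp add: A meta_subst_def sum_distrib_right)
  qed
  then have "meta_subst g A = (\<lambda>f. a + (\<Sum>m\<in>expvecs d k. (\<Sum>i\<in>expvecs d k. b i * mcoef g m i) * metavar m f))" by auto
  then show ?thesis unfolding affine_metapolys_def mem_Collect_eq
    by (intro exI[of _ a] exI[of _ "\<lambda>m. \<Sum>i\<in>expvecs d k. b i * mcoef g m i"]) simp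
qed

lemma affine_metapolys_0: "0 \<in> affine_metapolys d k"
  unfolding affine_metapolys_def by (auto simp: fun_eq_iff intro!: exI[of _ 0] exI[of _ "\<lambda>_. 0"])

text \<open>Serves the case \<open>d * \<delta> = 1\<close>, where each projection is a single input
  gate.\<close>

lemma linear_metapolys_affine: "metapolys 1 d k \<subseteq> affine_metapolys d k"
proof -
  define A where "A = {(\<lambda>f. \<Sum>i\<in>expvecs d k. b i * metavar i f) | b. True}"
  have "meta.subspace A"
  proof (rule meta.subspaceI)
    show "0 \<in> A" unfolding A_def by (auto simp: fun_eq_iff intro!: exI[of _ "\<lambda>_. 0"])
    show "x + y \<in> A" if xy: "x \<in> A" "y \<in> A" for x y
    proof -
      obtain b c where "x = (\<lambda>f. \<Sum>i\<in>expvecs d k. b i * metavar i f)" "y = (\<lambda>f. \<Sum>i\<in>expvecs d k. c i * metavar i f)"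
        using xy by (auto simp: A_def)
      then have "x + y = (\<lambda>f. \<Sum>i\<in>expvecs d k. (b i + c i) * metavar i f)"
        by (auto simp: fun_eq_iff distrib_right sum.distrib)
      then show ?thesis unfolding A_def mem_Collect_eq by (intro exI[of _ "\<lambda>i. b i + c i"]) simp
    qed
    show "mscale c x \<in> A" if x: "x \<in> A" for c x
    proof -
      obtain b where "x = (\<lambda>f. \<Sum>i\<in>expvecs d k. b i * metavar i f)" using x by (auto simp: A_def)
      then have "mscale c x = (\<lambda>f. \<Sum>i\<in>expvecs d k. (c * b i) * metavar i f)"
        by (auto simp: mscale_def sum_distrib_left mult.assoc)
      then show ?thesis unfolding A_def mem_Collect_eq by (intro exI[of _ "\<lambda>i. c * b i"]) simp
    qed
  qed
  moreover have "list_mono ` lists_len (expvecs d k) 1 \<subseteq> A"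
  proof clarify
    fix I assume "I \<in> lists_len (expvecs d k) 1"
    then obtain i where i: "I = [i]" "i \<in> expvecs d k" by (auto simp: lists_len_def length_Suc_conv)
    have "(\<Sum>j\<in>expvecs d k. (if j = i then 1 else 0) * metavar j f) = (\<Sum>j\<in>expvecs d k. if j = i then metavar i f else 0)" for f
      by (intro sum.cong) auto
    then have "list_mono I = (\<lambda>f. \<Sum>j\<in>expvecs d k. (if j = i then 1 else 0) * metavar j f)"
      using i by (simp add: list_mono_def metavar_def)
    then show "list_mono I \<in> A" unfolding A_def mem_Collect_eq by (intro exI[of _ "\<lambda>j. if j = i then 1 else 0"]) simp
  qed
  ultimately have "metapolys 1 d k \<subseteq> A" unfolding metapolys_eq by (intro meta.span_minimal)
  moreover have "A \<subseteq> affine_metapolys d k"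
  proof
    fix x assume "x \<in> A"
    then obtain b where "x = (\<lambda>f. 0 + (\<Sum>i\<in>expvecs d k. b i * metavar i f))" by (auto simp: A_def)
    then show "x \<in> affine_metapolys d k" unfolding affine_metapolys_def by blast
  qed
  ultimately show ?thesis by blast
qed

fun relabel :: "(nat \<Rightarrow> nat) \<Rightarrow> gate \<Rightarrow> gate" where
  "relabel f (Input A) = Input A"
| "relabel f (Plus (a, u) (b, v)) = Plus (a, f u) (b, f v)"
| "relabel f (Times (a, u) (b, v)) = Times (a, f u) (b, f v)"

lemma sources_relabel [simp]: "sources (relabel f G) = f ` sources G"
  by (cases "(f, G)" rule: relabel.cases) auto

lemma gate_value_relabel: "gate_value val (relabel f G) = gate_value (\<lambda>u. val (f u)) G"
  by (cases "(f, G)" rule: relabel.cases) auto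

lemma relabel_Input [simp]: "relabel f G = Input A \<longleftrightarrow> G = Input A"
  by (cases "(f, G)" rule: relabel.cases) auto

text \<open>Acyclicity is replaced by a rank that increases along edges; ranks are easy to supply
  when circuits are modified or joined.\<close>

definition ranked_circuit ::
  "nat \<Rightarrow> nat \<Rightarrow> nat set \<Rightarrow> (nat \<Rightarrow> gate) \<Rightarrow> (nat \<Rightarrow> nat) \<Rightarrow> (nat \<Rightarrow> metapoly) \<Rightarrow> bool" where
  "ranked_circuit d k W lab rk val \<longleftrightarrow> finite W \<and> (\<forall>v\<in>W. sources (lab v) \<subseteq> W \<and>
    (\<forall>A. lab v = Input A \<longrightarrow> A \<in> affine_metapolys d k) \<and> (\<forall>u\<in>sources (lab v). rk u < rk v) \<and>
    val v = gate_value val (lab v))"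

text \<open>In a finite acyclic graph the number of proper ancestors is a rank. Conversely a rank
  puts the edges into \<open>measure rk\<close>, which is well-founded.\<close>

lemma has_circuit_iff_ranked:
  "has_circuit_of_size d k \<Delta> s \<longleftrightarrow>
    (\<exists>W lab rk val out. ranked_circuit d k W lab rk val \<and> out \<in> W \<and> card W = s \<and> val out = \<Delta>)"
proof
  assume "has_circuit_of_size d k \<Delta> s"
  then obtain C val where C: "is_circuit d k C" "card (vertices C) = s"
    "\<forall>v\<in>vertices C. val v = gate_value val (label C v)" "val (out_vertex C) = \<Delta>"
    unfolding has_circuit_of_size_def circuit_computes_def by blast
  define E where "E = circuit_edges C"
  have "E \<subseteq> vertices C \<times> vertices C" using C(1) unfolding E_def circuit_edges_def is_circuit_def by auto
  then have fin: "finite E" using C(1) finite_subset unfolding is_circuit_def by blast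
  have ac: "acyclic E" using C(1) by (simp add: is_circuit_def E_def)
  define rk where "rk v = card {u. (u, v) \<in> E\<^sup>+}" for v
  have rk: "rk u < rk v" if "(u, v) \<in> E" for u v
    unfolding rk_def
  proof (rule psubset_card_mono)
    show "finite {u. (u, v) \<in> E\<^sup>+}"
      by (rule finite_subset[of _ "Domain E"]) (use fin in \<open>auto simp: finite_Domain dest: tranclD\<close>)
    show "{w. (w, u) \<in> E\<^sup>+} \<subset> {w. (w, v) \<in> E\<^sup>+}"
      using that ac unfolding acyclic_def by (auto intro: trancl_into_trancl)
  qed
  have "ranked_circuit d k (vertices C) (label C) rk val"
    unfolding ranked_circuit_def using C rk
    by (auto simp: is_circuit_def E_def circuit_edges_def)
  then show "\<exists>W lab rk val out. ranked_circuit d k W lab rk val \<and> out \<in> W \<and> card W = s \<and> val out = \<Delta>"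
    using C unfolding is_circuit_def by blast
next
  assume "\<exists>W lab rk val out. ranked_circuit d k W lab rk val \<and> out \<in> W \<and> card W = s \<and> val out = \<Delta>"
  then obtain W lab rk val out where *: "ranked_circuit d k W lab rk val" "out \<in> W" "card W = s" "val out = \<Delta>" by blast
  define C where "C = \<lparr>vertices = W, label = lab, out_vertex = out\<rparr>"
  have "circuit_edges C \<subseteq> measure rk" using *(1) by (auto simp: circuit_edges_def C_def ranked_circuit_def)
  then have "acyclic (circuit_edges C)" using wf_acyclic wf_subset wf_measure by blast
  then have "is_circuit d k C" using * by (auto simp: is_circuit_def C_def ranked_circuit_def)
  moreover have "circuit_computes C \<Delta>"
    unfolding circuit_computes_def using * by (intro exI[of _ val]) (auto simp: C_def ranked_circuit_def)
  ultimately show "has_circuit_of_size d k \<Delta> s"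
    unfolding has_circuit_of_size_def using * by (intro exI[of _ C]) (auto simp: C_def)
qed

lemma has_circuit_size_pos: "has_circuit_of_size d k \<Delta> s \<Longrightarrow> s \<ge> 1"
  unfolding has_circuit_iff_ranked ranked_circuit_def by (auto simp: Suc_le_eq card_gt_0_iff)

lemma has_circuit_affine: "A \<in> affine_metapolys d k \<Longrightarrow> has_circuit_of_size d k A 1"
  unfolding has_circuit_iff_ranked ranked_circuit_def
  by (intro exI[of _ "{0}"] exI[of _ "\<lambda>_. Input A"] exI[of _ "\<lambda>_. 0"] exI[of _ "\<lambda>_. A"] exI[of _ 0]) auto

text \<open>Substitution respects sums, products and scalars, so it can be pushed to the input
  gates, whose labels stay affine; the graph and its size do not change.\<close>

lemma has_circuit_subst:
  assumes g: "g \<in> carrier_mat k k" and "has_circuit_of_size d k \<Delta> s"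
  shows "has_circuit_of_size d k (meta_subst g \<Delta>) s"
proof -
  obtain W lab rk val out where *: "ranked_circuit d k W lab rk val" "out \<in> W" "card W = s" "val out = \<Delta>"
    using assms(2) unfolding has_circuit_iff_ranked by blast
  define sub where "sub G = (case G of Input A \<Rightarrow> Input (meta_subst g A) | _ \<Rightarrow> G)" for G
  have src: "sources (sub G) = sources G" for G by (cases G) (auto simp: sub_def)
  have inp: "A \<in> affine_metapolys d k" if "sub G = Input A" "\<forall>A. G = Input A \<longrightarrow> A \<in> affine_metapolys d k" for G A
    using that affine_metapolys_subst[OF g] by (cases G) (auto simp: sub_def)
  have gv: "gate_value (\<lambda>v. meta_subst g (val v)) (sub G) = meta_subst g (gate_value val G)" for G
    by (cases "(val, G)" rule: gate_value.cases) (auto simp: sub_def meta_subst_def mscale_def fun_eq_iff)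
  have "ranked_circuit d k W (\<lambda>v. sub (lab v)) rk (\<lambda>v. meta_subst g (val v))"
    using *(1) unfolding ranked_circuit_def src gv by (auto dest: inp)
  then show ?thesis using * unfolding has_circuit_iff_ranked by blast
qed

lemma has_circuit_combination:
  assumes "has_circuit_of_size d k \<Delta> s" "has_circuit_of_size d k \<Delta>' s'"
  shows "has_circuit_of_size d k (mscale a \<Delta> + mscale b \<Delta>') (s + s' + 1)"
proof -
  obtain W lab rk val out where 1: "ranked_circuit d k W lab rk val" "out \<in> W" "card W = s" "val out = \<Delta>"
    using assms(1) unfolding has_circuit_iff_ranked by blast
  obtain W' lab' rk' val' out' where 2: "ranked_circuit d k W' lab' rk' val'" "out' \<in> W'" "card W' = s'" "val' out' = \<Delta>'"
    using assms(2) unfolding has_circuit_iff_ranked by blast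
  \<comment> \<open>Odd numbers hold the first circuit, positive even numbers the second, and 0 is
    the new output gate.\<close>
  define f where "f v = Suc (2 * v)" for v
  define f' where "f' v = Suc (Suc (2 * v))" for v
  define X where "X = insert 0 (f ` W \<union> f' ` W')"
  define L where "L x = (if x = 0 then Plus (a, f out) (b, f' out') else
    if odd x then relabel f (lab (x div 2)) else relabel f' (lab' (x div 2 - 1)))" for x
  define R where "R x = (if x = 0 then Suc (max (rk out) (rk' out')) else
    if odd x then rk (x div 2) else rk' (x div 2 - 1))" for x
  define val2 where "val2 x = (if x = 0 then mscale a \<Delta> + mscale b \<Delta>' else
    if odd x then val (x div 2) else val' (x div 2 - 1))" for x
  have L: "L 0 = Plus (a, f out) (b, f' out')" "L (f v) = relabel f (lab v)" "L (f' v) = relabel f' (lab' v)" for v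
    by (auto simp: L_def f_def f'_def)
  have R: "R 0 = Suc (max (rk out) (rk' out'))" "R (f v) = rk v" "R (f' v) = rk' v" for v
    by (auto simp: R_def f_def f'_def)
  have val2: "val2 0 = mscale a \<Delta> + mscale b \<Delta>'" "val2 (f v) = val v" "val2 (f' v) = val' v" for v
    by (auto simp: val2_def f_def f'_def)
  have "ranked_circuit d k X L R val2"
    unfolding ranked_circuit_def
  proof (intro conjI ballI)
    show "finite X" using 1 2 by (auto simp: X_def ranked_circuit_def)
    fix x assume "x \<in> X"
    then consider "x = 0" | v where "v \<in> W" "x = f v" | v where "v \<in> W'" "x = f' v" by (auto simp: X_def)
    note cases = this
    have src: "\<And>v u. v \<in> W \<Longrightarrow> u \<in> sources (lab v) \<Longrightarrow> u \<in> W" "\<And>v u. v \<in> W' \<Longrightarrow> u \<in> sources (lab' v) \<Longrightarrow> u \<in> W'"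
      using 1(1) 2(1) unfolding ranked_circuit_def by blast+
    show "sources (L x) \<subseteq> X"
      using cases 1(2) 2(2) by cases (auto simp: L X_def src)
    show "\<forall>A. L x = Input A \<longrightarrow> A \<in> affine_metapolys d k"
      using cases 1(1) 2(1) by cases (auto simp: L ranked_circuit_def)
    show "val2 x = gate_value val2 (L x)"
      using cases
    proof cases
      case 1
      then show ?thesis using \<open>val out = \<Delta>\<close> \<open>val' out' = \<Delta>'\<close> by (simp add: L val2)
    next
      case (2 v)
      then show ?thesis using 1(1) by (simp add: L val2 gate_value_relabel ranked_circuit_def)
    next
      case (3 v)
      then show ?thesis using 2(1) by (simp add: L val2 gate_value_relabel ranked_circuit_def)
    qed
    fix u assume "u \<in> sources (L x)"
    have rks: "\<And>v u. v \<in> W \<Longrightarrow> u \<in> sources (lab v) \<Longrightarrow> rk u < rk v" "\<And>v u. v \<in> W' \<Longrightarrow> u \<in> sources (lab' v) \<Longrightarrow> rk' u < rk' v"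
      using 1(1) 2(1) unfolding ranked_circuit_def by blast+
    show "R u < R x"
      using cases \<open>u \<in> sources (L x)\<close> by cases (auto simp: L R rks less_Suc_eq_le)
  qed
  moreover have "card X = s + s' + 1"
  proof -
    have fin: "finite W" "finite W'" using 1 2 by (auto simp: ranked_circuit_def)
    have "f v \<noteq> f' v'" for v v' unfolding f_def f'_def by presburger
    then have "f ` W \<inter> f' ` W' = {}" by auto
    then have "card (f ` W \<union> f' ` W') = s + s'"
      using fin 1(3) 2(3) by (simp add: card_Un_disjoint card_image inj_on_def f_def f'_def)
    moreover have "0 \<notin> f ` W \<union> f' ` W'" by (auto simp: f_def f'_def)
    ultimately show ?thesis using fin by (simp add: X_def)
  qed
  ultimately show ?thesis
    unfolding has_circuit_iff_ranked using val2(1) by (intro exI[of _ X] exI[of _ L] exI[of _ R] exI[of _ val2] exI[of _ 0]) (simp add: X_def)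
qed

text \<open>Each summand costs its circuit and one addition gate, whose edges carry the scalars; the
  final \<open>+ 1\<close> pays for the zero gate from which the sum starts.\<close>

lemma has_circuit_sum:
  assumes "finite G" "\<And>g. g \<in> G \<Longrightarrow> has_circuit_of_size d k (F g) s"
  shows "\<exists>s'. has_circuit_of_size d k (\<Sum>g\<in>G. mscale (c g) (F g)) s' \<and> s' \<le> card G * (s + 1) + 1"
  using assms
proof (induction G rule: finite_induct)
  case empty
  have "has_circuit_of_size d k 0 1" by (rule has_circuit_affine[OF affine_metapolys_0])
  then show ?case by (intro exI[of _ 1]) (simp add: zero_fun_def)
next
  case (insert g G)
  then obtain s' where s': "has_circuit_of_size d k (\<Sum>g\<in>G. mscale (c g) (F g)) s'" "s' \<le> card G * (s + 1) + 1" by auto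
  have "has_circuit_of_size d k (mscale (c g) (F g) + mscale 1 (\<Sum>g\<in>G. mscale (c g) (F g))) (s + s' + 1)"
    using insert.prems s'(1) by (intro has_circuit_combination) auto
  then show ?case using insert.hyps s'(2) by (intro exI[of _ "s + s' + 1"]) (simp add: plus_fun_def)
qed

section \<open>Semistandard tableaux and interlacing chains\<close>

lemma part_Cons: "part (x # xs) i = (case i of 0 \<Rightarrow> x | Suc j \<Rightarrow> part xs j)"
  by (cases i) (auto simp: part_def)

text \<open>In a weakly decreasing list the zeros form the tail, so deleting them does not change
  the zero-padded entries.\<close>

lemma part_filter:
  assumes "sorted_wrt (\<ge>) (xs :: nat list)"
  shows "part (filter (\<lambda>x. x \<noteq> 0) xs) i = (if i < length xs then xs ! i else 0)"
  using assms
proof (induction xs arbitrary: i)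
  case (Cons x xs)
  show ?case
  proof (cases "x = 0")
    case True
    then have "\<forall>y\<in>set (x # xs). y = 0" using Cons.prems by auto
    then have "filter (\<lambda>x. x \<noteq> 0) (x # xs) = []" "i < length (x # xs) \<Longrightarrow> (x # xs) ! i = 0"
      using nth_mem by (force, blast)
    then show ?thesis by (simp add: part_def)
  next
    case False
    then have "filter (\<lambda>x. x \<noteq> 0) (x # xs) = x # filter (\<lambda>x. x \<noteq> 0) xs" by simp
    then show ?thesis unfolding part_Cons using Cons.IH Cons.prems
      by (simp only: part_Cons split: nat.split) auto
  qed
qed (simp add: part_def)

lemma part_inject:
  assumes "0 \<notin> set lam" "0 \<notin> set lam'" "part lam = part lam'"
  shows "lam = lam'"
proof -
  have "length xs \<le> length ys" if "0 \<notin> set xs" "part xs = part ys" for xs ys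
  proof (rule ccontr)
    assume "\<not> length xs \<le> length ys"
    then have "xs ! length ys = 0" using fun_cong[OF that(2), of "length ys"] by (simp add: part_def)
    then show False using that(1) \<open>\<not> length xs \<le> length ys\<close> nth_mem by (metis not_le)
  qed
  then have len: "length lam = length lam'" using assms by (metis order_antisym)
  show ?thesis
  proof (rule nth_equalityI[OF len])
    show "lam ! i = lam' ! i" if "i < length lam" for i
      using fun_cong[OF assms(3), of i] that len by (simp add: part_def)
  qed
qed

lemma shape_restrict: "shape (restrict_tableau j T) = filter (\<lambda>x. x \<noteq> 0) (map (\<lambda>r. length (filter (\<lambda>a. a \<le> j) r)) T)"
  unfolding shape_def restrict_tableau_def by (induction T) auto

text \<open>In a sorted row the entries at most \<open>j\<close> form an initial segment. This
  translates between entries of a tableau and row lengths of its subtableaux.\<close>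

lemma less_length_filter_sorted:
  assumes "sorted r"
  shows "c < length (filter (\<lambda>a. a \<le> j) r) \<longleftrightarrow> c < length r \<and> r ! c \<le> (j :: nat)"
  using assms
proof (induction r arbitrary: c)
  case (Cons x r)
  show ?case
  proof (cases "x \<le> j")
    case True
    then show ?thesis using Cons by (cases c) auto
  next
    case False
    then have "\<forall>a\<in>set (x # r). \<not> a \<le> j" using Cons.prems by auto
    then have "filter (\<lambda>a. a \<le> j) (x # r) = []" "c < length (x # r) \<Longrightarrow> \<not> (x # r) ! c \<le> j"
      using nth_mem by (force, blast)
    then show ?thesis by simp
  qed
qed simp

lemma semistandardD:
  assumes "T \<in> semistandard k lam"
  shows "shape T = lam" "i < length T \<Longrightarrow> sorted (T ! i)" "i < length T \<Longrightarrow> set (T ! i) \<subseteq> {1..k}"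
    "Suc i < length T \<Longrightarrow> c < length (T ! Suc i) \<Longrightarrow> T ! i ! c < T ! Suc i ! c"
  using assms by (auto simp: semistandard_def)

text \<open>If row \<open>Suc i\<close> had more entries at most \<open>j\<close> than row
  \<open>i\<close>, its box in the first excess column would have an entry at most \<open>j\<close>
  below a box with a larger one, against strict columns.\<close>

lemma sorted_row_counts:
  assumes T: "T \<in> semistandard k lam" and lam: "lam \<in> partitions N k"
  shows "sorted_wrt (\<ge>) (map (\<lambda>r. length (filter (\<lambda>a. a \<le> j) r)) T)"
proof -
  have "length (filter (\<lambda>a. a \<le> j) (T ! Suc i)) \<le> length (filter (\<lambda>a. a \<le> j) (T ! i))" if i: "Suc i < length T" for i
  proof (rule ccontr)
    define c where "c = length (filter (\<lambda>a. a \<le> j) (T ! i))"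
    assume "\<not> length (filter (\<lambda>a. a \<le> j) (T ! Suc i)) \<le> length (filter (\<lambda>a. a \<le> j) (T ! i))"
    then have "c < length (filter (\<lambda>a. a \<le> j) (T ! Suc i))" by (simp add: c_def)
    then have c: "c < length (T ! Suc i)" "T ! Suc i ! c \<le> j"
      using less_length_filter_sorted[OF semistandardD(2)[OF T i]] by auto
    have "lam ! Suc i \<le> lam ! i"
      using lam i semistandardD(1)[OF T] unfolding partitions_def shape_def
      by (auto simp: sorted_wrt_iff_nth_less)
    then have "length (T ! Suc i) \<le> length (T ! i)" using semistandardD(1)[OF T] i by (auto simp: shape_def)
    then have "c < length (filter (\<lambda>a. a \<le> j) (T ! i))"
      using less_length_filter_sorted[OF semistandardD(2)[OF T], of i c j] c i semistandardD(4)[OF T i c(1)] by auto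
    then show False by (simp add: c_def)
  qed
  then show ?thesis by (subst sorted_wrt_iff_nth_Suc_transp) (auto simp: transp_def)
qed

lemma part_shape_restrict:
  assumes "T \<in> semistandard k lam" "lam \<in> partitions N k"
  shows "part (shape (restrict_tableau j T)) i = (if i < length T then length (filter (\<lambda>a. a \<le> j) (T ! i)) else 0)"
  unfolding shape_restrict part_filter[OF sorted_row_counts[OF assms]] by simp

text \<open>Columns increase strictly from an entry at least 1; rows are counted from 0 and entries
  from 1, whence \<open>Suc i\<close>.\<close>

lemma row_entry_ge:
  assumes T: "T \<in> semistandard k lam" and lam: "lam \<in> partitions N k"
  shows "i < length T \<Longrightarrow> c < length (T ! i) \<Longrightarrow> Suc i \<le> T ! i ! c"
proof (induction i)
  case 0
  then have "T ! 0 ! c \<in> {1..k}" using semistandardD(3)[OF T, of 0] nth_mem by blast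
  then show ?case by simp
next
  case (Suc i)
  have "lam ! Suc i \<le> lam ! i"
    using lam Suc.prems semistandardD(1)[OF T] unfolding partitions_def shape_def
    by (auto simp: sorted_wrt_iff_nth_less)
  then have "c < length (T ! i)" using semistandardD(1)[OF T] Suc.prems by (auto simp: shape_def)
  then show ?case using Suc semistandardD(4)[OF T Suc.prems] by auto
qed

lemma part_shape_restrict_0:
  assumes T: "T \<in> semistandard k lam" and lam: "lam \<in> partitions N k" and "j \<le> i"
  shows "part (shape (restrict_tableau j T)) i = 0"
proof (rule ccontr)
  assume "part (shape (restrict_tableau j T)) i \<noteq> 0"
  then have i: "i < length T" "0 < length (filter (\<lambda>a. a \<le> j) (T ! i))"
    by (auto simp: part_shape_restrict[OF T lam] split: if_splits)
  then have "0 < length (T ! i)" "T ! i ! 0 \<le> j"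
    using less_length_filter_sorted[OF semistandardD(2)[OF T i(1)], of 0 j] by auto
  then show False using row_entry_ge[OF T lam i(1), of 0] assms(3) by simp
qed

text \<open>The entry of a box is the least \<open>j\<close> whose subtableau contains it, so the
  chain of shapes determines the tableau. The condition \<open>i < j\<close> is kept because
  orthogonality under \<open>GL j\<close> compares only the first \<open>j\<close> parts.\<close>

lemma tableau_chain_inject:
  assumes S: "S \<in> tableaux N k" and T: "T \<in> tableaux N k" and k: "k \<ge> 1" and "S \<noteq> T"
  obtains j i where "j \<in> {1..k}" "i < j" "part (shape (restrict_tableau j S)) i \<noteq> part (shape (restrict_tableau j T)) i"
proof -
  obtain lam where S: "S \<in> semistandard k lam" "lam \<in> partitions N k" using S by (auto simp: tableaux_def)
  obtain lam' where T: "T \<in> semistandard k lam'" "lam' \<in> partitions N k" using T by (auto simp: tableaux_def)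
  have "\<exists>j\<in>{1..k}. \<exists>i<j. part (shape (restrict_tableau j S)) i \<noteq> part (shape (restrict_tableau j T)) i"
  proof (rule ccontr)
    assume "\<not> (\<exists>j\<in>{1..k}. \<exists>i<j. part (shape (restrict_tableau j S)) i \<noteq> part (shape (restrict_tableau j T)) i)"
    then have eq: "part (shape (restrict_tableau j S)) i = part (shape (restrict_tableau j T)) i" if "j \<in> {1..k}" for i j
      using that part_shape_restrict_0[OF S, of j i] part_shape_restrict_0[OF T, of j i] by (cases "i < j") auto
    have full: "part (shape (restrict_tableau k Z)) = part nu" if Z: "Z \<in> semistandard k nu" "nu \<in> partitions N k" for Z nu
    proof
      fix i
      have "filter (\<lambda>a. a \<le> k) (Z ! i) = Z ! i" if "i < length Z"
        using semistandardD(3)[OF Z(1) that] by (intro filter_True) auto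
      moreover have "nu = map length Z" using semistandardD(1)[OF Z(1)] by (simp add: shape_def)
      ultimately show "part (shape (restrict_tableau k Z)) i = part nu i"
        unfolding part_shape_restrict[OF Z] by (simp add: part_def)
    qed
    have "part (shape (restrict_tableau k S)) = part (shape (restrict_tableau k T))"
      by (rule ext, rule eq) (use k in simp)
    then have "part lam = part lam'" using full[OF S] full[OF T] by simp
    then have lam: "lam = lam'" using S T by (intro part_inject) (auto simp: partitions_def)
    have shape: "map length S = map length T" using lam semistandardD(1)[OF S(1)] semistandardD(1)[OF T(1)] by (simp add: shape_def)
    then have len: "length S = length T" by (metis length_map)
    have rl: "length (S ! i) = length (T ! i)" if "i < length S" for i
      using that len shape by (metis nth_map)
    \<comment> \<open>A box belongs to the subtableau of \<open>Z\<close> cut at its own entry,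
      hence to that of \<open>Y\<close>, which bounds the entry of \<open>Y\<close>. Both directions
      together give equality.\<close>
    have le: "Y ! i ! c \<le> Z ! i ! c"
      if Y: "Y \<in> semistandard k nu" "nu \<in> partitions N k" and Z: "Z \<in> semistandard k nu'" "nu' \<in> partitions N k"
        and e: "\<And>i j. j \<in> {1..k} \<Longrightarrow> part (shape (restrict_tableau j Y)) i = part (shape (restrict_tableau j Z)) i"
        and i: "i < length Y" "i < length Z" "c < length (Y ! i)" "c < length (Z ! i)" for Y Z nu nu' i c
    proof -
      let ?j = "Z ! i ! c"
      have j: "?j \<in> {1..k}" using semistandardD(3)[OF Z(1) i(2)] i(4) nth_mem by blast
      have "c < length (filter (\<lambda>a. a \<le> ?j) (Z ! i))"
        using less_length_filter_sorted[OF semistandardD(2)[OF Z(1) i(2)]] i by simp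
      also have "\<dots> = length (filter (\<lambda>a. a \<le> ?j) (Y ! i))"
        using e[OF j, of i] i by (simp add: part_shape_restrict[OF Y] part_shape_restrict[OF Z])
      finally show ?thesis
        using less_length_filter_sorted[OF semistandardD(2)[OF Y(1) i(1)]] by simp
    qed
    have "S = T"
    proof (rule nth_equalityI[OF len])
      fix i assume i: "i < length S"
      show "S ! i = T ! i"
      proof (rule nth_equalityI[OF rl[OF i]])
        fix c assume c: "c < length (S ! i)"
        show "S ! i ! c = T ! i ! c"
          using le[OF S T eq, of i c] le[OF T S eq[symmetric], of i c] i c len rl[OF i] by auto
      qed
    qed
    then show False using assms(4) by simp
  qed
  then show ?thesis using that by blast
qed

definition list_of :: "nat \<Rightarrow> (nat \<Rightarrow> nat) \<Rightarrow> nat list" where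
  "list_of n \<mu> = filter (\<lambda>x. x \<noteq> 0) (map \<mu> [0..<n])"

lemma part_list_of:
  assumes "\<And>i. Suc i < n \<Longrightarrow> \<mu> (Suc i) \<le> \<mu> i" "\<And>i. n \<le> i \<Longrightarrow> \<mu> i = 0"
  shows "part (list_of n \<mu>) = \<mu>"
proof
  fix i
  have "sorted_wrt (\<ge>) (map \<mu> [0..<n])"
    using assms(1) by (subst sorted_wrt_iff_nth_Suc_transp) (auto simp: transp_def)
  from part_filter[OF this, of i] show "part (list_of n \<mu>) i = \<mu> i"
    using assms(2) by (auto simp: list_of_def)
qed

lemma list_of_partition:
  assumes "\<And>i. Suc i < n \<Longrightarrow> \<mu> (Suc i) \<le> \<mu> i"
  shows "list_of n \<mu> \<in> partitions (\<Sum>i<n. \<mu> i) n"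
proof -
  have "sorted_wrt (\<ge>) (map \<mu> [0..<n])"
    using assms by (subst sorted_wrt_iff_nth_Suc_transp) (auto simp: transp_def)
  then have "sorted_wrt (\<ge>) (list_of n \<mu>)" unfolding list_of_def by (rule sorted_wrt_filter)
  moreover have "sum_list (filter (\<lambda>x. x \<noteq> 0) xs) = sum_list xs" for xs :: "nat list" by (induction xs) auto
  then have "sum_list (list_of n \<mu>) = (\<Sum>i<n. \<mu> i)"
    by (simp add: list_of_def interv_sum_list_conv_sum_set_nat atLeast0LessThan)
  moreover have "length (list_of n \<mu>) \<le> n" unfolding list_of_def by (rule order_trans[OF length_filter_le]) simp
  ultimately show ?thesis by (simp add: partitions_def list_of_def)
qed

text \<open>The passage from a Gelfand-Tsetlin pattern to a tableau: growth of the shapes lets each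
  box be filled with the level at which it appears, and interlacing makes the columns
  strict.\<close>

lemma tableau_of_chain:
  fixes c :: "nat \<Rightarrow> nat \<Rightarrow> nat"
  assumes c0: "\<And>i. c 0 i = 0" and mono: "\<And>j i. j < k \<Longrightarrow> c j i \<le> c (Suc j) i"
    and inter: "\<And>j i. j < k \<Longrightarrow> c (Suc j) (Suc i) \<le> c j i" and zero: "\<And>i. k \<le> i \<Longrightarrow> c k i = 0"
    and k: "k \<ge> 1"
  obtains T where "T \<in> tableaux (\<Sum>i<k. c k i) k" "\<And>j. j \<le> k \<Longrightarrow> part (shape (restrict_tableau j T)) = c j"
proof -
  have mono': "c j i \<le> c j' i" if "j \<le> j'" "j' \<le> k" for j j' i
    using that by (induction rule: dec_induct) (auto intro: order_trans[OF _ mono])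
  have dec: "c k (Suc i) \<le> c k i" for i
    using inter[of "k - 1" i] mono[of "k - 1" i] k by simp
  define lam where "lam = list_of k (c k)"
  have plam: "part lam = c k" unfolding lam_def by (rule part_list_of) (use dec zero in auto)
  have lamp: "lam \<in> partitions (\<Sum>i<k. c k i) k" unfolding lam_def by (rule list_of_partition) (use dec in auto)
  have lami: "lam ! i = c k i" if "i < length lam" for i using fun_cong[OF plam, of i] that by (simp add: part_def)
  define e where "e i x = (LEAST j. x < c j i)" for i x
  have e_iff: "e i x \<le> j \<longleftrightarrow> x < c j i" if "x < c k i" "j \<le> k" for i x j
  proof
    have "x < c (e i x) i" unfolding e_def by (rule LeastI[of _ k]) (rule that)
    moreover assume "e i x \<le> j"
    ultimately show "x < c j i" using mono'[of "e i x" j i] that by simp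
  qed (simp add: e_def Least_le)
  have e_in: "e i x \<in> {1..k}" if "x < c k i" for i x
    using e_iff[OF that, of 0] e_iff[OF that, of k] that c0 by auto
  define T where "T = map (\<lambda>i. map (e i) [0..<c k i]) [0..<length lam]"
  have T_len: "length T = length lam" by (simp add: T_def)
  have T_row: "T ! i = map (e i) [0..<c k i]" if "i < length lam" for i using that by (simp add: T_def)
  have srt: "sorted (map (e i) [0..<c k i])" for i
  proof (rule sorted_iff_nth_mono[THEN iffD2], intro allI impI)
    fix x y assume xy: "x \<le> y" "y < length (map (e i) [0..<c k i])"
    then have y: "y < c k i" by simp
    have "e i y \<le> k" using e_in[OF y] by simp
    then have "y < c (e i y) i" using e_iff[OF y] by blast
    then have "e i x \<le> e i y" using e_iff[of x i "e i y"] xy y \<open>e i y \<le> k\<close> by simp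
    then show "map (e i) [0..<c k i] ! x \<le> map (e i) [0..<c k i] ! y" using xy by simp
  qed
  have T: "T \<in> semistandard k lam"
    unfolding semistandard_def
  proof (intro CollectI conjI allI impI ballI)
    show "shape T = lam" using lami T_row T_len by (intro nth_equalityI) (auto simp: shape_def)
    fix r assume "r \<in> set T"
    then obtain i where i: "r = map (e i) [0..<c k i]" by (auto simp: T_def)
    show "sorted r" using srt i by simp
    show "set r \<subseteq> {1..k}" using e_in i by auto
  next
    fix i x assume ix: "Suc i < length T \<and> x < length (T ! Suc i)"
    then have x: "x < c k (Suc i)" "i < length lam" "Suc i < length lam" using T_row T_len by auto
    then have xi: "x < c k i" using dec[of i] by simp
    obtain j where j: "e (Suc i) x = Suc j" "Suc j \<le> k" using e_in[OF x(1)] by (cases "e (Suc i) x") auto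
    then have "x < c (Suc j) (Suc i)" using e_iff[OF x(1), of "Suc j"] by simp
    \<comment> \<open>Interlacing puts the box above into the shape one level earlier, so its entry
      is strictly smaller.\<close>
    then have "x < c j i" using inter[of j i] j by simp
    then have "e i x \<le> j" using e_iff[OF xi, of j] j by simp
    then show "T ! i ! x < T ! Suc i ! x" using x xi j T_row by simp
  qed
  show ?thesis
  proof (rule that[of T])
    show "T \<in> tableaux (\<Sum>i<k. c k i) k" using T lamp by (auto simp: tableaux_def)
    fix j assume j: "j \<le> k"
    show "part (shape (restrict_tableau j T)) = c j"
    proof
      fix i
      show "part (shape (restrict_tableau j T)) i = c j i"
      proof (cases "i < length lam")
        case True
        have "x < length (filter (\<lambda>a. a \<le> j) (T ! i)) \<longleftrightarrow> x < c j i" for x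
          using less_length_filter_sorted[OF srt, of x j i] T_row[OF True] e_iff[of x i j] j mono'[of j k i] by auto
        then have "length (filter (\<lambda>a. a \<le> j) (T ! i)) = c j i" by (metis linorder_neqE_nat less_irrefl)
        then show ?thesis using True by (simp add: part_shape_restrict[OF T lamp] T_len)
      next
        case False
        then have "c k i = 0" using fun_cong[OF plam, of i] by (simp add: part_def)
        then show ?thesis using False mono'[of j k i] j by (simp add: part_shape_restrict[OF T lamp] T_len)
      qed
    qed
  qed
qed

lemma superstandard_semistandard:
  assumes "lam \<in> partitions N k"
  shows "superstandard lam \<in> semistandard k lam"
  unfolding semistandard_def
proof (intro CollectI conjI allI impI ballI)
  show "shape (superstandard lam) = lam" by (rule nth_equalityI) (auto simp: shape_def superstandard_def)
  fix r assume "r \<in> set (superstandard lam)"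
  then obtain i where i: "i < length lam" "r = replicate (lam ! i) (Suc i)" by (auto simp: superstandard_def)
  show "sorted r" using i by simp
  show "set r \<subseteq> {1..k}" using i assms by (auto simp: partitions_def)
next
  fix i j assume ij: "Suc i < length (superstandard lam) \<and> j < length (superstandard lam ! Suc i)"
  then have i: "Suc i < length lam" "j < lam ! Suc i" by (auto simp: superstandard_def)
  have "lam ! Suc i \<le> lam ! i" using assms i by (auto simp: partitions_def sorted_wrt_iff_nth_less)
  then show "superstandard lam ! i ! j < superstandard lam ! Suc i ! j" using i by (simp add: superstandard_def)
qed

lemma part_shape_superstandard:
  assumes "lam \<in> partitions N k"
  shows "part (shape (restrict_tableau j (superstandard lam))) i = (if i < j then part lam i else 0)"
  unfolding part_shape_restrict[OF superstandard_semistandard[OF assms] assms]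
  by (auto simp: superstandard_def part_def)

section \<open>Isotypic decompositions of metapolynomials\<close>

lemma GL_iff_Units: "g \<in> GL n \<longleftrightarrow> g \<in> Units (ring_mat TYPE(complex) n b)"
proof
  assume "g \<in> GL n"
  then obtain B where g: "g \<in> carrier_mat n n" and B: "g * B = 1\<^sub>m n" "B * g = 1\<^sub>m (dim_row B)"
    by (auto simp: GL_def invertible_mat_def inverts_mat_def)
  have "dim_col B = n" using arg_cong[OF B(1), of dim_col] by simp
  moreover have "dim_row B = n" using arg_cong[OF B(2), of dim_col] g by simp
  ultimately show "g \<in> Units (ring_mat TYPE(complex) n b)"
    using g B by (auto simp: Units_def ring_mat_simps intro!: bexI[of _ B])
next
  assume "g \<in> Units (ring_mat TYPE(complex) n b)"
  then obtain B where "g \<in> carrier_mat n n" "B \<in> carrier_mat n n" "g * B = 1\<^sub>m n" "B * g = 1\<^sub>m n"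
    by (auto simp: Units_def ring_mat_simps)
  then show "g \<in> GL n" by (auto simp: GL_def invertible_mat_def inverts_mat_def intro!: exI[of _ B])
qed

lemma GL_iff_det: "g \<in> carrier_mat n n \<Longrightarrow> g \<in> GL n \<longleftrightarrow> det g \<noteq> 0"
  using det_non_zero_imp_unit[of g n "()"] unit_imp_det_non_zero[of g n "()"] GL_iff_Units[of g n "()"] by auto

lemma mat_inv_inverse:
  assumes "g \<in> GL n"
  shows "mat_inv g \<in> carrier_mat n n" "g * mat_inv g = 1\<^sub>m n" "mat_inv g * g = 1\<^sub>m n"
proof -
  have g: "g \<in> carrier_mat n n" using assms by (simp add: GL_def)
  obtain B where B: "mat_inverse g = Some B"
    using mat_inverse(1)[OF g, of "()"] assms GL_iff_Units[of g n "()"] by (cases "mat_inverse g") auto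
  then show "mat_inv g \<in> carrier_mat n n" "g * mat_inv g = 1\<^sub>m n" "mat_inv g * g = 1\<^sub>m n"
    using mat_inverse(2)[OF g B] by (auto simp: mat_inv_def)
qed

lemma mat_inv_mat_inv:
  assumes "g \<in> GL n"
  shows "mat_inv (mat_inv g) = g"
proof -
  define h where "h = mat_inv g"
  have g: "g \<in> carrier_mat n n" using assms by (simp add: GL_def)
  have h: "h \<in> carrier_mat n n" "g * h = 1\<^sub>m n" "h * g = 1\<^sub>m n" using mat_inv_inverse[OF assms] by (auto simp: h_def)
  then have "h \<in> GL n" using g by (auto simp: GL_def invertible_mat_def inverts_mat_def intro!: exI[of _ g])
  then have i: "mat_inv h \<in> carrier_mat n n" "h * mat_inv h = 1\<^sub>m n" using mat_inv_inverse by auto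
  have "g = g * (h * mat_inv h)" unfolding i(2) using g by simp
  also have "\<dots> = (g * h) * mat_inv h" by (rule assoc_mult_mat[OF g h(1) i(1), symmetric])
  also have "\<dots> = mat_inv h" unfolding h(2) using i(1) by simp
  finally show ?thesis by (simp add: h_def)
qed

lemma meta_act_GL: "g \<in> GL n \<Longrightarrow> meta_act g \<Delta> = meta_subst g \<Delta>"
  by (simp add: meta_act_def meta_subst_def poly_act_def mat_inv_mat_inv)

lemma upper_triangular_GL_iff:
  assumes "g \<in> carrier_mat n n" "upper_triangular g"
  shows "g \<in> GL n \<longleftrightarrow> (\<forall>i<n. g $$ (i, i) \<noteq> 0)"
  using assms by (auto simp: GL_iff_det det_upper_triangular[OF assms(2,1)] prod_list_diag_prod)

lemma polyfun_det:
  assumes "A \<in> carrier_mat n n" "B \<in> carrier_mat n n"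
  shows "polyfun (\<lambda>s. det (A + s \<cdot>\<^sub>m B))"
proof -
  have "det (A + s \<cdot>\<^sub>m B) = (\<Sum>p\<in>{p. p permutes {0..<n}}. signof p * (\<Prod>i=0..<n. A $$ (i, p i) + s * B $$ (i, p i)))" for s
  proof -
    have "A + s \<cdot>\<^sub>m B \<in> carrier_mat n n" using assms by auto
    moreover have "p i < n" if "p permutes {0..<n}" "i < n" for p i using permutes_in_image[OF that(1), of i] that by simp
    ultimately show ?thesis unfolding det_def'[OF \<open>A + s \<cdot>\<^sub>m B \<in> carrier_mat n n\<close>] using assms
      by (intro sum.cong refl arg_cong2[where f = "(*)"] prod.cong) auto
  qed
  then show ?thesis by (simp add: polyfun_intros)
qed

lemma finite_singular_shifts:
  assumes g: "g \<in> carrier_mat n n"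
  shows "finite {s. g + s \<cdot>\<^sub>m 1\<^sub>m n \<notin> GL n}"
proof -
  have one: "1\<^sub>m n \<in> carrier_mat n n" by simp
  \<comment> \<open>The determinant of \<open>g + s \<cdot>\<^sub>m 1\<^sub>m n\<close> must be
    shown nonzero for some \<open>s\<close>. The reversed family
    \<open>1\<^sub>m n + r \<cdot>\<^sub>m g\<close> is invertible at \<open>r = 0\<close>, hence at
    some nonzero \<open>r\<close>, and \<open>s = inverse r\<close> works.\<close>
  have "finite {r. det (1\<^sub>m n + r \<cdot>\<^sub>m g) = 0}"
  proof (rule polyfun_finite_zeros[OF polyfun_det[OF one g], of 0])
    have "1\<^sub>m n + 0 \<cdot>\<^sub>m g = 1\<^sub>m n" using g by (intro eq_matI) auto
    then show "det (1\<^sub>m n + 0 \<cdot>\<^sub>m g) \<noteq> 0" by simp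
  qed
  then have "finite (insert 0 {r. det (1\<^sub>m n + r \<cdot>\<^sub>m g) = 0})" by simp
  then obtain r where r: "r \<noteq> 0" "det (1\<^sub>m n + r \<cdot>\<^sub>m g) \<noteq> 0"
    using ex_new_if_finite[OF infinite_UNIV_char_0[where 'a = complex]] by blast
  have "g + inverse r \<cdot>\<^sub>m 1\<^sub>m n = inverse r \<cdot>\<^sub>m (1\<^sub>m n + r \<cdot>\<^sub>m g)"
    using g r by (intro eq_matI) (auto simp: field_simps)
  then have "det (g + inverse r \<cdot>\<^sub>m 1\<^sub>m n) \<noteq> 0" using r by (simp add: det_smult)
  then have "finite {s. det (g + s \<cdot>\<^sub>m 1\<^sub>m n) = 0}"
    by (rule polyfun_finite_zeros[OF polyfun_det[OF g one]])
  moreover have "{s. g + s \<cdot>\<^sub>m 1\<^sub>m n \<notin> GL n} = {s. det (g + s \<cdot>\<^sub>m 1\<^sub>m n) = 0}"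
    using g by (auto simp: GL_iff_det)
  ultimately show ?thesis by simp
qed

text \<open>Let \<open>z\<close> be the part of \<open>act g u\<close> orthogonal to
  \<open>U\<close>. Pairing \<open>z\<close> with the image of \<open>u\<close> under
  \<open>g + s \<cdot>\<^sub>m 1\<^sub>m n\<close> gives a polynomial in \<open>s\<close> that
  vanishes whenever the matrix is invertible, hence also at \<open>s = 0\<close>.\<close>

lemma (in unitary_rep) stable_of_GL:
  assumes U: "subspace U" "U \<subseteq> V" and GL: "\<And>g u. g \<in> GL n \<Longrightarrow> u \<in> U \<Longrightarrow> act g u \<in> U"
  shows "stable U"
  unfolding stable_def
proof (intro conjI ballI U)
  fix g :: "complex mat" and u assume g: "g \<in> carrier_mat n n" and u: "u \<in> U"
  have uV: "u \<in> V" using u U by blast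
  obtain y where y: "y \<in> U" "\<forall>x\<in>U. ip (act g u - y) x = 0" using orth_proj[OF U act_in[OF g uV]] by blast
  define z where "z = act g u - y"
  have yV: "y \<in> V" using y U by blast
  have zV: "z \<in> V" using act_in[OF g uV] yV by (simp add: z_def V_closed)
  have orth: "ip x z = 0" if "x \<in> U" for x
    using y that zV U ip_0_commute[of z x] unfolding z_def by blast
  have "{s. ip (act (g + s \<cdot>\<^sub>m 1\<^sub>m n) u) z \<noteq> 0} \<subseteq> {s. g + s \<cdot>\<^sub>m 1\<^sub>m n \<notin> GL n}"
    using GL[OF _ u] orth by blast
  then have "finite {s. ip (act (g + s \<cdot>\<^sub>m 1\<^sub>m n) u) z \<noteq> 0}"
    using finite_singular_shifts[OF g] by (rule finite_subset)
  then have "ip (act (g + 0 \<cdot>\<^sub>m 1\<^sub>m n) u) z = 0"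
    by (rule polyfun_eq_0[OF polyfun_ip_act[OF uV zV g one_carrier_mat]])
  moreover have "g + 0 \<cdot>\<^sub>m 1\<^sub>m n = g" using g by (intro eq_matI) auto
  ultimately have "ip (act g u) z = 0" by simp
  then have "ip z z = 0" using ip_diff[OF act_in[OF g uV] yV zV] orth[OF y(1)] by (simp add: z_def)
  then have "z = 0" using zV ip_definite by blast
  then show "act g u \<in> U" using y by (simp add: z_def)
qed

lemma (in unitary_rep) hw_cong:
  assumes "\<And>i. i < n \<Longrightarrow> \<mu> i = \<nu> i"
  shows "hw \<mu> v \<longleftrightarrow> hw \<nu> v"
proof -
  have "(\<Prod>i<n. g $$ (i, i) ^ \<mu> i) = (\<Prod>i<n. g $$ (i, i) ^ \<nu> i)" for g :: "complex mat"
    by (intro prod.cong) (auto simp: assms)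
  then show ?thesis by (simp add: hw_def)
qed

lemma (in unitary_rep) comp_cong: "(\<And>i. i < n \<Longrightarrow> \<mu> i = \<nu> i) \<Longrightarrow> comp \<mu> = comp \<nu>"
  unfolding comp_def using hw_cong[of \<mu> \<nu>] by simp

text \<open>The size is left free: for \<open>n < k\<close> the \<open>GL n\<close>-components of a
  metapolynomial of fixed format have various degrees.\<close>

definition bounded_parts :: "nat \<Rightarrow> nat list set" where
  "bounded_parts n = {lam. lam \<in> partitions (sum_list lam) n}"

lemma part_beyond: "lam \<in> partitions N n \<Longrightarrow> n \<le> i \<Longrightarrow> part lam i = 0"
  by (auto simp: partitions_def part_def)

lemma sum_part: "lam \<in> partitions N n \<Longrightarrow> (\<Sum>i<n. part lam i) = N"
proof -
  assume lam: "lam \<in> partitions N n"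
  have "(\<Sum>i<n. part lam i) = (\<Sum>i<length lam. part lam i)"
    using lam by (intro sum.mono_neutral_right) (auto simp: partitions_def part_def)
  also have "\<dots> = sum_list lam" by (simp add: part_def sum_list_sum_nth atLeast0LessThan)
  finally show ?thesis using lam by (simp add: partitions_def)
qed

section \<open>The chain of subgroups acting on metapolynomials\<close>

locale metapoly_reps =
  fixes \<delta> d k :: nat and q :: "metapoly \<Rightarrow> metapoly \<Rightarrow> complex"
  assumes k_pos: "k \<ge> 1" and N_pos: "d * \<delta> > 0"
    and reps: "\<And>n. n \<le> k \<Longrightarrow> unitary_rep mscale (metapolys \<delta> d k) q meta_subst n (d * \<delta>)"
begin

abbreviation "V \<equiv> metapolys \<delta> d k"

sublocale R: unitary_rep mscale V q meta_subst k "d * \<delta>"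
  by (rule reps) simp

text \<open>Stability with the level \<open>n\<close> as an argument, so that different levels can
  be compared as in \<open>stab_mono\<close>.\<close>

definition stab :: "nat \<Rightarrow> metapoly set \<Rightarrow> bool" where
  "stab n U \<longleftrightarrow> meta.subspace U \<and> U \<subseteq> V \<and> (\<forall>g\<in>carrier_mat n n. \<forall>u\<in>U. meta_subst g u \<in> U)"

lemma stable_stab: "n \<le> k \<Longrightarrow> unitary_rep.stable mscale V meta_subst n U \<longleftrightarrow> stab n U"
  unfolding stab_def using unitary_rep.stable_def[OF reps] by blast

lemma meta_subst_emb: "g \<in> carrier_mat m m \<Longrightarrow> m \<le> n \<Longrightarrow> meta_subst (emb n g) \<Delta> = meta_subst g \<Delta>"
  by (simp add: meta_subst_def subst_linear_emb)

lemma stab_mono: "m \<le> n \<Longrightarrow> stab n U \<Longrightarrow> stab m U"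
  unfolding stab_def using meta_subst_emb emb_carrier by metis

lemma stab_Int: "stab n U \<Longrightarrow> stab n W \<Longrightarrow> stab n (U \<inter> W)"
  by (auto simp: stab_def meta.subspace_inter)

lemma GL_stable_iff:
  assumes "n \<le> k" "U \<subseteq> V"
  shows "GL_stable_subspace n U \<longleftrightarrow> stab n U"
proof
  assume *: "GL_stable_subspace n U"
  have "unitary_rep.stable mscale V meta_subst n U"
    by (rule unitary_rep.stable_of_GL[OF reps[OF assms(1)]])
      (use * assms(2) in \<open>auto simp: GL_stable_subspace_def simp flip: meta_act_GL\<close>)
  then show "stab n U" using stable_stab assms by blast
next
  assume "stab n U"
  then show "GL_stable_subspace n U"
    by (auto simp: stab_def GL_stable_subspace_def meta_act_GL) (simp add: GL_def)
qed

lemma hw_iff: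
  assumes "n \<le> k" "\<Delta> \<in> V"
  shows "highest_weight_vector n lam \<Delta> \<longleftrightarrow> unitary_rep.hw mscale V meta_subst n (part lam) \<Delta>"
proof -
  have "highest_weight_vector n lam \<Delta> \<longleftrightarrow> (\<forall>g\<in>carrier_mat n n. upper_triangular g \<longrightarrow> (\<forall>i<n. g $$ (i, i) \<noteq> 0) \<longrightarrow>
      meta_subst g \<Delta> = mscale (\<Prod>i<n. g $$ (i, i) ^ part lam i) \<Delta>)"
    unfolding highest_weight_vector_def using upper_triangular_GL_iff meta_act_GL
    by (metis (no_types, lifting) GL_def mem_Collect_eq)
  then show ?thesis using unitary_rep.hw_def[OF reps[OF assms(1)]] assms(2) by simp
qed

text \<open>An irreducible subspace is the cyclic module of any nonzero highest weight vector in it;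
  conversely \<open>cyc_irreducible\<close> makes each cyclic module of a nonzero highest weight
  vector irreducible.\<close>

lemma isotypic_eq:
  assumes n: "n \<le> k"
  shows "isotypic n \<delta> d k lam = unitary_rep.comp mscale V meta_subst n (part lam)"
proof -
  interpret S: unitary_rep mscale V q meta_subst n "d * \<delta>" by (rule reps[OF n])
  let ?F = "\<Union>{U. U \<subseteq> V \<and> GL_irreducible n U \<and> (\<exists>\<Delta>\<in>U. \<Delta> \<noteq> 0 \<and> highest_weight_vector n lam \<Delta>)}"
  have "?F \<subseteq> S.comp (part lam)"
  proof clarify
    fix x U \<Delta> assume U: "U \<subseteq> V" "GL_irreducible n U" "\<Delta> \<in> U" "\<Delta> \<noteq> 0" "highest_weight_vector n lam \<Delta>" and x: "x \<in> U"
    have \<Delta>V: "\<Delta> \<in> V" using U by blast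
    have hw: "S.hw (part lam) \<Delta>" using U hw_iff[OF n \<Delta>V] by simp
    have sU: "S.stable U" using U GL_stable_iff[OF n U(1)] stable_stab[OF n] by (simp add: GL_irreducible_def)
    have "S.cyc \<Delta> \<subseteq> U" by (rule S.cyc_least[OF sU U(3)])
    moreover have "GL_stable_subspace n (S.cyc \<Delta>)"
      using S.cyc_stable[OF \<Delta>V] stable_stab[OF n] GL_stable_iff[OF n] S.stableD(2) by blast
    ultimately have "S.cyc \<Delta> = {0} \<or> S.cyc \<Delta> = U" using U(2) unfolding GL_irreducible_def by blast
    then have "S.cyc \<Delta> = U" using S.cyc_self[OF \<Delta>V] U(4) by blast
    then show "x \<in> S.comp (part lam)" using S.cyc_in_comp[OF hw] x by blast
  qed
  then have "isotypic n \<delta> d k lam \<subseteq> S.comp (part lam)"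
    unfolding isotypic_def using S.stableD(1)[OF S.comp_stable] by (rule meta.span_minimal)
  moreover have "S.comp (part lam) \<subseteq> isotypic n \<delta> d k lam"
    unfolding S.comp_def
  proof (rule meta.span_minimal)
    show "meta.subspace (isotypic n \<delta> d k lam)" by (simp add: isotypic_def)
    show "{meta_subst g v |g v. g \<in> carrier_mat n n \<and> S.hw (part lam) v} \<subseteq> isotypic n \<delta> d k lam"
    proof clarify
      fix g :: "complex mat" and v assume g: "g \<in> carrier_mat n n" and v: "S.hw (part lam) v"
      have vV: "v \<in> V" using S.hw_V[OF v] .
      show "meta_subst g v \<in> isotypic n \<delta> d k lam"
      proof (cases "v = 0")
        case True
        then show ?thesis using S.act_0[OF g] meta.span_zero by (simp add: isotypic_def)
      next
        case False
        have cV: "S.cyc v \<subseteq> V" using S.stableD(2)[OF S.cyc_stable[OF vV]] .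
        have "GL_irreducible n (S.cyc v)"
          unfolding GL_irreducible_def
        proof (intro conjI allI impI)
          show "GL_stable_subspace n (S.cyc v)"
            using S.cyc_stable[OF vV] stable_stab[OF n] GL_stable_iff[OF n cV] by blast
          show "S.cyc v \<noteq> {0}" using S.cyc_self[OF vV] False by blast
          fix U' assume "GL_stable_subspace n U' \<and> U' \<subseteq> S.cyc v"
          then show "U' = {0} \<or> U' = S.cyc v"
            using S.cyc_irreducible[OF v False, of U'] GL_stable_iff[OF n, of U'] stable_stab[OF n, of U'] cV by blast
        qed
        then have "S.cyc v \<subseteq> ?F" using cV v False S.cyc_self[OF vV] hw_iff[OF n vV] by blast
        moreover have "meta_subst g v \<in> S.cyc v"
          using S.stableD(3)[OF S.cyc_stable[OF vV] g S.cyc_self[OF vV]] .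
        ultimately show ?thesis unfolding isotypic_def by (intro meta.span_base) blast
      qed
    qed
  qed
  ultimately show ?thesis by blast
qed

lemma isotypic_cong:
  assumes "n \<le> k" "\<And>i. i < n \<Longrightarrow> part lam i = part lam' i"
  shows "isotypic n \<delta> d k lam = isotypic n \<delta> d k lam'"
  unfolding isotypic_eq[OF assms(1)] by (rule unitary_rep.comp_cong[OF reps[OF assms(1)] assms(2)])

lemma isotypic_stab: "n \<le> k \<Longrightarrow> stab n (isotypic n \<delta> d k lam)"
  using unitary_rep.comp_stable[OF reps] stable_stab isotypic_eq by simp

lemma isotypic_V: "n \<le> k \<Longrightarrow> isotypic n \<delta> d k lam \<subseteq> V"
  using isotypic_stab by (auto simp: stab_def)

lemma isotypic_orth:
  "n \<le> k \<Longrightarrow> i < n \<Longrightarrow> part lam i \<noteq> part lam' i \<Longrightarrow> x \<in> isotypic n \<delta> d k lam \<Longrightarrow> y \<in> isotypic n \<delta> d k lam' \<Longrightarrow> q x y = 0"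
  using unitary_rep.comp_orth[OF reps] isotypic_eq by simp

lemma isotypic_decomposition:
  assumes n: "n \<le> k" and U: "stab n U" and x: "x \<in> U"
  shows "x \<in> meta.span (\<Union>lam\<in>bounded_parts n. U \<inter> isotypic n \<delta> d k lam)"
proof -
  interpret S: unitary_rep mscale V q meta_subst n "d * \<delta>" by (rule reps[OF n])
  have "x \<in> meta.span (\<Union>\<mu>\<in>doms n (d * \<delta>). U \<inter> S.comp \<mu>)"
    using S.stable_decomposition[OF _ x] U stable_stab[OF n] by blast
  moreover have "(\<Union>\<mu>\<in>doms n (d * \<delta>). U \<inter> S.comp \<mu>) \<subseteq> (\<Union>lam\<in>bounded_parts n. U \<inter> isotypic n \<delta> d k lam)"
  proof clarify
    fix y \<mu> assume \<mu>: "\<mu> \<in> doms n (d * \<delta>)" and y: "y \<in> U" "y \<in> S.comp \<mu>"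
    have p: "part (list_of n \<mu>) = \<mu>" by (rule part_list_of) (use \<mu> in \<open>auto simp: doms_def wts_def\<close>)
    have "list_of n \<mu> \<in> partitions (\<Sum>i<n. \<mu> i) n" by (rule list_of_partition) (use \<mu> in \<open>auto simp: doms_def\<close>)
    then have "list_of n \<mu> \<in> bounded_parts n" by (auto simp: bounded_parts_def partitions_def)
    then show "y \<in> (\<Union>lam\<in>bounded_parts n. U \<inter> isotypic n \<delta> d k lam)"
      using y p isotypic_eq[OF n, of "list_of n \<mu>"] by auto
  qed
  ultimately show ?thesis using meta.span_mono by blast
qed

lemma isotypic_scalar:
  "n \<le> k \<Longrightarrow> x \<in> isotypic n \<delta> d k lam \<Longrightarrow> t \<noteq> 0 \<Longrightarrow> meta_subst (dg n (\<lambda>_. t)) x = mscale (t ^ (\<Sum>i<n. part lam i)) x"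
  using unitary_rep.comp_scalar[OF reps] isotypic_eq by simp

text \<open>The intersection of the two components is stable under the smaller group, so it contains
  a nonzero highest weight vector \<open>v\<close> for that group, of weight \<open>lam'\<close> on
  the first \<open>m\<close> places. A nonzero matrix coefficient of \<open>v\<close> with a highest
  weight vector of the larger group then lets \<open>branching\<close> apply.\<close>

lemma isotypic_branching:
  assumes n: "Suc m \<le> k" and x: "x \<in> isotypic (Suc m) \<delta> d k lam" "x \<in> isotypic m \<delta> d k lam'" "x \<noteq> 0" and i: "i < m"
  shows "part lam (Suc i) \<le> part lam' i" "part lam' i \<le> part lam i"
proof -
  have m: "m \<le> k" using n by simp
  interpret S: unitary_rep mscale V q meta_subst "Suc m" "d * \<delta>" by (rule reps[OF n])
  interpret M: unitary_rep mscale V q meta_subst m "d * \<delta>" by (rule reps[OF m])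
  let ?Y = "isotypic (Suc m) \<delta> d k lam \<inter> isotypic m \<delta> d k lam'"
  have "stab m ?Y" 
    by (rule stab_Int[OF stab_mono[OF _ isotypic_stab[OF n]] isotypic_stab[OF m]]) simp
  then have "M.stable ?Y" using stable_stab[OF m] by blast
  moreover have "?Y \<noteq> {0}" using x by blast
  ultimately obtain \<mu> v where v: "v \<in> ?Y" "v \<noteq> 0" "M.hw \<mu> v" by (rule M.hw_exists)
  have vV: "v \<in> V" using M.hw_V[OF v(3)] .
  have vS: "v \<in> S.comp (part lam)" using v isotypic_eq[OF n] by auto
  have \<mu>: "\<mu> i = part lam' i"
    using M.hw_comp_unique[OF v(3) _ v(2) i] v(1) isotypic_eq[OF m] by auto
  \<comment> \<open>Otherwise \<open>v\<close> would be orthogonal to all translates of highest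
    weight vectors of weight \<open>lam\<close>, hence to the component that contains it.\<close>
  have "\<exists>g w. g \<in> carrier_mat (Suc m) (Suc m) \<and> S.hw (part lam) w \<and> q (meta_subst g v) w \<noteq> 0"
  proof (rule ccontr)
    assume "\<not> (\<exists>g w. g \<in> carrier_mat (Suc m) (Suc m) \<and> S.hw (part lam) w \<and> q (meta_subst g v) w \<noteq> 0)"
    then have z: "q (meta_subst g v) w = 0" if "g \<in> carrier_mat (Suc m) (Suc m)" "S.hw (part lam) w" for g w
      using that by blast
    have "q v v = 0"
    proof (rule S.span_orth[OF _ vV _ vS[unfolded S.comp_def]])
      show "{meta_subst g v |g v. g \<in> carrier_mat (Suc m) (Suc m) \<and> S.hw (part lam) v} \<subseteq> V"
        using S.act_in S.hw_V by auto
      fix y assume "y \<in> {meta_subst g v |g v. g \<in> carrier_mat (Suc m) (Suc m) \<and> S.hw (part lam) v}"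
      then obtain g w where g: "g \<in> carrier_mat (Suc m) (Suc m)" "S.hw (part lam) w" "y = meta_subst g w" by blast
      have wV: "w \<in> V" using S.hw_V[OF g(2)] .
      have "q w (meta_subst (adj g) v) = 0"
        by (rule R.ip_0_commute[OF S.act_in[OF adj_carrier[OF g(1)] vV] wV z[OF adj_carrier[OF g(1)] g(2)]])
      then show "q y v = 0" using S.act_adj[OF g(1) wV vV] g(3) by simp
    qed
    then show False using R.ip_definite vV v(2) by blast
  qed
  then obtain g w where g: "g \<in> carrier_mat (Suc m) (Suc m)" "S.hw (part lam) w" "q (meta_subst g v) w \<noteq> 0" by blast
  have v_hw: "meta_subst u v = mscale (\<Prod>i<m. u $$ (i, i) ^ \<mu> i) v"
    if u: "u \<in> carrier_mat (Suc m) (Suc m)" "upper_triangular u" "\<forall>i<Suc m. u $$ (i, i) \<noteq> 0"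
      "\<forall>i<Suc m. \<forall>j<Suc m. m \<le> j \<longrightarrow> u $$ (i, j) = (if i = j then 1 else 0)" for u
  proof -
    define u' where "u' = mat m m (\<lambda>(i, j). u $$ (i, j))"
    have u': "u' \<in> carrier_mat m m" by (simp add: u'_def)
    have "u = emb (Suc m) u'"
    proof (rule eq_matI)
      fix i j assume "i < dim_row (emb (Suc m) u')" "j < dim_col (emb (Suc m) u')"
      then have ij: "i < Suc m" "j < Suc m" by auto
      show "u $$ (i, j) = emb (Suc m) u' $$ (i, j)"
      proof (cases "j < m")
        case True
        then show ?thesis using ij u(1,2) unfolding emb_index[OF u' ij]
          by (cases "i < m") (auto simp: u'_def)
      next
        case False
        then show ?thesis using ij u(4) unfolding emb_index[OF u' ij] by auto
      qed
    qed (use u in auto)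
    then have "meta_subst u v = meta_subst u' v" using meta_subst_emb[OF u', of "Suc m"] by simp
    also have "\<dots> = mscale (\<Prod>i<m. u' $$ (i, i) ^ \<mu> i) v"
    proof -
      have "upper_triangular u'" by (intro upper_triangularI) (use u(1,2) in \<open>auto simp: u'_def\<close>)
      moreover have "\<forall>i<m. u' $$ (i, i) \<noteq> 0" using u(3) by (auto simp: u'_def)
      ultimately show ?thesis using v(3) u' unfolding M.hw_def by blast
    qed
    finally show ?thesis by (simp add: u'_def)
  qed
  show "part lam (Suc i) \<le> part lam' i"
    unfolding \<mu>[symmetric] by (rule S.branching(1)[OF refl vV _ g(2,1,3) i]) (rule v_hw)
  show "part lam' i \<le> part lam i"
    unfolding \<mu>[symmetric] by (rule S.branching(2)[OF refl vV _ g(2,1,3) i]) (rule v_hw)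
qed

section \<open>Weight spaces and degrees\<close>

lemma subst_linear_dg:
  assumes i: "i \<in> expvecs d k"
  shows "Poly_Mapping.lookup (subst_linear (dg k t) f) i = (\<Prod>a<k. t a ^ Poly_Mapping.lookup i a) * Poly_Mapping.lookup f i"
proof -
  have lf: "linear_form (dg k t) a = Const (t a) * Var a" if "a < k" for a
  proof -
    have "linear_form (dg k t) a = (\<Sum>b<k. Const (dg k t $$ (a, b)) * Var b)" using that by (simp add: linear_form_def)
    also have "\<dots> = (\<Sum>b<k. if b = a then Const (t a) * Var a else 0)"
      using that by (intro sum.cong refl) (auto simp: Const_simps)
    finally show ?thesis using that by simp
  qed
  have prodw: "(\<Prod>a<k. t a ^ Poly_Mapping.lookup (wcontent (b # w)) a) = t b * (\<Prod>a<k. t a ^ Poly_Mapping.lookup (wcontent w) a)"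
    if "b < k" for b w
  proof -
    have "(\<Prod>a<k. t a ^ Poly_Mapping.lookup (wcontent (b # w)) a) =
        (\<Prod>a<k. (if a = b then t b else 1) * t a ^ Poly_Mapping.lookup (wcontent w) a)"
      by (intro prod.cong refl) (auto simp: lookup_add lookup_single when_def)
    then show ?thesis using that by (simp add: prod.distrib)
  qed
  have ms: "mono_subst (dg k t) (wcontent w) = Poly_Mapping.single (wcontent w) (\<Prod>a<k. t a ^ Poly_Mapping.lookup (wcontent w) a)"
    if "set w \<subseteq> {..<k}" for w
    using that
  proof (induction w)
    case (Cons b w)
    then have "mono_subst (dg k t) (wcontent (b # w)) =
        (Const (t b) * Var b) * Poly_Mapping.single (wcontent w) (\<Prod>a<k. t a ^ Poly_Mapping.lookup (wcontent w) a)"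
      by (simp add: mono_subst_add lf)
    also have "\<dots> = Poly_Mapping.single (wcontent (b # w)) (\<Prod>a<k. t a ^ Poly_Mapping.lookup (wcontent (b # w)) a)"
      using Cons.prems prodw[of b w] by (simp add: Const_def Var_def mult_single)
    finally show ?case .
  qed simp
  have "mcoef (dg k t) m i = (if m = i then \<Prod>a<k. t a ^ Poly_Mapping.lookup i a else 0)" if "m \<in> expvecs d k" for m
    using that ms by (auto simp: mcoef_def expvecs_wcontent words_def lists_len_def lookup_single)
  then have "(\<Sum>m\<in>expvecs d k. mcoef (dg k t) m i * Poly_Mapping.lookup f m) =
      (\<Sum>m\<in>expvecs d k. if m = i then (\<Prod>a<k. t a ^ Poly_Mapping.lookup i a) * Poly_Mapping.lookup f i else 0)"
    by (intro sum.cong) auto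
  then show ?thesis using lookup_subst_linear[OF dg_carrier i] i by simp
qed

lemma list_mono_weight:
  assumes "I \<in> lists_len (expvecs d k) \<delta>"
  shows "R.weight (Poly_Mapping.lookup (sum_list I)) (list_mono I)"
proof -
  have "list_mono J (subst_linear (dg k t) f) = (\<Prod>a<k. t a ^ Poly_Mapping.lookup (sum_list J) a) * list_mono J f"
    if "set J \<subseteq> expvecs d k" for J t f
    using that
  proof (induction J)
    case (Cons i J)
    then show ?case
      by (simp add: list_mono_def subst_linear_dg lookup_add power_add prod.distrib)
  qed (simp add: list_mono_def)
  then show ?thesis using assms unfolding R.weight_def
    by (auto simp: meta_subst_def mscale_def lists_len_def)
qed

lemma sum_list_expvecs:
  assumes "I \<in> lists_len (expvecs d k) \<delta>"
  shows "sum_list I \<in> expvecs (d * \<delta>) k"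
proof -
  have "Poly_Mapping.keys (sum_list J) \<subseteq> {..<k} \<and> expdeg (sum_list J) = d * length J" if "set J \<subseteq> expvecs d k" for J
    using that
  proof (induction J)
    case (Cons i J)
    then show ?case using keys_add[of i "sum_list J"] by (auto simp: expdeg_add) (auto simp: expvecs_def expdeg_def)
  qed (simp add: expdeg_def)
  then show ?thesis using assms by (auto simp: expvecs_def lists_len_def expdeg_def)
qed

lemma weight_space_eq:
  "weight_space \<delta> d k \<mu> = meta.span (list_mono ` {I \<in> lists_len (expvecs d k) \<delta>. sum_list I = \<mu>})"
proof -
  have "{metamonomial M | M. size M = \<delta> \<and> set_mset M \<subseteq> expvecs d k \<and> metamonomial_weight M = \<mu>} =
    list_mono ` {I \<in> lists_len (expvecs d k) \<delta>. sum_list I = \<mu>}" (is "?A = ?B")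
  proof
    show "?A \<subseteq> ?B"
    proof clarify
      fix M assume M: "\<delta> = size M" "set_mset M \<subseteq> expvecs d k" "\<mu> = metamonomial_weight M"
      obtain I where I: "mset I = M" using ex_mset by blast
      then have "I \<in> {I \<in> lists_len (expvecs d k) (size M). sum_list I = metamonomial_weight M}"
        using M by (auto simp: lists_len_def metamonomial_weight_def simp flip: sum_mset_sum_list)
      then show "metamonomial M \<in> list_mono ` {I \<in> lists_len (expvecs d k) (size M). sum_list I = metamonomial_weight M}"
        using metamonomial_mset[of I] I by blast
    qed
    show "?B \<subseteq> ?A"
    proof clarify
      fix I assume I: "I \<in> lists_len (expvecs d k) \<delta>" "\<mu> = sum_list I"
      then show "\<exists>M. list_mono I = metamonomial M \<and> size M = \<delta> \<and> set_mset M \<subseteq> expvecs d k \<and> metamonomial_weight M = sum_list I"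
        using metamonomial_mset[of I]
        by (intro exI[of _ "mset I"]) (auto simp: lists_len_def metamonomial_weight_def sum_mset_sum_list)
    qed
  qed
  then show ?thesis by (simp add: weight_space_def)
qed

lemma weight_space_weight:
  assumes "x \<in> weight_space \<delta> d k \<mu>"
  shows "x \<in> V" "R.weight (Poly_Mapping.lookup \<mu>) x"
proof -
  have "weight_space \<delta> d k \<mu> \<subseteq> {x \<in> V. R.weight (Poly_Mapping.lookup \<mu>) x}"
    unfolding weight_space_eq
  proof (rule meta.span_minimal)
    show "meta.subspace {x \<in> V. R.weight (Poly_Mapping.lookup \<mu>) x}"
      by (rule meta.subspaceI)
        (auto simp: R.weight_def R.V_closed R.act_add R.act_scale meta.scale_right_distrib mult.commute)
    show "list_mono ` {I \<in> lists_len (expvecs d k) \<delta>. sum_list I = \<mu>} \<subseteq> {x \<in> V. R.weight (Poly_Mapping.lookup \<mu>) x}"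
      using list_mono_weight by (auto simp: metapolys_eq intro: meta.span_base)
  qed
  then show "x \<in> V" "R.weight (Poly_Mapping.lookup \<mu>) x" using assms by auto
qed

lemma lookup_wts: "\<mu> \<in> expvecs N k \<Longrightarrow> Poly_Mapping.lookup \<mu> \<in> wts k N"
proof -
  assume \<mu>: "\<mu> \<in> expvecs N k"
  have "Poly_Mapping.lookup \<mu> a \<le> N" for a
  proof (cases "a \<in> Poly_Mapping.keys \<mu>")
    case True
    then show ?thesis using \<mu> member_le_sum[of a "Poly_Mapping.keys \<mu>" "Poly_Mapping.lookup \<mu>"] by (simp add: expvecs_def)
  qed (simp add: in_keys_iff)
  moreover have "Poly_Mapping.lookup \<mu> a = 0" if "k \<le> a" for a
    using \<mu> that by (force simp: expvecs_def in_keys_iff)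
  ultimately show ?thesis by (simp add: wts_def)
qed

text \<open>Metamonomials are weight vectors, so \<open>x\<close> is a sum of elements
  \<open>y \<mu>\<close> of the weight spaces; the one-parameter subgroup \<open>hm\<close> then
  shows that each \<open>y \<mu>\<close> lies in \<open>U\<close>.\<close>

lemma weight_space_decomposition:
  assumes U: "stab k U" and x: "x \<in> U"
  shows "x \<in> meta.span (\<Union>\<mu>\<in>expvecs (d * \<delta>) k. U \<inter> weight_space \<delta> d k \<mu>)"
proof -
  let ?E = "expvecs (d * \<delta>) k"
  define D where "D = {x. \<exists>y. x = (\<Sum>\<mu>\<in>?E. y \<mu>) \<and> (\<forall>\<mu>\<in>?E. y \<mu> \<in> weight_space \<delta> d k \<mu>)}"
  have sub: "meta.subspace (weight_space \<delta> d k \<mu>)" for \<mu> by (simp add: weight_space_def)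
  have "meta.subspace D"
  proof (rule meta.subspaceI)
    show "0 \<in> D" unfolding D_def by (rule CollectI, rule exI[of _ "\<lambda>_. 0"]) (use meta.subspace_0[OF sub] in simp)
    show "a + b \<in> D" if ab: "a \<in> D" "b \<in> D" for a b
    proof -
      obtain y z where "a = (\<Sum>\<mu>\<in>?E. y \<mu>)" "\<forall>\<mu>\<in>?E. y \<mu> \<in> weight_space \<delta> d k \<mu>"
        "b = (\<Sum>\<mu>\<in>?E. z \<mu>)" "\<forall>\<mu>\<in>?E. z \<mu> \<in> weight_space \<delta> d k \<mu>" using ab by (auto simp: D_def)
      then show ?thesis unfolding D_def
        by (intro CollectI exI[of _ "\<lambda>\<mu>. y \<mu> + z \<mu>"]) (auto simp: sum.distrib intro: meta.subspace_add[OF sub])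
    qed
    show "mscale c a \<in> D" if a: "a \<in> D" for c a
    proof -
      obtain y where "a = (\<Sum>\<mu>\<in>?E. y \<mu>)" "\<forall>\<mu>\<in>?E. y \<mu> \<in> weight_space \<delta> d k \<mu>" using a by (auto simp: D_def)
      then show ?thesis unfolding D_def
        by (intro CollectI exI[of _ "\<lambda>\<mu>. mscale c (y \<mu>)"]) (auto simp: meta.scale_sum_right intro: meta.subspace_scale[OF sub])
    qed
  qed
  moreover have "list_mono ` lists_len (expvecs d k) \<delta> \<subseteq> D"
  proof clarify
    fix I assume I: "I \<in> lists_len (expvecs d k) \<delta>"
    have "list_mono I \<in> weight_space \<delta> d k (sum_list I)" unfolding weight_space_eq using I by (intro meta.span_base) auto
    then show "list_mono I \<in> D" unfolding D_def using sum_list_expvecs[OF I] meta.subspace_0[OF sub]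
      by (intro CollectI exI[of _ "\<lambda>\<mu>. if \<mu> = sum_list I then list_mono I else 0"]) auto
  qed
  ultimately have "V \<subseteq> D" unfolding metapolys_eq by (intro meta.span_minimal)
  moreover have UV: "U \<subseteq> V" "meta.subspace U" using U by (auto simp: stab_def)
  ultimately obtain y where y: "x = (\<Sum>\<mu>\<in>?E. y \<mu>)" "\<forall>\<mu>\<in>?E. y \<mu> \<in> weight_space \<delta> d k \<mu>" using x by (auto simp: D_def)
  define \<epsilon> where "\<epsilon> \<mu> = wheight k (d * \<delta>) (Poly_Mapping.lookup \<mu>)" for \<mu>
  have inj: "inj_on \<epsilon> ?E"
  proof (rule inj_onI)
    fix \<mu> \<nu> assume *: "\<mu> \<in> ?E" "\<nu> \<in> ?E" "\<epsilon> \<mu> = \<epsilon> \<nu>"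
    then have "Poly_Mapping.lookup \<mu> = Poly_Mapping.lookup \<nu>"
      by (intro inj_onD[OF wheight_inj[of k "d * \<delta>"]] lookup_wts) (simp add: \<epsilon>_def)
    then show "\<mu> = \<nu>" by (simp add: poly_mapping_eqI)
  qed
  have yU: "y \<mu> \<in> U" if \<mu>: "\<mu> \<in> ?E" for \<mu>
  proof (rule R.separate_exponents[OF UV(2) _ inj _ \<mu>])
    fix s :: complex assume s: "s \<noteq> 0"
    have "meta_subst (R.hm s) x = (\<Sum>\<mu>\<in>?E. mscale (s ^ \<epsilon> \<mu>) (y \<mu>))"
      unfolding y(1) using y(2) weight_space_weight R.weight_hm[OF _ s]
      by (subst R.act_sum) (auto simp: \<epsilon>_def intro!: sum.cong)
    moreover have "meta_subst (R.hm s) x \<in> U" using U x by (auto simp: stab_def)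
    ultimately show "(\<Sum>\<mu>\<in>?E. mscale (s ^ \<epsilon> \<mu>) (y \<mu>)) \<in> U" by simp
  qed simp
  have "(\<Sum>\<mu>\<in>?E. y \<mu>) \<in> meta.span (\<Union>\<mu>\<in>?E. U \<inter> weight_space \<delta> d k \<mu>)"
    using yU y(2) by (intro meta.span_sum meta.span_base) auto
  then show ?thesis using y(1) by simp
qed

lemma weight_space_orth:
  assumes "x \<in> weight_space \<delta> d k \<mu>" "y \<in> weight_space \<delta> d k \<nu>" "\<mu> \<in> expvecs N k" "\<nu> \<in> expvecs N k" "\<mu> \<noteq> \<nu>"
  shows "q x y = 0"
proof -
  obtain a where a: "Poly_Mapping.lookup \<mu> a \<noteq> Poly_Mapping.lookup \<nu> a" 
    using assms(5) poly_mapping_eqI[of \<mu> \<nu>] by blast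
  then have "a < k" using lookup_wts[OF assms(3)] lookup_wts[OF assms(4)] by (cases "a < k") (auto simp: wts_def)
  then show ?thesis using R.weight_orth[OF weight_space_weight[OF assms(1)] weight_space_weight[OF assms(2)]] a by blast
qed

lemma V_scalar: "x \<in> V \<Longrightarrow> meta_subst (dg k (\<lambda>_. t)) x = mscale (t ^ (d * \<delta>)) x" if "t \<noteq> 0"
proof -
  have "V \<subseteq> {x \<in> V. meta_subst (dg k (\<lambda>_. t)) x = mscale (t ^ (d * \<delta>)) x}"
    unfolding metapolys_eq
  proof (rule meta.span_minimal)
    show "list_mono ` lists_len (expvecs d k) \<delta> \<subseteq>
      {x \<in> meta.span (list_mono ` lists_len (expvecs d k) \<delta>). meta_subst (dg k (\<lambda>_. t)) x = mscale (t ^ (d * \<delta>)) x}"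
    proof clarify
      fix I assume I: "I \<in> lists_len (expvecs d k) \<delta>"
      have "(\<Prod>a<k. t ^ Poly_Mapping.lookup (sum_list I) a) = t ^ (d * \<delta>)"
      proof -
        have "expdeg (sum_list I) = d * \<delta>" using sum_list_expvecs[OF I] by (simp add: expvecs_def expdeg_def)
        moreover have "expdeg (sum_list I) = (\<Sum>a<k. Poly_Mapping.lookup (sum_list I) a)"
          using sum_list_expvecs[OF I] by (intro expdeg_superset) (auto simp: expvecs_def)
        ultimately show ?thesis by (simp flip: power_sum)
      qed
      then have "meta_subst (dg k (\<lambda>_. t)) (list_mono I) = mscale (t ^ (d * \<delta>)) (list_mono I)"
        using list_mono_weight[OF I, unfolded R.weight_def, rule_format, of "\<lambda>_. t"] that by simp
      then show "list_mono I \<in> meta.span (list_mono ` lists_len (expvecs d k) \<delta>) \<and>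
        meta_subst (dg k (\<lambda>_. t)) (list_mono I) = mscale (t ^ (d * \<delta>)) (list_mono I)"
        using I by (auto intro: meta.span_base)
    qed
    show "meta.subspace {x \<in> meta.span (list_mono ` lists_len (expvecs d k) \<delta>). meta_subst (dg k (\<lambda>_. t)) x = mscale (t ^ (d * \<delta>)) x}"
      unfolding metapolys_eq[symmetric]
      by (rule meta.subspaceI)
        (auto simp: R.V_closed R.act_add R.act_scale meta.scale_right_distrib mult.commute)
  qed
  then show "x \<in> V \<Longrightarrow> meta_subst (dg k (\<lambda>_. t)) x = mscale (t ^ (d * \<delta>)) x" by blast
qed

text \<open>Twice the identity acts on all of \<open>V\<close> with exponent
  \<open>d * \<delta>\<close> and on the component with exponent the size of
  \<open>lam\<close>.\<close>

lemma isotypic_size: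
  assumes "x \<in> isotypic k \<delta> d k lam" "x \<noteq> 0"
  shows "(\<Sum>i<k. part lam i) = d * \<delta>"
proof -
  have "x \<in> V" using assms isotypic_V[of k lam] by auto
  then have 1: "meta_subst (dg k (\<lambda>_. 2)) x = mscale (2 ^ (d * \<delta>)) x" by (rule V_scalar[rotated]) simp
  have "meta_subst (dg k (\<lambda>_. 2)) x = mscale (2 ^ (\<Sum>i<k. part lam i)) x"
    by (rule isotypic_scalar[OF order_refl assms(1)]) simp
  then have "mscale (2 ^ (\<Sum>i<k. part lam i)) x = mscale (2 ^ (d * \<delta>)) x" by (rule trans[OF sym 1])
  then have "(2::complex) ^ (\<Sum>i<k. part lam i) = 2 ^ (d * \<delta>)"
    using assms(2) meta.scale_right_imp_eq by blast
  then show ?thesis by (simp only: two_power_complex_inject)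
qed

section \<open>Decomposition along the chain of subgroups\<close>

lemma isotypic_k_decomposition:
  assumes U: "stab k U" and x: "x \<in> U"
  shows "x \<in> meta.span (\<Union>lam\<in>partitions (d * \<delta>) k. U \<inter> isotypic k \<delta> d k lam)"
proof -
  have "(\<Union>lam\<in>bounded_parts k. U \<inter> isotypic k \<delta> d k lam) \<subseteq>
    meta.span (\<Union>lam\<in>partitions (d * \<delta>) k. U \<inter> isotypic k \<delta> d k lam)"
  proof clarify
    fix lam y assume lam: "lam \<in> bounded_parts k" and y: "y \<in> U" "y \<in> isotypic k \<delta> d k lam"
    show "y \<in> meta.span (\<Union>lam\<in>partitions (d * \<delta>) k. U \<inter> isotypic k \<delta> d k lam)"
    proof (cases "y = 0")
      case False
      then have "(\<Sum>i<k. part lam i) = d * \<delta>" using isotypic_size[OF y(2)] by simp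
      then have "lam \<in> partitions (d * \<delta>) k" using lam sum_part[of lam _ k] unfolding bounded_parts_def by force
      then show ?thesis using y by (intro meta.span_base) auto
    qed (simp add: meta.span_zero)
  qed
  then have "meta.span (\<Union>lam\<in>bounded_parts k. U \<inter> isotypic k \<delta> d k lam) \<subseteq>
    meta.span (\<Union>lam\<in>partitions (d * \<delta>) k. U \<inter> isotypic k \<delta> d k lam)" by (rule meta.span_minimal) simp
  then show ?thesis using isotypic_decomposition[OF _ U x] by blast
qed

text \<open>The levels are treated downwards from \<open>k\<close>: components of the larger groups
  are stable under the smaller ones, so each piece obtained so far can be decomposed again inside
  \<open>U\<close>.\<close>

lemma chain_decomposition:
  assumes U: "stab k U" and x: "x \<in> U" and m: "1 \<le> m" "m \<le> k"
  shows "x \<in> meta.span (\<Union>c\<in>{c. \<forall>i\<in>{m..k}. c i \<in> bounded_parts i}. U \<inter> (\<Inter>i\<in>{m..k}. isotypic i \<delta> d k (c i)))"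
  using m(2,1)
proof (induction rule: inc_induct)
  case base
  have "(\<Union>lam\<in>bounded_parts k. U \<inter> isotypic k \<delta> d k lam) \<subseteq>
    (\<Union>c\<in>{c. \<forall>i\<in>{k..k}. c i \<in> bounded_parts i}. U \<inter> (\<Inter>i\<in>{k..k}. isotypic i \<delta> d k (c i)))"
  proof clarify
    fix y lam assume "lam \<in> bounded_parts k" "y \<in> U" "y \<in> isotypic k \<delta> d k lam"
    then show "y \<in> (\<Union>c\<in>{c. \<forall>i\<in>{k..k}. c i \<in> bounded_parts i}. U \<inter> (\<Inter>i\<in>{k..k}. isotypic i \<delta> d k (c i)))"
      by (intro UN_I[of "\<lambda>_. lam"]) auto
  qed
  then show ?case using isotypic_decomposition[OF _ U x] meta.span_mono by blast
next
  case (step m)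
  let ?B = "\<lambda>m. \<Union>c\<in>{c. \<forall>i\<in>{m..k}. c i \<in> bounded_parts i}. U \<inter> (\<Inter>i\<in>{m..k}. isotypic i \<delta> d k (c i))"
  have "?B (Suc m) \<subseteq> meta.span (?B m)"
  proof clarify
    fix y c assume c: "\<forall>i\<in>{Suc m..k}. c i \<in> bounded_parts i" and y: "y \<in> U" "y \<in> (\<Inter>i\<in>{Suc m..k}. isotypic i \<delta> d k (c i))"
    define Y where "Y = U \<inter> (\<Inter>i\<in>{Suc m..k}. isotypic i \<delta> d k (c i))"
    have mk: "m \<le> k" "m < k" using step by auto
    have iso: "stab m (isotypic i \<delta> d k (c i))" if "i \<in> {Suc m..k}" for i
      using stab_mono[OF _ isotypic_stab, of m i] that by auto
    have "stab m U" using stab_mono[OF mk(1) U] .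
    then have "stab m Y" using iso unfolding Y_def stab_def
      by (auto intro!: meta.subspace_inter meta.subspace_Inter)
    moreover have "y \<in> Y" using y by (auto simp: Y_def)
    ultimately have "y \<in> meta.span (\<Union>lam\<in>bounded_parts m. Y \<inter> isotypic m \<delta> d k lam)"
      using isotypic_decomposition[OF mk(1)] by blast
    moreover have "(\<Union>lam\<in>bounded_parts m. Y \<inter> isotypic m \<delta> d k lam) \<subseteq> ?B m"
    proof clarify
      fix z lam assume z: "lam \<in> bounded_parts m" "z \<in> Y" "z \<in> isotypic m \<delta> d k lam"
      have "{m..k} = insert m {Suc m..k}" using mk by auto
      then show "z \<in> ?B m" using z c by (intro UN_I[of "c(m := lam)"]) (auto simp: Y_def)
    qed
    ultimately show "y \<in> meta.span (?B m)" using meta.span_mono by blast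
  qed
  then have "meta.span (?B (Suc m)) \<subseteq> meta.span (?B m)" by (rule meta.span_minimal) simp
  then show ?case using step by auto
qed

text \<open>A nonzero piece of \<open>chain_decomposition\<close> has an interlacing chain by
  \<open>isotypic_branching\<close>, and such a chain comes from a tableau; zero pieces lie in every
  span.\<close>

lemma tableau_decomposition:
  assumes U: "stab k U" and x: "x \<in> U"
  shows "x \<in> meta.span (\<Union>T\<in>tableaux (d * \<delta>) k. U \<inter> tableau_isotypic \<delta> d k T)"
proof -
  let ?B = "\<Union>c\<in>{c. \<forall>i\<in>{1..k}. c i \<in> bounded_parts i}. U \<inter> (\<Inter>i\<in>{1..k}. isotypic i \<delta> d k (c i))"
  have UV: "U \<subseteq> V" using U by (simp add: stab_def)
  have "?B \<subseteq> meta.span (\<Union>T\<in>tableaux (d * \<delta>) k. U \<inter> tableau_isotypic \<delta> d k T)"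
  proof clarify
    fix y c assume c: "\<forall>i\<in>{1..k}. c i \<in> bounded_parts i" and y: "y \<in> U" "y \<in> (\<Inter>i\<in>{1..k}. isotypic i \<delta> d k (c i))"
    show "y \<in> meta.span (\<Union>T\<in>tableaux (d * \<delta>) k. U \<inter> tableau_isotypic \<delta> d k T)"
    proof (cases "y = 0")
      case False
      \<comment> \<open>Level 0 is set to the empty shape, where the chain of a tableau
        starts.\<close>
      define cc where "cc j = (if j = 0 then (\<lambda>_. 0) else part (c j))" for j
      have zero: "cc j i = 0" if "j \<le> i" "j \<le> k" for i j
        using c that part_beyond[of "c j" "sum_list (c j)" j i] by (auto simp: cc_def bounded_parts_def)
      have iso: "y \<in> isotypic j \<delta> d k (c j)" if "1 \<le> j" "j \<le> k" for j using y that by auto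
      have br: "cc (Suc j) (Suc i) \<le> cc j i \<and> cc j i \<le> cc (Suc j) i" if j: "j < k" for i j
      proof (cases "i < j")
        case True
        then have "part (c (Suc j)) (Suc i) \<le> part (c j) i" "part (c j) i \<le> part (c (Suc j)) i"
          using isotypic_branching[of j y "c (Suc j)" "c j" i] iso[of j] iso[of "Suc j"] False j by auto
        then show ?thesis using True by (simp add: cc_def)
      next
        case f: False
        then show ?thesis using zero[of j i] zero[of "Suc j" "Suc i"] j by simp
      qed
      have "(\<Sum>i<k. cc k i) = d * \<delta>" using isotypic_size[OF iso[OF k_pos order_refl] False] k_pos by (simp add: cc_def)
      moreover obtain T where T: "T \<in> tableaux (\<Sum>i<k. cc k i) k" "\<And>j. j \<le> k \<Longrightarrow> part (shape (restrict_tableau j T)) = cc j"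
      proof (rule tableau_of_chain[of cc k])
        show "cc 0 i = 0" for i by (simp add: cc_def)
        show "j < k \<Longrightarrow> cc j i \<le> cc (Suc j) i" "j < k \<Longrightarrow> cc (Suc j) (Suc i) \<le> cc j i" for i j using br by auto
        show "k \<le> i \<Longrightarrow> cc k i = 0" for i using zero by simp
      qed (use k_pos in auto)
      moreover have "y \<in> tableau_isotypic \<delta> d k T"
        unfolding tableau_isotypic_def
      proof (intro CollectI conjI ballI)
        show "y \<in> V" using y UV by blast
        fix j assume j: "j \<in> {1..k}"
        then have "isotypic j \<delta> d k (shape (restrict_tableau j T)) = isotypic j \<delta> d k (c j)"
          using T(2)[of j] by (intro isotypic_cong) (auto simp: cc_def)
        then show "y \<in> isotypic j \<delta> d k (shape (restrict_tableau j T))" using iso j by auto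
      qed
      ultimately show ?thesis using y(1) by (intro meta.span_base) auto
    qed (simp add: meta.span_zero)
  qed
  then have "meta.span ?B \<subseteq> meta.span (\<Union>T\<in>tableaux (d * \<delta>) k. U \<inter> tableau_isotypic \<delta> d k T)"
    by (rule meta.span_minimal) simp
  then show ?thesis using chain_decomposition[OF U x _ k_pos] by auto
qed

lemma tableau_isotypic_orth:
  assumes "S \<in> tableaux (d * \<delta>) k" "T \<in> tableaux (d * \<delta>) k" "S \<noteq> T"
    "x \<in> tableau_isotypic \<delta> d k S" "y \<in> tableau_isotypic \<delta> d k T"
  shows "q x y = 0"
proof -
  obtain j i where ji: "j \<in> {1..k}" "i < j" "part (shape (restrict_tableau j S)) i \<noteq> part (shape (restrict_tableau j T)) i"
    using tableau_chain_inject[OF assms(1,2) k_pos assms(3)] by blast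
  then show ?thesis using assms(4,5) isotypic_orth[of j i] unfolding tableau_isotypic_def by auto
qed

lemma tableau_isotypic_subspace: "meta.subspace (tableau_isotypic \<delta> d k T)" "tableau_isotypic \<delta> d k T \<subseteq> V"
proof -
  have "meta.subspace (isotypic j \<delta> d k lam)" for j lam by (simp add: isotypic_def)
  then show "meta.subspace (tableau_isotypic \<delta> d k T)"
    using R.V_sub unfolding tableau_isotypic_def
    by (intro meta.subspaceI) (auto simp: meta.subspace_0 meta.subspace_add meta.subspace_scale)
qed (auto simp: tableau_isotypic_def)

text \<open>A highest weight vector for \<open>GL k\<close> is one for every smaller block with the
  truncated weight. Conversely, membership at all levels fixes the action of the scalar matrices of
  each block; these generate the torus, so \<open>x\<close> has weight \<open>lam\<close>, and
  \<open>comp_weight_hw\<close> applies.\<close>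

lemma highest_weight_space_tableau:
  assumes lam: "lam \<in> partitions (d * \<delta>) k"
  shows "highest_weight_space \<delta> d k lam = tableau_isotypic \<delta> d k (superstandard lam)"
proof -
  have iso: "isotypic j \<delta> d k (shape (restrict_tableau j (superstandard lam))) = isotypic j \<delta> d k lam" if "j \<le> k" for j
    by (rule isotypic_cong[OF that]) (simp add: part_shape_superstandard[OF lam])
  show ?thesis
  proof (intro equalityI subsetI)
    fix x assume "x \<in> highest_weight_space \<delta> d k lam"
    then have x: "x \<in> V" "highest_weight_vector k lam x" by (auto simp: highest_weight_space_def)
    have "x \<in> isotypic j \<delta> d k lam" if j: "j \<in> {1..k}" for j
    proof -
      have jk: "j \<le> k" using j by simp
      interpret S: unitary_rep mscale V q meta_subst j "d * \<delta>" by (rule reps[OF jk])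
      have hwk: "R.hw (part lam) x" using x hw_iff by simp
      have "S.hw (part lam) x"
        unfolding S.hw_def
      proof (intro conjI ballI impI x(1))
        fix g :: "complex mat" assume g: "g \<in> carrier_mat j j" "upper_triangular g" "\<forall>i<j. g $$ (i, i) \<noteq> 0"
        have "upper_triangular (emb k g)"
          by (intro upper_triangularI) (use g(1,2) jk in \<open>auto simp: emb_index[of _ j]\<close>)
        moreover have "\<forall>i<k. emb k g $$ (i, i) \<noteq> 0" using g by (auto simp: emb_index[of _ j])
        ultimately have "meta_subst (emb k g) x = mscale (\<Prod>i<k. emb k g $$ (i, i) ^ part lam i) x"
          using hwk unfolding R.hw_def by auto
        moreover have "(\<Prod>i<k. emb k g $$ (i, i) ^ part lam i) = (\<Prod>i<j. g $$ (i, i) ^ part lam i)"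
          using jk g(1) by (intro prod.mono_neutral_cong_right) (auto simp: emb_index[of _ j])
        ultimately show "meta_subst g x = mscale (\<Prod>i<j. g $$ (i, i) ^ part lam i) x"
          using meta_subst_emb[OF g(1) jk] by simp
      qed
      then show ?thesis using S.hw_in_comp isotypic_eq[OF jk] by simp
    qed
    then show "x \<in> tableau_isotypic \<delta> d k (superstandard lam)"
      using x(1) iso by (auto simp: tableau_isotypic_def)
  next
    fix x assume "x \<in> tableau_isotypic \<delta> d k (superstandard lam)"
    then have x: "x \<in> V" "\<And>j. j \<in> {1..k} \<Longrightarrow> x \<in> isotypic j \<delta> d k lam" using iso by (auto simp: tableau_isotypic_def)
    have tor: "meta_subst (dg m t) x = mscale (\<Prod>i<m. t i ^ part lam i) x"
      if "m \<le> k" "\<forall>i<m. t i \<noteq> 0" for m and t :: "nat \<Rightarrow> complex"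
      using that
    proof (induction m arbitrary: t)
      case 0
      have "dg 0 t = 1\<^sub>m 0" by (rule eq_matI) auto
      then show ?case using unitary_rep.act_one[OF reps[of 0] x(1)] by simp
    next
      case (Suc m)
      interpret S: unitary_rep mscale V q meta_subst "Suc m" "d * \<delta>" by (rule reps[OF Suc.prems(1)])
      define u where "u i = t i / t m" for i
      have tm: "t m \<noteq> 0" using Suc.prems by simp
      \<comment> \<open>A diagonal matrix is a scalar matrix with the last entry times a diagonal
        matrix of the next smaller block.\<close>
      have eq: "dg (Suc m) t = emb (Suc m) (dg m u) * dg (Suc m) (\<lambda>_. t m)"
      proof (rule eq_matI)
        fix i j assume "i < dim_row (emb (Suc m) (dg m u) * dg (Suc m) (\<lambda>_. t m))"
          "j < dim_col (emb (Suc m) (dg m u) * dg (Suc m) (\<lambda>_. t m))"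
        then have ij: "i < Suc m" "j < Suc m" by auto
        show "dg (Suc m) t $$ (i, j) = (emb (Suc m) (dg m u) * dg (Suc m) (\<lambda>_. t m)) $$ (i, j)"
          unfolding dg_mult_index(2)[OF emb_carrier ij] emb_index[OF dg_carrier ij]
          using ij tm by (auto simp: u_def less_Suc_eq)
      qed auto
      have "meta_subst (dg (Suc m) t) x = meta_subst (emb (Suc m) (dg m u)) (meta_subst (dg (Suc m) (\<lambda>_. t m)) x)"
        unfolding eq by (rule S.act_mult) (auto simp: x(1))
      also have "meta_subst (dg (Suc m) (\<lambda>_. t m)) x = mscale (t m ^ (\<Sum>i<Suc m. part lam i)) x"
        using isotypic_scalar[OF Suc.prems(1) x(2) tm] Suc.prems(1) by simp
      also have "meta_subst (emb (Suc m) (dg m u)) (mscale (t m ^ (\<Sum>i<Suc m. part lam i)) x) =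
          mscale (t m ^ (\<Sum>i<Suc m. part lam i)) (meta_subst (dg m u) x)"
        using meta_subst_emb[OF dg_carrier, of m "Suc m" u] by (simp add: meta_subst_def mscale_def)
      also have "meta_subst (dg m u) x = mscale (\<Prod>i<m. u i ^ part lam i) x"
        using Suc.prems tm by (intro Suc.IH) (auto simp: u_def)
      also have "mscale (t m ^ (\<Sum>i<Suc m. part lam i)) (mscale (\<Prod>i<m. u i ^ part lam i) x) =
          mscale (t m ^ (\<Sum>i<Suc m. part lam i) * (\<Prod>i<m. u i ^ part lam i)) x" by simp
      also have "t m ^ (\<Sum>i<Suc m. part lam i) * (\<Prod>i<m. u i ^ part lam i) = (\<Prod>i<Suc m. t i ^ part lam i)"
        using tm by (simp add: u_def power_add power_sum power_divide prod_dividef)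
      finally show ?case .
    qed
    have "R.weight (part lam) x" unfolding R.weight_def using tor[of k] by simp
    moreover have "x \<in> R.comp (part lam)" using x(2)[of k] isotypic_eq[of k lam] k_pos by simp
    ultimately have "R.hw (part lam) x" using R.comp_weight_hw by blast
    then show "x \<in> highest_weight_space \<delta> d k lam"
      using hw_iff[of k x lam] x(1) by (simp add: highest_weight_space_def)
  qed
qed

section \<open>Projections and their circuits\<close>

text \<open>Splitting \<open>\<Delta>\<close> inside \<open>U\<close> exhibits a valid component in
  \<open>U\<close>. It is the one chosen by the definite description, since the difference of two
  candidates lies in \<open>F i0\<close> and in the span of the others, so it is orthogonal to
  itself.\<close>

lemma proj_along_mem:
  assumes U: "meta.subspace U" and F: "\<And>i. i \<in> insert i0 Ix \<Longrightarrow> meta.subspace (F i) \<and> F i \<subseteq> V"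
    and orth: "\<And>i x y. i \<in> Ix \<Longrightarrow> i \<noteq> i0 \<Longrightarrow> x \<in> F i \<Longrightarrow> y \<in> F i0 \<Longrightarrow> q x y = 0"
    and \<Delta>: "\<Delta> \<in> meta.span (\<Union>i\<in>Ix. U \<inter> F i)"
  shows "proj_along (F i0) (meta.span (\<Union>i\<in>Ix - {i0}. F i)) \<Delta> \<in> U \<inter> F i0"
proof -
  let ?O = "\<Union>i\<in>Ix - {i0}. F i"
  have "(\<Union>i\<in>Ix. U \<inter> F i) \<subseteq> (U \<inter> F i0) \<union> ?O" by auto
  then have "\<Delta> \<in> meta.span ((U \<inter> F i0) \<union> ?O)" using \<Delta> meta.span_mono by blast
  then obtain a b where ab: "\<Delta> = a + b" "a \<in> meta.span (U \<inter> F i0)" "b \<in> meta.span ?O"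
    unfolding meta.span_Un by blast
  have subF: "meta.subspace (F i0)" "F i0 \<subseteq> V" using F by auto
  have a: "a \<in> U \<inter> F i0" using ab(2) meta.span_eq_iff[of "U \<inter> F i0"] meta.subspace_inter[OF U subF(1)] by blast
  have OV: "?O \<subseteq> V" using F by blast
  have "proj_along (F i0) (meta.span ?O) \<Delta> = a"
    unfolding proj_along_def
  proof (rule the_equality)
    show "a \<in> F i0 \<and> \<Delta> - a \<in> meta.span ?O" using a ab by simp
    fix a' assume a': "a' \<in> F i0 \<and> \<Delta> - a' \<in> meta.span ?O"
    define z where "z = a' - a"
    have zF: "z \<in> F i0" using a' a subF by (auto simp: z_def meta.subspace_diff)
    have "z = b - (\<Delta> - a')" by (simp add: z_def ab(1))
    then have zO: "z \<in> meta.span ?O" using ab(3) a' meta.span_diff by auto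
    have zV: "z \<in> V" using zF subF by blast
    have "q z z = 0" by (rule R.span_orth[OF OV zV _ zO]) (use orth zF in blast)
    then have "z = 0" using zV R.ip_definite by blast
    then show "a' = a" by (simp add: z_def)
  qed
  then show ?thesis using a by simp
qed

lemma stab_cyc: "\<Delta> \<in> V \<Longrightarrow> stab k (R.cyc \<Delta>)"
  using R.cyc_stable stable_stab[of k] by simp

lemma projections_in_cyc:
  assumes \<Delta>: "\<Delta> \<in> V"
  shows "\<mu> \<in> expvecs (d * \<delta>) k \<Longrightarrow> weight_proj \<delta> d k \<mu> \<Delta> \<in> R.cyc \<Delta>"
    "lam \<in> partitions (d * \<delta>) k \<Longrightarrow> isotypic_proj \<delta> d k lam \<Delta> \<in> R.cyc \<Delta>"
    "lam \<in> partitions (d * \<delta>) k \<Longrightarrow> T \<in> semistandard k lam \<Longrightarrow> tableau_proj \<delta> d k T \<Delta> \<in> R.cyc \<Delta>"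
    "lam \<in> partitions (d * \<delta>) k \<Longrightarrow> highest_weight_proj \<delta> d k lam \<Delta> \<in> R.cyc \<Delta>"
proof -
  have U: "meta.subspace (R.cyc \<Delta>)" "\<Delta> \<in> R.cyc \<Delta>" "stab k (R.cyc \<Delta>)"
    using stab_cyc[OF \<Delta>] R.cyc_self[OF \<Delta>] by (auto simp: stab_def)
  show "weight_proj \<delta> d k \<mu> \<Delta> \<in> R.cyc \<Delta>" if \<mu>: "\<mu> \<in> expvecs (d * \<delta>) k"
  proof -
    have "weight_proj \<delta> d k \<mu> \<Delta> \<in> R.cyc \<Delta> \<inter> weight_space \<delta> d k \<mu>"
      unfolding weight_proj_def
    proof (rule proj_along_mem[OF U(1)])
      show "meta.subspace (weight_space \<delta> d k i) \<and> weight_space \<delta> d k i \<subseteq> V" for i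
        using weight_space_weight by (auto simp: weight_space_def)
    qed (use weight_space_orth \<mu> weight_space_decomposition[OF U(3,2)] in auto)
    then show ?thesis by simp
  qed
  show "isotypic_proj \<delta> d k lam \<Delta> \<in> R.cyc \<Delta>" if lam: "lam \<in> partitions (d * \<delta>) k" for lam
  proof -
    have "isotypic_proj \<delta> d k lam \<Delta> \<in> R.cyc \<Delta> \<inter> isotypic k \<delta> d k lam"
      unfolding isotypic_proj_def
    proof (rule proj_along_mem[OF U(1)])
      show "meta.subspace (isotypic k \<delta> d k i) \<and> isotypic k \<delta> d k i \<subseteq> V" for i
        using isotypic_V[of k i] by (auto simp: isotypic_def)
      show "q x y = 0" if nu: "nu \<in> partitions (d * \<delta>) k" "nu \<noteq> lam" and xy: "x \<in> isotypic k \<delta> d k nu" "y \<in> isotypic k \<delta> d k lam" for nu x y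
      proof -
        have "part nu \<noteq> part lam" using nu lam part_inject[of nu lam] by (auto simp: partitions_def)
        then obtain i where i: "part nu i \<noteq> part lam i" by blast
        \<comment> \<open>Both partitions have at most \<open>k\<close> parts, so they already
          differ within the range where components of \<open>GL k\<close> are orthogonal.\<close>
        then have "i < k" using part_beyond[OF nu(1), of i] part_beyond[OF lam, of i] by (cases "i < k") auto
        then show ?thesis using isotypic_orth[of k i nu lam x y] i xy by simp
      qed
    qed (use isotypic_k_decomposition[OF U(3,2)] in auto)
    then show ?thesis by simp
  qed
  have tab: "tableau_proj \<delta> d k T \<Delta> \<in> R.cyc \<Delta>" if "lam \<in> partitions (d * \<delta>) k" "T \<in> semistandard k lam" for lam T
  proof -
    have T: "T \<in> tableaux (d * \<delta>) k" using that by (auto simp: tableaux_def)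
    have "tableau_proj \<delta> d k T \<Delta> \<in> R.cyc \<Delta> \<inter> tableau_isotypic \<delta> d k T"
      unfolding tableau_proj_def
    proof (rule proj_along_mem[OF U(1)])
      show "meta.subspace (tableau_isotypic \<delta> d k i) \<and> tableau_isotypic \<delta> d k i \<subseteq> V" for i
        using tableau_isotypic_subspace by auto
    qed (use tableau_isotypic_orth T tableau_decomposition[OF U(3,2)] in auto)
    then show ?thesis by simp
  qed
  show "lam \<in> partitions (d * \<delta>) k \<Longrightarrow> T \<in> semistandard k lam \<Longrightarrow> tableau_proj \<delta> d k T \<Delta> \<in> R.cyc \<Delta>" by (rule tab)
  show "highest_weight_proj \<delta> d k lam \<Delta> \<in> R.cyc \<Delta>" if lam: "lam \<in> partitions (d * \<delta>) k"
    using tab[OF lam superstandard_semistandard[OF lam]]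
    by (simp add: highest_weight_proj_def tableau_proj_def highest_weight_space_tableau[OF lam])
qed

lemma cyc_circuit:
  assumes \<Delta>: "\<Delta> \<in> V" "has_circuit_of_size d k \<Delta> s" and x: "x \<in> R.cyc \<Delta>"
  shows "\<exists>s'. has_circuit_of_size d k x s' \<and> real s' \<le> 3 * (real s * real (\<delta> * d) ^ (2 * k\<^sup>2))"
proof -
  have s: "s \<ge> 1" using has_circuit_size_pos[OF \<Delta>(2)] .
  have xV: "x \<in> V" using x R.stableD(2)[OF R.cyc_stable[OF \<Delta>(1)]] by blast
  show ?thesis
  proof (cases "d * \<delta> = 1")
    case True
    then have "d = 1" "\<delta> = 1" by auto
    \<comment> \<open>Here the bound is \<open>3 * s\<close> for every \<open>k\<close>, too small
      for the general count of translates; but \<open>x\<close> is linear and needs just one input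
      gate.\<close>
    then have "has_circuit_of_size d k x 1" using xV linear_metapolys_affine[of 1 k] has_circuit_affine by auto
    then show ?thesis using \<open>d = 1\<close> \<open>\<delta> = 1\<close> s by (intro exI[of _ 1]) auto
  next
    case False
    define N where "N = d * \<delta>"
    have N: "N \<ge> 2" using False N_pos unfolding N_def by linarith
    obtain G c where G: "finite G" "G \<subseteq> carrier_mat k k" "card G \<le> (N + 1) ^ k\<^sup>2" "x = (\<Sum>g\<in>G. mscale (c g) (meta_subst g \<Delta>))"
      using R.cyc_combination[OF \<Delta>(1) x] unfolding N_def by blast
    obtain s' where s': "has_circuit_of_size d k x s'" "s' \<le> card G * (s + 1) + 1"
      using has_circuit_sum[OF G(1), of d k "\<lambda>g. meta_subst g \<Delta>" s c] has_circuit_subst[OF _ \<Delta>(2)] G(2,4) by auto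
    have "N + 1 \<le> N\<^sup>2"
    proof -
      have "N + 1 \<le> 2 * N" using N by simp
      also have "\<dots> \<le> N * N" using N by (intro mult_right_mono) auto
      finally show ?thesis by (simp add: power2_eq_square)
    qed
    then have "(N + 1) ^ k\<^sup>2 \<le> (N\<^sup>2) ^ k\<^sup>2" by (rule power_mono) simp
    then have "card G \<le> N ^ (2 * k\<^sup>2)" using G(3) by (simp add: power_mult)
    \<comment> \<open>Origin of the constant 3: \<open>s + 1 \<le> 2 * s\<close> accounts for two
      copies of \<open>s * N ^ (2 * k\<^sup>2)\<close>, and the extra zero gate is absorbed by a
      third.\<close>
    moreover have "1 \<le> s * N ^ (2 * k\<^sup>2)" using s N by (simp add: Suc_le_eq)
    moreover have "s + 1 \<le> 2 * s" using s by simp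
    ultimately have "card G * (s + 1) + 1 \<le> N ^ (2 * k\<^sup>2) * (2 * s) + s * N ^ (2 * k\<^sup>2)"
      by (intro add_mono mult_mono) auto
    then have "s' \<le> 3 * (s * N ^ (2 * k\<^sup>2))" using s'(2) by simp
    then have "real s' \<le> real (3 * (s * N ^ (2 * k\<^sup>2)))" by (simp only: of_nat_le_iff)
    then show ?thesis using s'(1) by (intro exI[of _ s']) (simp add: N_def mult.commute)
  qed
qed

end

theorem theorem1p1:
  shows "\<exists>C::real. C > 0 \<and>
    (\<forall>(k::nat) (d::nat) (\<delta>::nat) (s::nat) (\<Delta>::metapoly).
      d \<ge> 1 \<and> \<delta> \<ge> 1 \<and> \<Delta> \<in> metapolys \<delta> d k \<and> has_circuit_of_size d k \<Delta> s \<longrightarrow>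
      (\<forall>\<mu>\<in>expvecs (d * \<delta>) k. \<exists>s'.
         has_circuit_of_size d k (weight_proj \<delta> d k \<mu> \<Delta>) s' \<and>
         real s' \<le> C * (real s * real (\<delta> * d) ^ (2 * k ^ 3))) \<and>
      (\<forall>lam\<in>partitions (d * \<delta>) k. \<exists>s'.
         has_circuit_of_size d k (isotypic_proj \<delta> d k lam \<Delta>) s' \<and>
         real s' \<le> C * (real s * real k ^ (2 * k ^ 2) * real (\<delta> * d) ^ (2 * k ^ 3))) \<and>
      (\<forall>lam\<in>partitions (d * \<delta>) k. \<exists>s'.
         has_circuit_of_size d k (highest_weight_proj \<delta> d k lam \<Delta>) s' \<and>
         real s' \<le> C * (real s * real (k + 1) ^ (2 * k ^ 2) * real (\<delta> * d) ^ (2 * k ^ 3))) \<and>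
      (\<forall>lam\<in>partitions (d * \<delta>) k. \<forall>T\<in>semistandard k lam. \<exists>s'.
         has_circuit_of_size d k (tableau_proj \<delta> d k T \<Delta>) s' \<and>
         real s' \<le> C * (real s * real k ^ (2 * k ^ 2) * real (\<delta> * d) ^ (2 * k ^ 4))))"
proof (intro exI[of _ 3] conjI allI impI)
  show "(0::real) < 3" by simp
  fix k d \<delta> s :: nat and \<Delta> :: metapoly
  assume asm: "d \<ge> 1 \<and> \<delta> \<ge> 1 \<and> \<Delta> \<in> metapolys \<delta> d k \<and> has_circuit_of_size d k \<Delta> s"
  then have pos: "d * \<delta> > 0" by simp
  show "(\<forall>\<mu>\<in>expvecs (d * \<delta>) k. \<exists>s'.
         has_circuit_of_size d k (weight_proj \<delta> d k \<mu> \<Delta>) s' \<and>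
         real s' \<le> 3 * (real s * real (\<delta> * d) ^ (2 * k ^ 3)))" (is ?A)
    and "(\<forall>lam\<in>partitions (d * \<delta>) k. \<exists>s'.
         has_circuit_of_size d k (isotypic_proj \<delta> d k lam \<Delta>) s' \<and>
         real s' \<le> 3 * (real s * real k ^ (2 * k ^ 2) * real (\<delta> * d) ^ (2 * k ^ 3)))" (is ?B)
    and "(\<forall>lam\<in>partitions (d * \<delta>) k. \<exists>s'.
         has_circuit_of_size d k (highest_weight_proj \<delta> d k lam \<Delta>) s' \<and>
         real s' \<le> 3 * (real s * real (k + 1) ^ (2 * k ^ 2) * real (\<delta> * d) ^ (2 * k ^ 3)))" (is ?C)
    and "(\<forall>lam\<in>partitions (d * \<delta>) k. \<forall>T\<in>semistandard k lam. \<exists>s'.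
         has_circuit_of_size d k (tableau_proj \<delta> d k T \<Delta>) s' \<and>
         real s' \<le> 3 * (real s * real k ^ (2 * k ^ 2) * real (\<delta> * d) ^ (2 * k ^ 4)))" (is ?D)
  proof -
    have "?A \<and> ?B \<and> ?C \<and> ?D"
    proof (cases "k = 0")
      case True
      \<comment> \<open>A positive degree cannot be attained without variables, so all four index
        sets are empty.\<close>
      have "expvecs (d * \<delta>) 0 = {}" using pos by (auto simp: expvecs_def)
      moreover have "partitions (d * \<delta>) 0 = {}" using pos by (auto simp: partitions_def)
      ultimately show ?thesis using True by simp
    next
      case False
      obtain q where q: "\<And>n. n \<le> k \<Longrightarrow> unitary_rep mscale (metapolys \<delta> d k) q meta_subst n (d * \<delta>)"
        using metapolys_unitary_rep[OF pos] by blast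
      interpret metapoly_reps \<delta> d k q by (rule metapoly_reps.intro) (use False pos q in auto)
      \<comment> \<open>One estimate covers all four claims: \<open>a \<ge> 1\<close> is the extra
        factor of each claim, and \<open>r \<ge> 2\<close> is the power of \<open>k\<close> in its
        exponent.\<close>
      have bound: "\<exists>s'. has_circuit_of_size d k x s' \<and> real s' \<le> 3 * (real s * a * real (\<delta> * d) ^ (2 * k ^ r))"
        if x: "x \<in> R.cyc \<Delta>" and a: "a \<ge> 1" and r: "r \<ge> 2" for x a r
      proof -
        obtain s' where s': "has_circuit_of_size d k x s'" "real s' \<le> 3 * (real s * real (\<delta> * d) ^ (2 * k\<^sup>2))"
          using cyc_circuit[OF _ _ x] asm by blast
        have "1 \<le> \<delta> * d" using pos by (simp add: Suc_le_eq)
        then have "1 \<le> real (\<delta> * d)" by (metis of_nat_1 of_nat_le_iff)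
        then have "real (\<delta> * d) ^ (2 * k\<^sup>2) \<le> real (\<delta> * d) ^ (2 * k ^ r)"
          using False r by (intro power_increasing mult_le_mono2) auto
        then have "real s * 1 * real (\<delta> * d) ^ (2 * k\<^sup>2) \<le> real s * a * real (\<delta> * d) ^ (2 * k ^ r)"
          using a by (intro mult_mono) auto
        then show ?thesis using s' by (intro exI[of _ s']) auto
      qed
      have ge1: "real k ^ (2 * k\<^sup>2) \<ge> 1" "real (k + 1) ^ (2 * k\<^sup>2) \<ge> 1" using False by auto
      have mem: "\<Delta> \<in> V" using asm by simp
      show ?thesis
      proof (intro conjI ballI)
        fix \<mu> assume "\<mu> \<in> expvecs (d * \<delta>) k"
        then show "\<exists>s'. has_circuit_of_size d k (weight_proj \<delta> d k \<mu> \<Delta>) s' \<and>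
            real s' \<le> 3 * (real s * real (\<delta> * d) ^ (2 * k ^ 3))"
          using bound[OF projections_in_cyc(1)[OF mem], of \<mu> 1 3] by simp
      next
        fix lam assume lam: "lam \<in> partitions (d * \<delta>) k"
        show "\<exists>s'. has_circuit_of_size d k (isotypic_proj \<delta> d k lam \<Delta>) s' \<and>
            real s' \<le> 3 * (real s * real k ^ (2 * k ^ 2) * real (\<delta> * d) ^ (2 * k ^ 3))"
          by (rule bound[OF projections_in_cyc(2)[OF mem lam] ge1(1)]) simp
        show "\<exists>s'. has_circuit_of_size d k (highest_weight_proj \<delta> d k lam \<Delta>) s' \<and>
            real s' \<le> 3 * (real s * real (k + 1) ^ (2 * k ^ 2) * real (\<delta> * d) ^ (2 * k ^ 3))"
          by (rule bound[OF projections_in_cyc(4)[OF mem lam] ge1(2)]) simp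
        fix T assume T: "T \<in> semistandard k lam"
        show "\<exists>s'. has_circuit_of_size d k (tableau_proj \<delta> d k T \<Delta>) s' \<and>
            real s' \<le> 3 * (real s * real k ^ (2 * k ^ 2) * real (\<delta> * d) ^ (2 * k ^ 4))"
          by (rule bound[OF projections_in_cyc(3)[OF mem lam T] ge1(1)]) simp
      qed
    qed
    then show ?A ?B ?C ?D by blast+
  qed
qed

end
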